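(* Let $\mathfrak g$ be one of $\mathfrak{sl}(m|n)$ ($m\neq n$), $\mathfrak{gl}(m|n)$, $\mathfrak{osp}(m|2n)$, $D(2,1,\alpha)$, $F(4)$, $G(3)$. Let $B=\{\beta_1,\ldots,\beta_k\}$ be a set of linearly independent mutually orthogonal isotropic roots, let $x=x_{\beta_1}+\cdots+x_{\beta_k}$ with $0\ne x_{\beta_i}\in\mathfrak g_{\beta_i}$, and let $ds_x:\mathcal J_{\mathfrak g}\to\mathcal J_{\mathfrak g_x}$ be the ring homomorphism determined by $ds_x([M])=[M_x]$. Let $f\in\mathcal J_{\mathfrak g}$. (1) $ds_x(f)=f|_{\mathfrak h_x}$. (2) If $B=\{\varepsilon_1-\delta_1\}$, then $ds_x(f)$ is given by substituting $x_1=y_1$ into $f$, i.e. $ds_x(f)=f|_{x_1=y_1}$. If $\mathfrak g=F(4)$ and $B=\{\frac12(\varepsilon_1+\varepsilon_2+\varepsilon_3-\delta_1)\}$, then $ds_x(f)$ is given by substituting $y_1=x_1x_2x_3$ into $f$. If $\mathfrak g=D(2,1,\alpha)$ and $B=\{\varepsilon_1-\varepsilon_2-\varepsilon_3\}$, then $ds_x(f)$ is given by substituting $x_1=x_2x_3$ into $f$. (3) If $B=\{\beta_i=a_i\varepsilon_{r_i}-b_i\delta_{s_i}\}_{i=1,\ldots,k}$ for some $a_i,b_i\in\{\pm1\}$, then $ds_x(f)=f|_{x_{r_i}^{a_i}=y_{s_i}^{b_i};\ i=1,\ldots,k}$. (4) $ds_x(f)=f|_{\beta_1=\cdots=\bet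a_k=0}$.
   Context: Everything is over $\mathbb C$; $\mathfrak h\subset\mathfrak g_{\bar0}$ is a Cartan subalgebra, $\Delta$ the roots, $(\cdot,\cdot)$ the even invariant form (also on $\mathfrak h^*$). An odd root $\beta$ is isotropic if $(\beta,\beta)=0$. Standard notation: $\mathfrak h^*$ is spanned by $\varepsilon_1,\ldots,\varepsilon_m,\delta_1,\ldots,\delta_n$ (the standard coordinates). Isotropic roots: $\pm(\varepsilon_i-\delta_j)$ for $\mathfrak{gl},\mathfrak{sl}$; $\pm\varepsilon_i\pm\delta_j$ for $\mathfrak{osp}$; $\pm\varepsilon_i\pm\delta_1$ ($1\le i\le3$, $\varepsilon_1+\varepsilon_2+\varepsilon_3=0$) for $G(3)$; $\frac12(\pm\varepsilon_1\pm\varepsilon_2\pm\varepsilon_3\pm\delta_1)$ for $F(4)$; $\pm\varepsilon_1\pm\varepsilon_2\pm\varepsilon_3$ for $D(2,1,\alpha)$. Put $x_i=e^{\varepsilon_i}$, $y_j=e^{\delta_j}$, except for $F(4)$, where $x_i=e^{\frac12\varepsilon_i}$, $y_j=e^{\frac12\delta_j}$. $\mathcal J_{\mathfrak g}$ (supercharacter ring) is the ring spanned over $\mathbb Z$ by the supercharacters $\operatorname{sch}M=\sum_\mu(\dim M^\mu_{\bar0}-\dim M^\mu_{\bar1})e^\mu$ of finite-dimensional $\mathfrak g$-modules $M$ (with weight decomposition); $[M]=\operatorname{sch}M$. Elements are viewed as functions on $\mathfrak h$ via $e^\mu(h)=e^{\mu(h)}$. Likewise $\mathcal J_{\mathfrak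 g_x}$ with respect to $\mathfrak h_x$. For $x$ as in the claim, $M_x=\ker_Mx/xM$ is a module over $\mathfrak g_x=\mathfrak g^x/[x,\mathfrak g]$, $\mathfrak g^x=\{a\mid[x,a]=0\}$. $\mathfrak g_x$ is embedded in $\mathfrak g^x$ as a subalgebra complementary to $[x,\mathfrak g]$, $\mathfrak g_x=\mathfrak h_x\oplus\bigoplus_{\alpha\in\Delta_x}\mathfrak g_\alpha$, with $\mathfrak h_x=\mathfrak h\cap\mathfrak g_x$ a Cartan subalgebra of $\mathfrak g_x$ and $\Delta_x=\{\alpha\in\Delta\mid(\alpha,\beta)=0\ \forall\beta\in B,\ \pm\alpha\notin B\}$. (For $\mathfrak{gl}(m|n)$ one takes the matrix embedding with zero rows and columns at the positions involved in $B$.) The right-hand sides in (2)–(4) denote the restriction of $f$ to the subspace of $\mathfrak h$ cut out by the given equations, i.e. to $\mathfrak h^x=\{h\in\mathfrak h\mid\beta_i(h)=0,\ 1\le i\le k\}$ (e.g. $x_1=y_1$ is the locus $\varepsilon_1=\delta_1$). One has $\mathfrak h^x=\mathfrak h_x\oplus\operatorname{span}\{h_{\beta_1},\ldots,h_{\beta_k}\}$, where $h_\beta$ spans $[\mathfrak g_\beta,\mathfrak g_{-\beta}]$, and functions on $\mathfrak h_x$ are identified with functions on $\mathfrak h^x$ via the projection along $\operatorname{span}\{h_{\beta_i}\}$ (e.g. $f|_{x_1=y_1=t}$ is independent of $t$ and is regarded as a function of the remaining variables). *)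

theory Defs
  imports
    Complex_Main
    "HOL-Library.FuncSet"
    "HOL-Library.Function_Algebras"
    "HOL-Algebra.Ring"
    "Jordan_Normal_Form.Matrix"
begin

section \<open>Linear algebra over the complex numbers\<close>

text \<open>The locale \<open>module\<close> of HOL-Algebra shadows the one of \<^theory>\<open>HOL.Modules\<close> meant
  here. The scalar multiplication is an argument of all notions.\<close>

type_synonym 'v scaling = "complex \<Rightarrow> 'v \<Rightarrow> 'v"

abbreviation csubspace :: "'v::ab_group_add scaling \<Rightarrow> 'v set \<Rightarrow> bool" where
  "csubspace \<equiv> Modules.module.subspace"

abbreviation cspan :: "'v::ab_group_add scaling \<Rightarrow> 'v set \<Rightarrow> 'v set" where
  "cspan \<equiv> Modules.module.span"

abbreviation cdependent :: "'v::ab_group_add scaling \<Rightarrow> 'v set \<Rightarrow> bool" where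
  "cdependent \<equiv> Modules.module.dependent"

abbreviation cdim :: "'v::ab_group_add scaling \<Rightarrow> 'v set \<Rightarrow> nat" where
  "cdim \<equiv> vector_space.dim"

definition set_sum :: "'v::ab_group_add set \<Rightarrow> 'v set \<Rightarrow> 'v set" where
  "set_sum S T = {a + b | a b. a \<in> S \<and> b \<in> T}"

definition super_space :: "'v::ab_group_add scaling \<Rightarrow> (bool \<Rightarrow> 'v set) \<Rightarrow> bool" where
  "super_space scale V \<longleftrightarrow>
     vector_space scale \<and>
     (\<forall>p. csubspace scale (V p)) \<and>
     V False \<inter> V True = {0} \<and>
     (\<exists>S. finite S \<and> V False \<union> V True \<subseteq> cspan scale S)"

definition linear_between ::
  "'v::ab_group_add scaling \<Rightarrow> 'v set \<Rightarrow> 'w::ab_group_add scaling \<Rightarrow> ('v \<Rightarrow> 'w) \<Rightarrow> bool" where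
  "linear_between s V t F \<longleftrightarrow>
     (\<forall>a\<in>V. \<forall>b\<in>V. F (a + b) = F a + F b) \<and> (\<forall>c. \<forall>a\<in>V. F (s c a) = t c (F a))"

definition bilinear_between ::
  "'u::ab_group_add scaling \<Rightarrow> 'u set \<Rightarrow> 'v::ab_group_add scaling \<Rightarrow> 'v set
    \<Rightarrow> 'w::ab_group_add scaling \<Rightarrow> ('u \<Rightarrow> 'v \<Rightarrow> 'w) \<Rightarrow> bool" where
  "bilinear_between r U s V t F \<longleftrightarrow>
     (\<forall>a\<in>U. linear_between s V t (F a)) \<and> (\<forall>b\<in>V. linear_between r U t (\<lambda>a. F a b))"


section \<open>Finite-dimensional Lie superalgebras\<close>

text \<open>Parities are Booleans, \<^term>\<open>False\<close> being even and \<^term>\<open>True\<close> odd, so that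
  the sum of the parities \<open>p\<close> and \<open>q\<close> is \<open>p \<noteq> q\<close>. An algebra lives on the direct sum of
  its two parts inside an ambient vector space, and outside of it the bracket is arbitrary.\<close>

definition ksign :: "bool \<Rightarrow> bool \<Rightarrow> complex" where
  "ksign p q = (if p \<and> q then - 1 else 1)"

record 'g lie_super =
  scl :: "'g scaling"
  part :: "bool \<Rightarrow> 'g set"
  brk :: "'g \<Rightarrow> 'g \<Rightarrow> 'g"

definition car :: "'g::ab_group_add lie_super \<Rightarrow> 'g set" where
  "car L = set_sum (part L False) (part L True)"

definition lie_superalgebra :: "'g::ab_group_add lie_super \<Rightarrow> bool" where
  "lie_superalgebra L \<longleftrightarrow>
     super_space (scl L) (part L) \<and>
     bilinear_between (scl L) (car L) (scl L) (car L) (scl L) (brk L) \<and>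
     (\<forall>p q. \<forall>a\<in>part L p. \<forall>b\<in>part L q.
        brk L a b \<in> part L (p \<noteq> q) \<and>
        brk L a b = - scl L (ksign p q) (brk L b a)) \<and>
     (\<forall>p q r. \<forall>a\<in>part L p. \<forall>b\<in>part L q. \<forall>c\<in>part L r.
        brk L a (brk L b c) =
          brk L (brk L a b) c + scl L (ksign p q) (brk L b (brk L a c)))"

definition subalgebra :: "'g::ab_group_add lie_super \<Rightarrow> 'g set \<Rightarrow> bool" where
  "subalgebra L S \<longleftrightarrow>
     csubspace (scl L) S \<and> S \<subseteq> car L \<and> (\<forall>a\<in>S. \<forall>b\<in>S. brk L a b \<in> S)"

definition graded_ideal :: "'g::ab_group_add lie_super \<Rightarrow> 'g set \<Rightarrow> bool" where
  "graded_ideal L I \<longleftrightarrow>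
     csubspace (scl L) I \<and> I = set_sum (I \<inter> part L False) (I \<inter> part L True) \<and>
     (\<forall>a\<in>car L. \<forall>b\<in>I. brk L a b \<in> I)"

definition sub_lsa :: "'g lie_super \<Rightarrow> 'g set \<Rightarrow> 'g lie_super" where
  "sub_lsa L S = L\<lparr>part := \<lambda>p. part L p \<inter> S\<rparr>"

primrec lower_central :: "'g::ab_group_add lie_super \<Rightarrow> 'g set \<Rightarrow> nat \<Rightarrow> 'g set" where
  "lower_central L H 0 = H"
| "lower_central L H (Suc n) = cspan (scl L) {brk L a b | a b. a \<in> H \<and> b \<in> lower_central L H n}"

text \<open>Cartan subalgebras of the even part: nilpotent and self-normalizing.\<close>

definition cartan_subalgebra :: "'g::ab_group_add lie_super \<Rightarrow> 'g set \<Rightarrow> bool" where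
  "cartan_subalgebra L H \<longleftrightarrow>
     subalgebra L H \<and> H \<subseteq> part L False \<and>
     (\<exists>n. lower_central L H n = {0}) \<and>
     {a \<in> part L False. \<forall>h\<in>H. brk L a h \<in> H} = H"

text \<open>Even, supersymmetric, invariant and nondegenerate bilinear forms.\<close>

definition invariant_form :: "'g::ab_group_add lie_super \<Rightarrow> ('g \<Rightarrow> 'g \<Rightarrow> complex) \<Rightarrow> bool" where
  "invariant_form L frm \<longleftrightarrow>
     bilinear_between (scl L) (car L) (scl L) (car L) (*) frm \<and>
     (\<forall>a\<in>part L False. \<forall>b\<in>part L True. frm a b = 0) \<and>
     (\<forall>p q. \<forall>a\<in>part L p. \<forall>b\<in>part L q. frm a b = ksign p q * frm b a) \<and>
     (\<forall>a\<in>car L. \<forall>b\<in>car L. \<forall>c\<in>car L. frm (brk L a b) c = frm a (brk L b c)) \<and>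
     (\<forall>a\<in>car L. (\<forall>b\<in>car L. frm a b = 0) \<longrightarrow> a = 0)"


section \<open>Roots\<close>

text \<open>A linear functional on \<open>H\<close> is represented by its extension by zero outside \<open>H\<close>.\<close>

definition dual :: "'g::ab_group_add lie_super \<Rightarrow> 'g set \<Rightarrow> ('g \<Rightarrow> complex) set" where
  "dual L H = {\<mu>. linear_between (scl L) H (*) \<mu> \<and> (\<forall>h. h \<notin> H \<longrightarrow> \<mu> h = 0)}"

definition root_space :: "'g::ab_group_add lie_super \<Rightarrow> 'g set \<Rightarrow> ('g \<Rightarrow> complex) \<Rightarrow> 'g set" where
  "root_space L H \<alpha> = {a \<in> car L. \<forall>h\<in>H. brk L h a = scl L (\<alpha> h) a}"

definition roots :: "'g::ab_group_add lie_super \<Rightarrow> 'g set \<Rightarrow> ('g \<Rightarrow> complex) set" where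
  "roots L H = {\<alpha> \<in> dual L H. \<alpha> \<noteq> 0 \<and> root_space L H \<alpha> \<noteq> {0}}"

definition odd_roots :: "'g::ab_group_add lie_super \<Rightarrow> 'g set \<Rightarrow> ('g \<Rightarrow> complex) set" where
  "odd_roots L H = {\<alpha> \<in> roots L H. root_space L H \<alpha> \<inter> part L True \<noteq> {0}}"

definition dual_vector :: "'g set \<Rightarrow> ('g \<Rightarrow> 'g \<Rightarrow> complex) \<Rightarrow> ('g \<Rightarrow> complex) \<Rightarrow> 'g" where
  "dual_vector H frm \<alpha> = (THE t. t \<in> H \<and> (\<forall>h\<in>H. frm t h = \<alpha> h))"

definition dual_form ::
  "'g set \<Rightarrow> ('g \<Rightarrow> 'g \<Rightarrow> complex) \<Rightarrow> ('g \<Rightarrow> complex) \<Rightarrow> ('g \<Rightarrow> complex) \<Rightarrow> complex" where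
  "dual_form H frm \<alpha> \<beta> = frm (dual_vector H frm \<alpha>) (dual_vector H frm \<beta>)"

definition isotropic_roots ::
  "'g::ab_group_add lie_super \<Rightarrow> 'g set \<Rightarrow> ('g \<Rightarrow> 'g \<Rightarrow> complex) \<Rightarrow> ('g \<Rightarrow> complex) set" where
  "isotropic_roots L H frm = {\<beta> \<in> odd_roots L H. dual_form H frm \<beta> \<beta> = 0}"

definition lin_indep_family :: "nat \<Rightarrow> (nat \<Rightarrow> 'g \<Rightarrow> complex) \<Rightarrow> bool" where
  "lin_indep_family k \<beta> \<longleftrightarrow>
     (\<forall>c :: nat \<Rightarrow> complex. (\<forall>h. (\<Sum>i<k. c i * \<beta> i h) = 0) \<longrightarrow> (\<forall>i<k. c i = 0))"


section \<open>The Lie superalgebras under consideration\<close>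

text \<open>\<open>OSP m n\<close> stands for \<open>osp(m|2n)\<close>.\<close>

datatype lsa_type = GL nat nat | SL nat nat | OSP nat nat | D21 complex | F4 | G3

primrec admissible :: "lsa_type \<Rightarrow> bool" where
  "admissible (GL m n) \<longleftrightarrow> True"
| "admissible (SL m n) \<longleftrightarrow> m \<noteq> n"
| "admissible (OSP m n) \<longleftrightarrow> True"
| "admissible (D21 a) \<longleftrightarrow> a \<noteq> 0 \<and> a \<noteq> - 1"
| "admissible F4 \<longleftrightarrow> True"
| "admissible G3 \<longleftrightarrow> True"

text \<open>The numbers of the coordinates \<open>\<epsilon>\<^sub>1, \<epsilon>\<^sub>2, \<dots>\<close> and \<open>\<delta>\<^sub>1, \<delta>\<^sub>2, \<dots>\<close>.\<close>

primrec num_eps :: "lsa_type \<Rightarrow> nat" where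
  "num_eps (GL m n) = m"
| "num_eps (SL m n) = m"
| "num_eps (OSP m n) = m div 2"
| "num_eps (D21 a) = 3"
| "num_eps F4 = 3"
| "num_eps G3 = 3"

primrec num_del :: "lsa_type \<Rightarrow> nat" where
  "num_del (GL m n) = n"
| "num_del (SL m n) = n"
| "num_del (OSP m n) = n"
| "num_del (D21 a) = 0"
| "num_del F4 = 1"
| "num_del G3 = 1"

subsection \<open>Matrix superalgebras\<close>

definition gl_part :: "nat \<Rightarrow> nat \<Rightarrow> bool \<Rightarrow> complex mat set" where
  "gl_part m n p = {A \<in> carrier_mat (m + n) (m + n).
     \<forall>i<m + n. \<forall>j<m + n. A $$ (i, j) \<noteq> 0 \<longrightarrow> ((i < m) \<noteq> (j < m)) = p}"

definition supertrace :: "nat \<Rightarrow> nat \<Rightarrow> complex mat \<Rightarrow> complex" where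
  "supertrace m n A = (\<Sum>i<m. A $$ (i, i)) - (\<Sum>i=m..<m + n. A $$ (i, i))"

definition sl_part :: "nat \<Rightarrow> nat \<Rightarrow> bool \<Rightarrow> complex mat set" where
  "sl_part m n p = {A \<in> gl_part m n p. supertrace m n A = 0}"

text \<open>The Gram matrix of an even supersymmetric form on the superspace of dimension \<open>m|2n\<close>,
  symmetric on the even and skew-symmetric on the odd part. It is antidiagonal on both parts, so
  that the diagonal matrices in \<open>osp(m|2n)\<close> form a Cartan subalgebra of the even part.\<close>

definition osp_gram :: "nat \<Rightarrow> nat \<Rightarrow> nat \<Rightarrow> nat \<Rightarrow> complex" where
  "osp_gram m n i j =
     (if i < m \<and> j < m then (if Suc (i + j) = m then 1 else 0)
      else if m \<le> i \<and> m \<le> j \<and> Suc ((i - m) + (j - m)) = 2 * n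
        then (if i - m < n then 1 else - 1)
      else 0)"

text \<open>\<open>A\<close> of parity \<open>p\<close> preserves the form \<open>B\<close> if
  \<open>B(A u, v) + (-1)\<^bsup>p|u|\<^esup> B(u, A v) = 0\<close>; below \<open>u\<close> and \<open>v\<close> are the basis vectors number
  \<open>i\<close> and \<open>j\<close>.\<close>

definition osp_part :: "nat \<Rightarrow> nat \<Rightarrow> bool \<Rightarrow> complex mat set" where
  "osp_part m n p = {A \<in> gl_part m (2 * n) p. \<forall>i<m + 2 * n. \<forall>j<m + 2 * n.
     (\<Sum>l<m + 2 * n. A $$ (l, i) * osp_gram m n l j)
       + ksign p (m \<le> i) * (\<Sum>l<m + 2 * n. osp_gram m n i l * A $$ (l, j)) = 0}"

text \<open>\<open>\<phi>\<close> identifies \<open>L\<close> with the matrix superalgebra having the parts \<open>P\<close> (the bracket being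
  the supercommutator of matrices of size \<open>d\<close>).\<close>

definition matrix_iso ::
  "'g::ab_group_add lie_super \<Rightarrow> nat \<Rightarrow> (bool \<Rightarrow> complex mat set) \<Rightarrow> ('g \<Rightarrow> complex mat) \<Rightarrow> bool" where
  "matrix_iso L d P \<phi> \<longleftrightarrow>
     inj_on \<phi> (car L) \<and> \<phi> ` car L \<subseteq> carrier_mat d d \<and> (\<forall>p. \<phi> ` part L p = P p) \<and>
     (\<forall>a\<in>car L. \<forall>b\<in>car L. \<phi> (a + b) = \<phi> a + \<phi> b) \<and>
     (\<forall>c. \<forall>a\<in>car L. \<phi> (scl L c a) = c \<cdot>\<^sub>m \<phi> a) \<and>
     (\<forall>p q. \<forall>a\<in>part L p. \<forall>b\<in>part L q.
        \<phi> (brk L a b) = \<phi> a * \<phi> b - ksign p q \<cdot>\<^sub>m (\<phi> b * \<phi> a))"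

text \<open>Standard coordinates on the diagonal matrices in a matrix superalgebra: matrices have
  indices starting from 0, the coordinates have indices starting from 1, and the first odd
  basis vector has number \<open>m\<close>.\<close>

definition matrix_coords ::
  "'g::ab_group_add lie_super \<Rightarrow> 'g set \<Rightarrow> nat \<Rightarrow> nat \<Rightarrow> nat \<Rightarrow> ('g \<Rightarrow> complex mat)
    \<Rightarrow> (nat \<Rightarrow> 'g \<Rightarrow> complex) \<Rightarrow> (nat \<Rightarrow> 'g \<Rightarrow> complex) \<Rightarrow> bool" where
  "matrix_coords L H m ne nd \<phi> eps del \<longleftrightarrow>
     H = {h \<in> car L. diagonal_mat (\<phi> h)} \<and>
     (\<forall>i\<in>{1..ne}. eps i = (\<lambda>h. if h \<in> H then \<phi> h $$ (i - 1, i - 1) else 0)) \<and>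
     (\<forall>j\<in>{1..nd}. del j = (\<lambda>h. if h \<in> H then \<phi> h $$ (m + j - 1, m + j - 1) else 0))"

subsection \<open>Exceptional superalgebras\<close>

text \<open>\<open>D(2,1,\<alpha>)\<close>, \<open>F(4)\<close> and \<open>G(3)\<close> are the contragredient Lie superalgebras (Kac) of the
  following invertible Cartan matrices, the simple root number 0 being the only odd one.
  \<open>contragredient L H r A e f hh\<close> says that \<open>L\<close> is the contragredient superalgebra of the
  invertible \<open>r \<times> r\<close> matrix \<open>A\<close> with Chevalley generators \<open>e\<close>, \<open>f\<close>, \<open>hh\<close>; the last
  conjunct says that \<open>L\<close> is the quotient by the maximal ideal meeting \<open>H\<close> trivially.\<close>

definition contragredient ::
  "'g::ab_group_add lie_super \<Rightarrow> 'g set \<Rightarrow> nat \<Rightarrow> complex mat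
    \<Rightarrow> (nat \<Rightarrow> 'g) \<Rightarrow> (nat \<Rightarrow> 'g) \<Rightarrow> (nat \<Rightarrow> 'g) \<Rightarrow> bool" where
  "contragredient L H r A e f hh \<longleftrightarrow>
     (\<forall>i<r. e i \<in> part L (i = 0) \<and> f i \<in> part L (i = 0) \<and> hh i \<in> part L False) \<and>
     inj_on hh {..<r} \<and> \<not> cdependent (scl L) (hh ` {..<r}) \<and>
     H = cspan (scl L) (hh ` {..<r}) \<and>
     (\<forall>i<r. \<forall>j<r.
        brk L (hh i) (hh j) = 0 \<and>
        brk L (e i) (f j) = (if i = j then hh i else 0) \<and>
        brk L (hh i) (e j) = scl L (A $$ (i, j)) (e j) \<and>
        brk L (hh i) (f j) = scl L (- A $$ (i, j)) (f j)) \<and>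
     (\<forall>S. subalgebra L S \<and> e ` {..<r} \<union> f ` {..<r} \<union> hh ` {..<r} \<subseteq> S \<longrightarrow> S = car L) \<and>
     (\<forall>I. graded_ideal L I \<and> I \<inter> H = {0} \<longrightarrow> I = {0})"

definition D21_cartan :: "complex \<Rightarrow> complex mat" where
  "D21_cartan a = mat_of_rows_list 3
     [[0, 1, a],
      [- 1, 2, 0],
      [- 1, 0, 2]]"

definition F4_cartan :: "complex mat" where
  "F4_cartan = mat_of_rows_list 4
     [[0, 1, 0, 0],
      [- 1, 2, - 2, 0],
      [0, - 1, 2, - 1],
      [0, 0, - 1, 2]]"

definition G3_cartan :: "complex mat" where
  "G3_cartan = mat_of_rows_list 3
     [[0, 1, 0],
      [- 1, 2, - 3],
      [0, - 1, 2]]"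

text \<open>The simple roots in the standard coordinates. The Cartan matrices above come from the forms
  \<^item> \<open>(\<epsilon>\<^sub>1,\<epsilon>\<^sub>1) = -(1+\<alpha>)/2\<close>, \<open>(\<epsilon>\<^sub>2,\<epsilon>\<^sub>2) = 1/2\<close>, \<open>(\<epsilon>\<^sub>3,\<epsilon>\<^sub>3) = \<alpha>/2\<close> for \<open>D(2,1,\<alpha>)\<close>,
  \<^item> \<open>(\<epsilon>\<^sub>i,\<epsilon>\<^sub>i) = 1\<close>, \<open>(\<delta>\<^sub>1,\<delta>\<^sub>1) = -3\<close> for \<open>F(4)\<close>,
  \<^item> \<open>(\<epsilon>\<^sub>i,\<epsilon>\<^sub>i) = -2\<close>, \<open>(\<epsilon>\<^sub>i,\<epsilon>\<^sub>j) = 1\<close> for \<open>i \<noteq> j\<close>, \<open>(\<delta>\<^sub>1,\<delta>\<^sub>1) = 2\<close> for \<open>G(3)\<close>,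

  all other products of coordinates being zero. Row \<open>i\<close> is \<open>2(\<alpha>\<^sub>i,\<alpha>\<^sub>j)/(\<alpha>\<^sub>i,\<alpha>\<^sub>i)\<close> for the
  even simple roots \<open>\<alpha>\<^sub>i\<close>, and a multiple of \<open>(\<alpha>\<^sub>0,\<alpha>\<^sub>j)\<close> for the odd one.\<close>

definition D21_simple :: "(nat \<Rightarrow> 'g \<Rightarrow> complex) \<Rightarrow> nat \<Rightarrow> 'g \<Rightarrow> complex" where
  "D21_simple eps j h =
     [eps 1 h - eps 2 h - eps 3 h, 2 * eps 2 h, 2 * eps 3 h] ! j"

definition F4_simple ::
  "(nat \<Rightarrow> 'g \<Rightarrow> complex) \<Rightarrow> (nat \<Rightarrow> 'g \<Rightarrow> complex) \<Rightarrow> nat \<Rightarrow> 'g \<Rightarrow> complex" where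
  "F4_simple eps del j h =
     [(del 1 h - eps 1 h - eps 2 h - eps 3 h) / 2, eps 3 h, eps 2 h - eps 3 h, eps 1 h - eps 2 h] ! j"

definition G3_simple ::
  "(nat \<Rightarrow> 'g \<Rightarrow> complex) \<Rightarrow> (nat \<Rightarrow> 'g \<Rightarrow> complex) \<Rightarrow> nat \<Rightarrow> 'g \<Rightarrow> complex" where
  "G3_simple eps del j h = [del 1 h + eps 3 h, eps 1 h, eps 2 h - eps 1 h] ! j"

text \<open>\<open>realizes X L H eps del\<close>: the superalgebra \<open>L\<close> with Cartan subalgebra \<open>H\<close> is the one of
  type \<open>X\<close>, and \<open>eps i\<close>, \<open>del j\<close> are the standard coordinates
  \<open>\<epsilon>\<^sub>i\<close> (\<open>1 \<le> i \<le> num_eps X\<close>) and \<open>\<delta>\<^sub>j\<close> (\<open>1 \<le> j \<le> num_del X\<close>).\<close>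

fun realizes ::
  "lsa_type \<Rightarrow> 'g::ab_group_add lie_super \<Rightarrow> 'g set
    \<Rightarrow> (nat \<Rightarrow> 'g \<Rightarrow> complex) \<Rightarrow> (nat \<Rightarrow> 'g \<Rightarrow> complex) \<Rightarrow> bool" where
  "realizes (GL m n) L H eps del \<longleftrightarrow>
     (\<exists>\<phi>. matrix_iso L (m + n) (gl_part m n) \<phi> \<and> matrix_coords L H m m n \<phi> eps del)"
| "realizes (SL m n) L H eps del \<longleftrightarrow>
     (\<exists>\<phi>. matrix_iso L (m + n) (sl_part m n) \<phi> \<and> matrix_coords L H m m n \<phi> eps del)"
| "realizes (OSP m n) L H eps del \<longleftrightarrow>
     (\<exists>\<phi>. matrix_iso L (m + 2 * n) (osp_part m n) \<phi> \<and>
          matrix_coords L H m (m div 2) n \<phi> eps del)"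
| "realizes (D21 a) L H eps del \<longleftrightarrow>
     (\<forall>i\<in>{1..3}. eps i \<in> dual L H) \<and>
     (\<exists>e f hh. contragredient L H 3 (D21_cartan a) e f hh \<and>
        (\<forall>i<3. \<forall>j<3. D21_simple eps j (hh i) = D21_cartan a $$ (i, j)))"
| "realizes F4 L H eps del \<longleftrightarrow>
     (\<forall>i\<in>{1..3}. eps i \<in> dual L H) \<and> del 1 \<in> dual L H \<and>
     (\<exists>e f hh. contragredient L H 4 F4_cartan e f hh \<and>
        (\<forall>i<4. \<forall>j<4. F4_simple eps del j (hh i) = F4_cartan $$ (i, j)))"
| "realizes G3 L H eps del \<longleftrightarrow>
     (\<forall>i\<in>{1..3}. eps i \<in> dual L H) \<and> del 1 \<in> dual L H \<and>
     (\<forall>h. eps 1 h + eps 2 h + eps 3 h = 0) \<and>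
     (\<exists>e f hh. contragredient L H 3 G3_cartan e f hh \<and>
        (\<forall>i<3. \<forall>j<3. G3_simple eps del j (hh i) = G3_cartan $$ (i, j)))"


section \<open>Modules and supercharacters\<close>

record ('g, 'v) super_mod =
  mscl :: "'v scaling"
  mpart :: "bool \<Rightarrow> 'v set"
  act :: "'g \<Rightarrow> 'v \<Rightarrow> 'v"

definition mcar :: "('g, 'v::ab_group_add) super_mod \<Rightarrow> 'v set" where
  "mcar M = set_sum (mpart M False) (mpart M True)"

definition weight_space ::
  "'g set \<Rightarrow> ('g, 'v::ab_group_add) super_mod \<Rightarrow> ('g \<Rightarrow> complex) \<Rightarrow> bool \<Rightarrow> 'v set" where
  "weight_space H M \<mu> p = {v \<in> mpart M p. \<forall>h\<in>H. act M h v = mscl M (\<mu> h) v}"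

definition lsa_module :: "'g::ab_group_add lie_super \<Rightarrow> ('g, 'v::ab_group_add) super_mod \<Rightarrow> bool" where
  "lsa_module L M \<longleftrightarrow>
     super_space (mscl M) (mpart M) \<and>
     bilinear_between (scl L) (car L) (mscl M) (mcar M) (mscl M) (act M) \<and>
     (\<forall>p q. \<forall>a\<in>part L p. \<forall>v\<in>mpart M q. act M a v \<in> mpart M (p \<noteq> q)) \<and>
     (\<forall>p q. \<forall>a\<in>part L p. \<forall>b\<in>part L q. \<forall>v\<in>mcar M.
        act M (brk L a b) v =
          act M a (act M b v) - mscl M (ksign p q) (act M b (act M a v)))"

definition weight_module ::
  "'g::ab_group_add lie_super \<Rightarrow> 'g set \<Rightarrow> ('g, 'v::ab_group_add) super_mod \<Rightarrow> bool" where
  "weight_module L H M \<longleftrightarrow>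
     lsa_module L M \<and>
     (\<forall>p. mpart M p = cspan (mscl M) (\<Union>\<mu>\<in>dual L H. weight_space H M \<mu> p))"

text \<open>Supercharacters as functions on \<open>H\<close>, \<open>e\<^sup>\<mu>\<close> being the function \<open>h \<mapsto> exp (\<mu> h)\<close>.\<close>

definition sch ::
  "'g::ab_group_add lie_super \<Rightarrow> 'g set \<Rightarrow> ('g, 'v::ab_group_add) super_mod \<Rightarrow> 'g \<Rightarrow> complex" where
  "sch L H M = (\<lambda>h\<in>H. \<Sum>\<mu> | \<mu> \<in> dual L H \<and> (\<exists>p. weight_space H M \<mu> p \<noteq> {0}).
     (of_nat (cdim (mscl M) (weight_space H M \<mu> False))
       - of_nat (cdim (mscl M) (weight_space H M \<mu> True))) * exp (\<mu> h))"

text \<open>The supercharacter ring. Every finite-dimensional superspace is isomorphic to one inside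
  \<^typ>\<open>nat \<Rightarrow> complex\<close>, so it suffices to consider modules over this type.\<close>

type_synonym 'g fd_mod = "('g, nat \<Rightarrow> complex) super_mod"

definition supchar_ring :: "'g::ab_group_add lie_super \<Rightarrow> 'g set \<Rightarrow> ('g \<Rightarrow> complex) ring" where
  "supchar_ring L H =
     \<lparr>carrier = {F. \<exists>N (c :: nat \<Rightarrow> int) (M :: nat \<Rightarrow> 'g fd_mod).
                  (\<forall>i<N. weight_module L H (M i)) \<and>
                  F = (\<lambda>h\<in>H. \<Sum>i<N. of_int (c i) * sch L H (M i) h)},
      mult = (\<lambda>F G. \<lambda>h\<in>H. F h * G h),
      one = (\<lambda>h\<in>H. 1),
      zero = (\<lambda>h\<in>H. 0),
      add = (\<lambda>F G. \<lambda>h\<in>H. F h + G h)\<rparr>"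


section \<open>The Duflo-Serganova functor\<close>

definition centralizer :: "'g::ab_group_add lie_super \<Rightarrow> 'g \<Rightarrow> 'g set" where
  "centralizer L x = {a \<in> car L. brk L x a = 0}"

definition ds_roots ::
  "'g::ab_group_add lie_super \<Rightarrow> 'g set \<Rightarrow> ('g \<Rightarrow> 'g \<Rightarrow> complex) \<Rightarrow> ('g \<Rightarrow> complex) set
    \<Rightarrow> ('g \<Rightarrow> complex) set" where
  "ds_roots L H frm B =
     {\<alpha> \<in> roots L H. (\<forall>\<beta>\<in>B. dual_form H frm \<alpha> \<beta> = 0) \<and> \<alpha> \<notin> B \<and> - \<alpha> \<notin> B}"

text \<open>\<open>gx\<close> is an admissible copy of \<open>g\<^sup>x / [x, g]\<close> inside \<open>g\<^sup>x\<close>, with Cartan subalgebra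
  \<open>H \<inter> gx\<close>.\<close>

definition ds_subalgebra ::
  "'g::ab_group_add lie_super \<Rightarrow> 'g set \<Rightarrow> ('g \<Rightarrow> 'g \<Rightarrow> complex) \<Rightarrow> ('g \<Rightarrow> complex) set
    \<Rightarrow> 'g \<Rightarrow> 'g set \<Rightarrow> bool" where
  "ds_subalgebra L H frm B x gx \<longleftrightarrow>
     subalgebra L gx \<and>
     gx \<inter> brk L x ` car L = {0} \<and> set_sum gx (brk L x ` car L) = centralizer L x \<and>
     gx = cspan (scl L) ((H \<inter> gx) \<union> (\<Union>\<alpha>\<in>ds_roots L H frm B. root_space L H \<alpha>)) \<and>
     cartan_subalgebra (sub_lsa L gx) (H \<inter> gx)"

text \<open>\<open>Q\<close> is the \<open>gx\<close>-module \<open>M\<^sub>x = ker x / x M\<close>, the quotient map being \<open>\<pi>\<close>.\<close>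

definition ds_quotient ::
  "'g::ab_group_add lie_super \<Rightarrow> 'g set \<Rightarrow> 'g \<Rightarrow> ('g, 'v::ab_group_add) super_mod
    \<Rightarrow> ('g, 'w::ab_group_add) super_mod \<Rightarrow> ('v \<Rightarrow> 'w) \<Rightarrow> bool" where
  "ds_quotient L gx x M Q \<pi> \<longleftrightarrow>
     lsa_module (sub_lsa L gx) Q \<and>
     (let K = {v \<in> mcar M. act M x v = 0} in
        linear_between (mscl M) K (mscl Q) \<pi> \<and>
        (\<forall>p. \<pi> ` (K \<inter> mpart M p) = mpart Q p) \<and>
        {v \<in> K. \<pi> v = 0} = act M x ` mcar M \<and>
        (\<forall>a\<in>gx. \<forall>v\<in>K. \<pi> (act M a v) = act Q a (\<pi> v)))"

definition ds_hom ::
  "'g::ab_group_add lie_super \<Rightarrow> 'g set \<Rightarrow> 'g set \<Rightarrow> 'g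
    \<Rightarrow> (('g \<Rightarrow> complex) \<Rightarrow> ('g \<Rightarrow> complex)) \<Rightarrow> bool" where
  "ds_hom L H gx x ds \<longleftrightarrow>
     ds \<in> ring_hom (supchar_ring L H) (supchar_ring (sub_lsa L gx) (H \<inter> gx)) \<and>
     (\<forall>(M :: 'g fd_mod) (Q :: 'g fd_mod) \<pi>.
        weight_module L H M \<and> ds_quotient L gx x M Q \<pi> \<longrightarrow>
        ds (sch L H M) = sch (sub_lsa L gx) (H \<inter> gx) Q)"

text \<open>\<open>h\<^sup>x\<close>, the common kernel of \<open>B\<close>, and the span of all \<open>h\<^sub>\<beta>\<close> (\<open>\<beta> \<in> B\<close>), where \<open>h\<^sub>\<beta>\<close> spans
  \<open>[g\<^sub>\<beta>, g\<^sub>-\<^sub>\<beta>]\<close>.\<close>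

definition common_kernel :: "'g set \<Rightarrow> ('g \<Rightarrow> complex) set \<Rightarrow> 'g set" where
  "common_kernel H B = {h \<in> H. \<forall>\<beta>\<in>B. \<beta> h = 0}"

definition coroot_span ::
  "'g::ab_group_add lie_super \<Rightarrow> 'g set \<Rightarrow> ('g \<Rightarrow> complex) set \<Rightarrow> 'g set" where
  "coroot_span L H B = cspan (scl L)
     (\<Union>\<beta>\<in>B. {brk L a b | a b. a \<in> root_space L H \<beta> \<and> b \<in> root_space L H (- \<beta>)})"

definition proj_along :: "'g::ab_group_add set \<Rightarrow> 'g set \<Rightarrow> 'g \<Rightarrow> 'g" where
  "proj_along U W h = (THE u. u \<in> U \<and> h - u \<in> W)"

text \<open>The function on \<open>h\<^sup>x\<close> identified with the function \<open>F\<close> on \<open>h\<^sub>x = H \<inter> gx\<close>.\<close>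

definition pullback ::
  "'g::ab_group_add lie_super \<Rightarrow> 'g set \<Rightarrow> ('g \<Rightarrow> complex) set \<Rightarrow> 'g set
    \<Rightarrow> ('g \<Rightarrow> complex) \<Rightarrow> 'g \<Rightarrow> complex" where
  "pullback L H B gx F =
     (\<lambda>h\<in>common_kernel H B. F (proj_along (H \<inter> gx) (coroot_span L H B) h))"

end

theory Submission
  imports Defs
begin

text \<open>On a finite-dimensional module \<open>M\<close> the operator \<open>x\<close> is an odd differential commuting with
  \<open>h\<^sup>x = {h | \<beta>\<^sub>1(h) = \<dots> = \<beta>\<^sub>k(h) = 0}\<close>, so by rank--nullity each eigenspace of \<open>h \<in> h\<^sup>x\<close> has the same
  superdimension on \<open>M\<close> and on the homology \<open>M\<^sub>x\<close>. Every \<open>h\<^sub>\<beta>\<close> with \<open>\<beta> \<in> B\<close> is a bracket \<open>[x, y]\<close>, hence acts by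
  zero on \<open>M\<^sub>x\<close>; this makes \<open>sch M\<close> on \<open>h\<^sup>x\<close> the pullback of \<open>sch M\<^sub>x\<close> along \<open>h\<^sup>x \<rightarrow> h\<^sub>x\<close>.

  The only property of the individual superalgebras that enters, besides the root decomposition, is
  that no even root is isotropic. It gives \<open>[x, x] = 0\<close>, the oddness of the root vectors of \<open>\<beta>\<close>,
  and the vanishing of \<open>[g\<^sub>\<beta>, g\<^sub>-\<^sub>\<beta>\<^sub>']\<close> for distinct \<open>\<beta>, \<beta>' \<in> B\<close>.\<close>

section \<open>Weight decompositions\<close>

text \<open>The comparison is made at one \<open>h\<close> at a time and through eigenvalues of
  \<open>act M h\<close>, not through weights: distinct weights may agree at \<open>h\<close>, and
  replacing \<open>h\<close> by its component \<open>u\<close> in h_x changes the operator on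
  \<open>M\<close>, though not the one on the homology. So only the superdimensions of eigenspaces
  are compared, each weighted by exp of its eigenvalue.

  \<open>ds_hom\<close> prescribes \<open>ds\<close> only on modules over
  \<open>nat \<Rightarrow> complex\<close>. The homology must therefore be realised over the type of
  \<open>M\<close>, which is why representatives replace cosets throughout.

  No root system is computed. If an even root \<gamma> had (\<gamma>,\<gamma>) = 0, two root vectors
  paired nontrivially by the form would span a Heisenberg algebra with centre in \<open>H\<close>.
  In a matrix algebra a trace forbids this; in a contragredient algebra the centre would have to act
  by zero on every simple root vector, hence vanish because the Cartan matrix is invertible.\<close>

locale cvector_space = vector_space scale for scale :: "complex \<Rightarrow> 'v::ab_group_add \<Rightarrow> 'v"
begin

section \<open>Maps that are linear only on a subspace\<close>

lemma linear_between_zero: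
  assumes "subspace V" "linear_between scale V scale f"
  shows "f 0 = 0"
proof -
  have "f (scale 0 0) = scale 0 (f 0)"
    using assms subspace_0 unfolding linear_between_def by blast
  then show ?thesis by simp
qed

lemma linear_between_minus:
  assumes "subspace V" "linear_between scale V scale f" "v \<in> V"
  shows "f (- v) = - f v"
proof -
  have "f (scale (- 1) v) = scale (- 1) (f v)"
    using assms unfolding linear_between_def by blast
  then show ?thesis by simp
qed

lemma linear_between_diff:
  assumes "subspace V" "linear_between scale V scale f" "v \<in> V" "w \<in> V"
  shows "f (v - w) = f v - f w"
proof -
  have "f (v + - w) = f v + f (- w)"
    using assms subspace_neg unfolding linear_between_def by blast
  then show ?thesis using linear_between_minus[OF assms(1,2,4)] by simp
qed

lemma linear_between_sum:
  assumes "subspace V" "linear_between scale V scale f" "\<And>i. i \<in> F \<Longrightarrow> v i \<in> V"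
  shows "f (\<Sum>i\<in>F. v i) = (\<Sum>i\<in>F. f (v i))"
  using assms(3)
proof (induction F rule: infinite_finite_induct)
  case (insert j F)
  moreover have "(\<Sum>i\<in>F. v i) \<in> V"
    using insert by (intro subspace_sum[OF assms(1)]) auto
  ultimately show ?case
    using assms(2) unfolding linear_between_def by simp
qed (use linear_between_zero[OF assms(1,2)] in auto)

lemma linear_between_mono:
  "linear_between scale V scale f \<Longrightarrow> W \<subseteq> V \<Longrightarrow> linear_between scale W scale f"
  by (simp add: linear_between_def subset_iff)

lemma subspace_linear_image:
  assumes "subspace V" "linear_between scale V scale f"
  shows "subspace (f ` V)"
proof (rule subspaceI)
  show "0 \<in> f ` V"
    using linear_between_zero[OF assms] subspace_0[OF assms(1)] by force
next
  fix a b assume "a \<in> f ` V" "b \<in> f ` V"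
  then obtain v w where "v \<in> V" "w \<in> V" "a = f v" "b = f w" by blast
  then show "a + b \<in> f ` V"
    using assms subspace_add unfolding linear_between_def by (metis image_eqI)
next
  fix c a assume "a \<in> f ` V"
  then obtain v where "v \<in> V" "a = f v" by blast
  then show "scale c a \<in> f ` V"
    using assms subspace_scale unfolding linear_between_def by (metis image_eqI)
qed

lemma subspace_linear_kernel:
  assumes "subspace V" "linear_between scale V scale f"
  shows "subspace {v \<in> V. f v = 0}"
proof (rule subspaceI)
  show "0 \<in> {v \<in> V. f v = 0}"
    using linear_between_zero[OF assms] subspace_0[OF assms(1)] by simp
qed (use assms subspace_add subspace_scale in \<open>auto simp: linear_between_def\<close>)

section \<open>Bases, complements and dimension counts\<close>

lemma finite_basis:
  assumes "subspace V" "finite S" "V \<subseteq> span S"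
  obtains B where "finite B" "B \<subseteq> V" "independent B" "span B = V" "card B = dim V"
proof -
  obtain B where B: "B \<subseteq> V" "independent B" "V \<subseteq> span B" "card B = dim V" by (rule basis_exists)
  have "finite B" using independent_span_bound[OF assms(2) B(2)] B(1) assms(3) by auto
  then show ?thesis using that B span_subspace[OF B(1,3) assms(1)] by blast
qed

lemma independent_Un:
  assumes "finite A" "independent A" "independent B" "span A \<inter> span B = {0}"
  shows "independent (A \<union> B)"
  using assms
proof (induction A rule: finite_induct)
  case (insert a A)
  have "independent A" using insert.prems(1) independent_mono by blast
  moreover have "span A \<subseteq> span (insert a A)" by (rule span_mono) auto
  ultimately have IH: "independent (A \<union> B)" "span A \<inter> span B = {0}"
    using insert span_zero by auto
  have "a \<notin> span (A \<union> B)"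
  proof
    assume "a \<in> span (A \<union> B)"
    then obtain u w where u: "u \<in> span A" and w: "w \<in> span B" and a: "a = u + w"
      unfolding span_Un by blast
    have "w = a - u" using a by simp
    then have "w \<in> span (insert a A)"
      using u \<open>span A \<subseteq> span (insert a A)\<close> by (auto intro: span_diff span_base)
    with w insert.prems(3) have "w = 0" by blast
    then have "a \<in> span A" using a u by simp
    with insert.prems(1) insert.hyps(2) show False
      using independent_insert[of a A] by auto
  qed
  then show ?case using IH independent_insertI by simp
qed simp

text \<open>Coordinates with respect to \<open>B\<close> are unique, so those of a common vector are
  supported both in \<open>A\<close> and off \<open>A\<close>, hence nowhere.\<close>

lemma span_Int_span_Diff:
  assumes B: "independent B" "A \<subseteq> B"
  shows "span A \<inter> span (B - A) = {0}"
proof -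
  have "v = 0" if v: "v \<in> span A" "v \<in> span (B - A)" for v
  proof (rule ccontr)
    assume "v \<noteq> 0"
    have "representation (B - A) v = representation B v"
      using representation_extend[OF B(1) v(2)] by auto
    moreover have "representation A v = representation B v"
      using representation_extend[OF B(1) v(1) B(2)] by auto
    ultimately have "representation B v b = 0" for b
      by (metis DiffD2 representation_ne_zero)
    moreover have "v \<in> span B" using v(1) span_mono[OF B(2)] by auto
    ultimately show False
      using sum_nonzero_representation_eq[OF B(1)] \<open>v \<noteq> 0\<close> by force
  qed
  then show ?thesis using span_zero by blast
qed

text \<open>Extend a basis of \<open>I\<close> to one of \<open>K\<close>; the new basis vectors
  span the complement. The last clause has the form in which homology classes will be
  represented.\<close>

lemma complement_exists:
  assumes "subspace I" "subspace K" "I \<subseteq> K"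
  obtains C where "subspace C" "C \<subseteq> K" "C \<inter> I = {0}" "\<And>v. v \<in> K \<Longrightarrow> \<exists>u\<in>C. v - u \<in> I"
proof -
  obtain A where A: "A \<subseteq> I" "independent A" "I \<subseteq> span A" by (rule maximal_independent_subset)
  have "A \<subseteq> K" using A(1) assms(3) by simp
  obtain B where B: "A \<subseteq> B" "B \<subseteq> K" "independent B" "K \<subseteq> span B"
    by (rule maximal_independent_subset_extend[OF \<open>A \<subseteq> K\<close> A(2)])
  have I: "span A = I" by (rule span_subspace[OF A(1,3) assms(1)])
  show thesis
  proof (rule that)
    show "span (B - A) \<subseteq> K" using B(2) by (intro span_minimal assms) auto
    show "span (B - A) \<inter> I = {0}" using span_Int_span_Diff[OF B(3,1)] I by auto
    fix v assume "v \<in> K"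
    then have "v \<in> span (A \<union> (B - A))" using B(1,4) by (simp add: Un_absorb1 subset_iff)
    then obtain y z where "y \<in> span A" "z \<in> span (B - A)" "v = y + z" unfolding span_Un by blast
    then show "\<exists>u\<in>span (B - A). v - u \<in> I" using I by auto
  qed simp
qed

lemma dim_direct_sum:
  assumes "subspace U" "subspace W" "U \<inter> W = {0}" "finite S" "U \<subseteq> span S" "W \<subseteq> span S"
  shows "dim (span (U \<union> W)) = dim U + dim W"
proof -
  obtain A where A: "finite A" "A \<subseteq> U" "independent A" "span A = U" "card A = dim U"
    by (rule finite_basis[OF assms(1,4,5)])
  obtain B where B: "finite B" "B \<subseteq> W" "independent B" "span B = W" "card B = dim W"
    by (rule finite_basis[OF assms(2,4,6)])
  have ind: "independent (A \<union> B)" using A B assms(3) by (intro independent_Un) auto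
  have "A \<inter> B = {}"
  proof (rule ccontr)
    assume "A \<inter> B \<noteq> {}"
    then obtain z where z: "z \<in> A" "z \<in> B" by blast
    then have "z \<in> U \<inter> W" using A(2) B(2) by auto
    then have "0 \<in> A" using z(1) assms(3) by simp
    then show False using A(3) dependent_zero by blast
  qed
  then have "card (A \<union> B) = dim U + dim W" using A B by (simp add: card_Un_disjoint)
  moreover have "span (A \<union> B) = span (U \<union> W)"
    using assms(1,2) by (simp add: span_Un A(4) B(4) span_eq_iff[THEN iffD2])
  ultimately show ?thesis using dim_span_eq_card_independent[OF ind] by simp
qed

text \<open>As \<open>f\<close> is linear only on \<open>V\<close>, it is replaced by a globally
  linear \<open>g\<close> with the same values on a basis \<open>B\<close> of \<open>V\<close>
  extending a basis \<open>A\<close> of the kernel. Then \<open>g\<close> is injective on the span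
  of \<open>B - A\<close> and maps it onto the image of \<open>f\<close>.\<close>

lemma rank_nullity:
  assumes V: "subspace V" "finite S" "V \<subseteq> span S" and f: "linear_between scale V scale f"
  shows "dim V = dim {v \<in> V. f v = 0} + dim (f ` V)"
proof -
  let ?K = "{v \<in> V. f v = 0}"
  obtain A where A: "finite A" "A \<subseteq> ?K" "independent A" "span A = ?K" "card A = dim ?K"
    by (rule finite_basis[OF subspace_linear_kernel[OF V(1) f] V(2)]) (use V(3) in auto)
  obtain B where B: "A \<subseteq> B" "B \<subseteq> V" "independent B" "V \<subseteq> span B"
    using maximal_independent_subset_extend[of A V] A(2,3) by auto
  have finB: "finite B" using independent_span_bound[OF V(2) B(3)] B(2) V(3) by auto
  interpret P: vector_space_pair scale scale ..
  define g where "g = P.construct B f"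
  have g: "Vector_Spaces.linear scale scale g"
    unfolding g_def by (rule P.linear_construct[OF B(3)])
  then interpret g: module_hom scale scale g unfolding module_hom_iff_linear .
  have gf: "g v = f v" if "v \<in> V" for v
  proof -
    have "v \<in> span B" using B(4) that by blast
    then have "v \<in> V \<and> g v = f v"
    proof (induction rule: span_induct_alt)
      case base
      then show ?case using linear_between_zero[OF V(1) f] subspace_0[OF V(1)] by simp
    next
      case (step c x y)
      have "x \<in> V" using step(1) B(2) by auto
      moreover have "g x = f x" unfolding g_def by (rule P.construct_basis[OF B(3) step(1)])
      ultimately show ?case using step f V(1)
        by (simp add: linear_between_def g.add g.scale subspace_scale subspace_add)
    qed
    then show ?thesis ..
  qed
  let ?D = "B - A"
  have indD: "independent ?D" using B(3) independent_mono by blast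
  have spD: "span ?D \<subseteq> V" using B(2) V(1) by (intro span_minimal) auto
  have inj: "inj_on g (span ?D)"
  proof -
    have "v = 0" if "v \<in> span ?D" "g v = 0" for v
    proof -
      have "v \<in> span A" using that spD gf A(4) by auto
      then show ?thesis using that(1) span_Int_span_Diff[OF B(3,1)] by blast
    qed
    then show ?thesis using g.inj_on_iff_eq_0[OF subspace_span] by blast
  qed
  have "independent (g ` ?D)" by (rule g.independent_injective_image[OF indD inj])
  moreover have "span (g ` ?D) = f ` V"
  proof -
    have "span (g ` ?D) = span (g ` B)"
    proof -
      have "g ` B \<subseteq> insert 0 (g ` ?D)" using A(2) gf by auto
      moreover have "insert 0 (g ` ?D) \<subseteq> span (g ` ?D)"
        using span_zero span_base by auto
      ultimately have "span (g ` B) \<subseteq> span (g ` ?D)"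
        by (metis order_trans span_minimal subspace_span)
      moreover have "span (g ` ?D) \<subseteq> span (g ` B)" by (rule span_mono) auto
      ultimately show ?thesis by auto
    qed
    also have "\<dots> = g ` span B" by (rule g.span_image)
    also have "span B = V" using B V(1) span_subspace by blast
    also have "g ` V = f ` V" using gf by auto
    finally show ?thesis .
  qed
  ultimately have "dim (f ` V) = card (g ` ?D)"
    using dim_span_eq_card_independent by metis
  also have "\<dots> = card ?D"
    by (rule card_image, rule inj_on_subset[OF inj span_superset])
  also have "\<dots> = card B - card A" using finB B(1) by (meson card_Diff_subset finite_subset)
  finally show ?thesis
    using A(5) basis_card_eq_dim[OF B(2,4,3)] card_mono[OF finB B(1)] by simp
qed

text \<open>Root spaces of an algebra, weight spaces of a module and, for a one-element
  \<open>T\<close>, eigenspaces of a single operator all have this form, so the results below serve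
  each of them.\<close>

definition wsp :: "'v set \<Rightarrow> 't set \<Rightarrow> ('t \<Rightarrow> 'v \<Rightarrow> 'v) \<Rightarrow> ('t \<Rightarrow> complex) \<Rightarrow> 'v set" where
  "wsp V T A \<mu> = {v \<in> V. \<forall>h\<in>T. A h v = scale (\<mu> h) v}"

lemma subspace_wsp:
  assumes "subspace V" "\<And>h. h \<in> T \<Longrightarrow> linear_between scale V scale (A h)"
  shows "subspace (wsp V T A \<mu>)"
proof (rule subspaceI)
  show "0 \<in> wsp V T A \<mu>"
    using assms linear_between_zero[OF assms(1)] subspace_0 by (simp add: wsp_def)
qed (use assms subspace_add subspace_scale in
     \<open>auto simp: wsp_def linear_between_def scale_right_distrib\<close>)

text \<open>Choose \<open>h\<close> separating i from j. The operator \<open>A h\<close> minus the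
  scalar \<open>w j h\<close> keeps the sum in \<open>S\<close>, kills component j and multiplies
  component i by a nonzero scalar. Other components may be killed too, which is harmless because the
  induction is over arbitrary weight vectors. For \<open>S = {0}\<close> this is the independence of
  vectors of distinct weights.\<close>

lemma components_in_stable_subspace:
  assumes V: "subspace V" "\<And>h. h \<in> T \<Longrightarrow> linear_between scale V scale (A h)"
    and S: "subspace S" "\<And>h v. h \<in> T \<Longrightarrow> v \<in> S \<Longrightarrow> A h v \<in> S"
    and fin: "finite F"
    and v: "\<And>i. i \<in> F \<Longrightarrow> v i \<in> wsp V T A (w i)"
    and sep: "\<And>i j. i \<in> F \<Longrightarrow> j \<in> F \<Longrightarrow> i \<noteq> j \<Longrightarrow> \<exists>h\<in>T. w i h \<noteq> w j h"
    and sum: "(\<Sum>i\<in>F. v i) \<in> S"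
    and i: "i \<in> F"
  shows "v i \<in> S"
  using fin v sep sum i
proof (induction F arbitrary: v i rule: finite_induct)
  case (insert j F)
  have vV: "v i \<in> V" if "i \<in> insert j F" for i using insert.prems(1)[OF that] by (simp add: wsp_def)
  have F: "v i \<in> S" if iF: "i \<in> F" for i
  proof -
    have "i \<noteq> j" using iF insert.hyps by auto
    then obtain h where h: "h \<in> T" "w i h \<noteq> w j h" using insert.prems(2)[of i j] iF by auto
    let ?s = "\<Sum>i\<in>insert j F. v i"
    have "A h ?s - scale (w j h) ?s \<in> S"
      by (intro subspace_diff subspace_scale S h insert.prems(3))
    also have "A h ?s = (\<Sum>i\<in>insert j F. A h (v i))"
      by (rule linear_between_sum[OF V(1) V(2)[OF h(1)] vV])
    also have "\<dots> = (\<Sum>i\<in>insert j F. scale (w i h) (v i))"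
      using insert.prems(1) h(1) by (intro sum.cong) (auto simp: wsp_def)
    also have "\<dots> - scale (w j h) ?s = (\<Sum>i\<in>insert j F. scale (w i h - w j h) (v i))"
      by (simp add: scale_sum_right scale_left_diff_distrib sum_subtractf insert.hyps scale_right_distrib)
    also have "\<dots> = (\<Sum>i\<in>F. scale (w i h - w j h) (v i))"
      using insert.hyps by simp
    finally have "scale (w i h - w j h) (v i) \<in> S"
      using insert.prems(1,2) subspace_wsp[OF V] iF
      by (intro insert.IH[of "\<lambda>i. scale (w i h - w j h) (v i)" i])
        (auto intro!: subspace_scale)
    then have "scale (inverse (w i h - w j h)) (scale (w i h - w j h) (v i)) \<in> S"
      by (rule subspace_scale[OF S(1)])
    then show ?thesis using h by simp
  qed
  have "v j = (\<Sum>i\<in>insert j F. v i) - (\<Sum>i\<in>F. v i)" using insert.hyps by simp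
  moreover have "(\<Sum>i\<in>F. v i) \<in> S" using F by (rule subspace_sum[OF S(1)])
  ultimately have "v j \<in> S" using subspace_diff[OF S(1) insert.prems(3)] by simp
  then show ?case using F insert.prems(4) by auto
qed simp

text \<open>Terms from the same space can be merged, so one vector per index suffices.\<close>

lemma span_UN_eq_sum:
  assumes "\<And>i. i \<in> D \<Longrightarrow> subspace (U i)" "x \<in> span (\<Union>i\<in>D. U i)"
  shows "\<exists>F u. finite F \<and> F \<subseteq> D \<and> (\<forall>i\<in>F. u i \<in> U i) \<and> x = (\<Sum>i\<in>F. u i)"
  using assms(2)
proof (induction rule: span_induct_alt)
  case base
  show ?case by (rule exI[of _ "{}"]) auto
next
  case (step c x y)
  then obtain F u where F: "finite F" "F \<subseteq> D" "\<forall>i\<in>F. u i \<in> U i" "y = (\<Sum>i\<in>F. u i)" by auto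
  obtain j where j: "j \<in> D" "x \<in> U j" using step by auto
  show ?case
  proof (cases "j \<in> F")
    case True
    have "(\<Sum>i\<in>F. (u(j := scale c x + u j)) i) = scale c x + u j + (\<Sum>i\<in>F - {j}. (u(j := scale c x + u j)) i)"
      using True F(1) by (subst sum.remove[of F j]) auto
    also have "(\<Sum>i\<in>F - {j}. (u(j := scale c x + u j)) i) = (\<Sum>i\<in>F - {j}. u i)"
      by (intro sum.cong) auto
    also have "scale c x + u j + \<dots> = scale c x + y"
      using sum.remove[OF F(1) True, of u] unfolding F(4) by (simp add: add.assoc)
    finally have "scale c x + y = (\<Sum>i\<in>F. (u(j := scale c x + u j)) i)" ..
    moreover have "\<forall>i\<in>F. (u(j := scale c x + u j)) i \<in> U i"
      using F j True assms(1) by (auto intro!: subspace_add subspace_scale)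
    ultimately show ?thesis using F by blast
  next
    case False
    have "(\<Sum>i\<in>F. (u(j := scale c x)) i) = (\<Sum>i\<in>F. u i)"
      using False by (intro sum.cong) auto
    then have "scale c x + y = (\<Sum>i\<in>insert j F. (u(j := scale c x)) i)"
      using False F by simp
    moreover have "\<forall>i\<in>insert j F. (u(j := scale c x)) i \<in> U i"
      using F j False assms(1) by (auto intro!: subspace_scale)
    ultimately show ?thesis using F j by (metis finite_insert insert_subset)
  qed
qed

lemma dim_span_UN:
  assumes "finite F" "\<And>i. i \<in> F \<Longrightarrow> subspace (U i)"
    and "\<And>i. i \<in> F \<Longrightarrow> U i \<inter> span (\<Union>j\<in>F - {i}. U j) = {0}"
    and "finite S" "\<And>i. i \<in> F \<Longrightarrow> U i \<subseteq> span S"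
  shows "dim (span (\<Union>i\<in>F. U i)) = (\<Sum>i\<in>F. dim (U i))"
  using assms
proof (induction F rule: finite_induct)
  case empty
  have "dim {0} = card ({} :: 'v set)" by (rule dim_eq_card) (auto simp: independent_empty)
  then show ?case by simp
next
  case (insert j F)
  have "U i \<inter> span (\<Union>l\<in>F - {i}. U l) = {0}" if "i \<in> F" for i
  proof -
    have "span (\<Union>l\<in>F - {i}. U l) \<subseteq> span (\<Union>l\<in>insert j F - {i}. U l)"
      by (rule span_mono) auto
    moreover have "0 \<in> U i" using insert.prems(1)[of i] that subspace_0 by auto
    ultimately show ?thesis using insert.prems(2)[of i] that span_zero by blast
  qed
  then have IH: "dim (span (\<Union>i\<in>F. U i)) = (\<Sum>i\<in>F. dim (U i))"
    using insert.prems by (intro insert.IH) auto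
  have "span (\<Union>i\<in>insert j F. U i) = span (U j \<union> span (\<Union>i\<in>F. U i))"
    by (simp add: span_Un span_span)
  moreover have "dim (span (U j \<union> span (\<Union>i\<in>F. U i))) = dim (U j) + dim (span (\<Union>i\<in>F. U i))"
  proof (rule dim_direct_sum)
    have "insert j F - {j} = F" using insert.hyps by auto
    then show "U j \<inter> span (\<Union> (U ` F)) = {0}" using insert.prems(2)[of j] by auto
    show "span (\<Union> (U ` F)) \<subseteq> span S" using insert.prems(4) by (intro span_minimal) auto
  qed (use insert.prems in auto)
  ultimately show ?case using IH insert.hyps by simp
qed

text \<open>Otherwise \<open>- v\<close> could be added as a further component of a new weight, and
  vectors of distinct weights with sum zero all vanish.\<close>

lemma wsp_nonzero_weight_in:
  assumes V: "subspace V" "\<And>h. h \<in> T \<Longrightarrow> linear_between scale V scale (A h)"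
    and sep: "\<And>\<mu> \<nu>. \<mu> \<in> D \<Longrightarrow> \<nu> \<in> D \<Longrightarrow> \<mu> \<noteq> \<nu> \<Longrightarrow> \<exists>h\<in>T. \<mu> h \<noteq> \<nu> h"
    and v: "v \<in> wsp V T A \<mu>" "v \<noteq> 0" "\<mu> \<in> D" and F: "F \<subseteq> D"
    and span: "v \<in> span (\<Union>\<nu>\<in>F. wsp V T A \<nu>)"
  shows "\<mu> \<in> F"
proof (rule ccontr)
  assume "\<mu> \<notin> F"
  obtain G u where G: "finite G" "G \<subseteq> F" "\<forall>i\<in>G. u i \<in> wsp V T A i" "v = (\<Sum>i\<in>G. u i)"
    using span_UN_eq_sum[OF subspace_wsp[OF V] span] by blast
  have nm: "\<mu> \<notin> G" using G \<open>\<mu> \<notin> F\<close> by auto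
  have "(u(\<mu> := - v)) \<mu> \<in> {0}"
  proof (rule components_in_stable_subspace[where v = "u(\<mu> := - v)" and F = "insert \<mu> G"
        and w = id and S = "{0}" and A = A and V = V and T = T])
    show "(u(\<mu> := - v)) i \<in> wsp V T A (id i)" if "i \<in> insert \<mu> G" for i
      using that G(3) v(1) subspace_neg[OF subspace_wsp[OF V]] by auto
    have "(\<Sum>i\<in>G. (u(\<mu> := - v)) i) = (\<Sum>i\<in>G. u i)"
      using nm by (intro sum.cong) auto
    then show "(\<Sum>i\<in>insert \<mu> G. (u(\<mu> := - v)) i) \<in> {0}" using nm G by simp
    show "\<exists>h\<in>T. id i h \<noteq> id j h" if "i \<in> insert \<mu> G" "j \<in> insert \<mu> G" "i \<noteq> j" for i j
      using that sep[of i j] v(3) F G(2) by auto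
    show "A h w \<in> {0}" if "h \<in> T" "w \<in> {0}" for h w
      using that linear_between_zero[OF V(1) V(2)] by auto
  qed (use V G in auto)
  then show False using v(2) by simp
qed

text \<open>A finite basis of \<open>V\<close> involves only finitely many weights, and every weight
  with a nonzero vector is one of them.\<close>

lemma finite_weights:
  assumes V: "subspace V" "\<And>h. h \<in> T \<Longrightarrow> linear_between scale V scale (A h)"
    and sep: "\<And>\<mu> \<nu>. \<mu> \<in> D \<Longrightarrow> \<nu> \<in> D \<Longrightarrow> \<mu> \<noteq> \<nu> \<Longrightarrow> \<exists>h\<in>T. \<mu> h \<noteq> \<nu> h"
    and S: "finite S" "V \<subseteq> span S"
    and D: "V \<subseteq> span (\<Union>\<mu>\<in>D. wsp V T A \<mu>)"
  shows "finite {\<mu> \<in> D. wsp V T A \<mu> \<noteq> {0}}"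
proof -
  obtain B where B: "finite B" "B \<subseteq> V" "span B = V" by (rule finite_basis[OF V(1) S])
  have "\<exists>F. finite F \<and> F \<subseteq> D \<and> b \<in> span (\<Union>\<mu>\<in>F. wsp V T A \<mu>)" if "b \<in> B" for b
  proof -
    have "b \<in> span (\<Union>\<mu>\<in>D. wsp V T A \<mu>)" using that B D by blast
    from span_UN_eq_sum[OF subspace_wsp[OF V] this]
    obtain F u where "finite F" "F \<subseteq> D" "\<forall>i\<in>F. u i \<in> wsp V T A i" "b = (\<Sum>i\<in>F. u i)"
      by blast
    then show ?thesis by (intro exI[of _ F]) (auto intro!: span_sum intro: span_base)
  qed
  then obtain G where G: "\<And>b. b \<in> B \<Longrightarrow> finite (G b) \<and> G b \<subseteq> D \<and> b \<in> span (\<Union>\<mu>\<in>G b. wsp V T A \<mu>)"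
    by metis
  let ?F = "\<Union>b\<in>B. G b"
  have "B \<subseteq> span (\<Union>\<mu>\<in>?F. wsp V T A \<mu>)"
  proof
    fix b assume b: "b \<in> B"
    have "span (\<Union>\<mu>\<in>G b. wsp V T A \<mu>) \<subseteq> span (\<Union>\<mu>\<in>?F. wsp V T A \<mu>)"
      by (rule span_mono) (use b in blast)
    then show "b \<in> span (\<Union>\<mu>\<in>?F. wsp V T A \<mu>)" using G[OF b] by auto
  qed
  then have VF: "V \<subseteq> span (\<Union>\<mu>\<in>?F. wsp V T A \<mu>)"
    using B(3) span_minimal[OF _ subspace_span] by blast
  have "{\<mu> \<in> D. wsp V T A \<mu> \<noteq> {0}} \<subseteq> ?F"
  proof
    fix \<mu> assume mu: "\<mu> \<in> {\<mu> \<in> D. wsp V T A \<mu> \<noteq> {0}}"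
    moreover have "0 \<in> wsp V T A \<mu>" by (rule subspace_0[OF subspace_wsp[OF V]])
    ultimately obtain v where v: "v \<in> wsp V T A \<mu>" "v \<noteq> 0" by blast
    have "v \<in> V" using v by (simp add: wsp_def)
    show "\<mu> \<in> ?F"
    proof (rule wsp_nonzero_weight_in[OF V sep v])
      show "?F \<subseteq> D" using G by blast
      show "v \<in> span (\<Union>\<nu>\<in>?F. wsp V T A \<nu>)" using VF \<open>v \<in> V\<close> by blast
    qed (use mu in auto)
  qed
  then show ?thesis using B(1) G by (meson finite_UN_I finite_subset)
qed

lemma stable_subspace_spanned:
  assumes V: "subspace V" "\<And>h. h \<in> T \<Longrightarrow> linear_between scale V scale (A h)"
    and sep: "\<And>\<mu> \<nu>. \<mu> \<in> D \<Longrightarrow> \<nu> \<in> D \<Longrightarrow> \<mu> \<noteq> \<nu> \<Longrightarrow> \<exists>h\<in>T. \<mu> h \<noteq> \<nu> h"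
    and D: "V \<subseteq> span (\<Union>\<mu>\<in>D. wsp V T A \<mu>)"
    and S: "subspace S" "S \<subseteq> V" "\<And>h v. h \<in> T \<Longrightarrow> v \<in> S \<Longrightarrow> A h v \<in> S"
  shows "S = span (\<Union>\<mu>\<in>D. wsp S T A \<mu>)"
proof
  show "span (\<Union>\<mu>\<in>D. wsp S T A \<mu>) \<subseteq> S"
    using S(1) by (intro span_minimal) (auto simp: wsp_def)
  show "S \<subseteq> span (\<Union>\<mu>\<in>D. wsp S T A \<mu>)"
  proof
    fix s assume s: "s \<in> S"
    then have "s \<in> span (\<Union>\<mu>\<in>D. wsp V T A \<mu>)" using S D by blast
    from span_UN_eq_sum[OF subspace_wsp[OF V] this]
    obtain F u where F: "finite F" "F \<subseteq> D" "\<forall>i\<in>F. u i \<in> wsp V T A i" "s = (\<Sum>i\<in>F. u i)"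
       by blast
    have "u i \<in> S" if "i \<in> F" for i
    proof (rule components_in_stable_subspace[where v = u and F = F
        and w = id and S = S and A = A and V = V and T = T])
      show "\<exists>h\<in>T. id i h \<noteq> id j h" if "i \<in> F" "j \<in> F" "i \<noteq> j" for i j
        using that sep[of i j] F(2) by auto
    qed (use V S F s that in auto)
    then have "u i \<in> wsp S T A i" if "i \<in> F" for i using F(3) that by (auto simp: wsp_def)
    then show "s \<in> span (\<Union>\<mu>\<in>D. wsp S T A \<mu>)"
      unfolding F(4) using F(2) by (intro span_sum span_base) auto
  qed
qed

text \<open>The eigenspace of a single \<open>h\<close> collects all weights that agree at
  \<open>h\<close>. The set \<open>W\<close> may contain weights with zero weight space, so that the
  even and the odd part of a module can share one index set.\<close>

lemma dim_eigenspace_eq_sum_weights: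
  assumes V: "subspace V" "\<And>h. h \<in> T \<Longrightarrow> linear_between scale V scale (A h)"
    and sep: "\<And>\<mu> \<nu>. \<mu> \<in> D \<Longrightarrow> \<nu> \<in> D \<Longrightarrow> \<mu> \<noteq> \<nu> \<Longrightarrow> \<exists>h\<in>T. \<mu> h \<noteq> \<nu> h"
    and S: "finite S" "V \<subseteq> span S"
    and D: "V \<subseteq> span (\<Union>\<mu>\<in>D. wsp V T A \<mu>)"
    and h: "h \<in> T"
    and W: "finite W" "W \<subseteq> D" "{\<mu> \<in> D. wsp V T A \<mu> \<noteq> {0}} \<subseteq> W"
  shows "dim {v \<in> V. A h v = scale c v} = (\<Sum>\<mu> | \<mu> \<in> W \<and> \<mu> h = c. dim (wsp V T A \<mu>))"
proof -
  let ?F = "{\<mu> \<in> W. \<mu> h = c}"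
  let ?E = "{v \<in> V. A h v = scale c v}"
  have "dim (span (\<Union>\<mu>\<in>?F. wsp V T A \<mu>)) = (\<Sum>\<mu>\<in>?F. dim (wsp V T A \<mu>))"
  proof (rule dim_span_UN)
    show "wsp V T A \<mu> \<inter> span (\<Union>\<nu>\<in>?F - {\<mu>}. wsp V T A \<nu>) = {0}" if "\<mu> \<in> ?F" for \<mu>
    proof -
      have "v = 0" if v: "v \<in> wsp V T A \<mu>" "v \<in> span (\<Union>\<nu>\<in>?F - {\<mu>}. wsp V T A \<nu>)" for v
      proof (rule ccontr)
        assume "v \<noteq> 0"
        have "\<mu> \<in> ?F - {\<mu>}"
          by (rule wsp_nonzero_weight_in[OF V sep v(1) \<open>v \<noteq> 0\<close>, of D]) (use W v \<open>\<mu> \<in> ?F\<close> in auto)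
        then show False by simp
      qed
      then show ?thesis using span_zero subspace_0[OF subspace_wsp[OF V]] by auto
    qed
    show "finite S" by fact
    show "wsp V T A \<mu> \<subseteq> span S" for \<mu> using S by (auto simp: wsp_def)
  qed (use W subspace_wsp[OF V] in auto)
  moreover have "span (\<Union>\<mu>\<in>?F. wsp V T A \<mu>) = ?E"
  proof
    have sE: "subspace ?E"
      using subspace_wsp[of V "{h}" A "\<lambda>_. c"] V h by (auto simp: wsp_def)
    show "span (\<Union>\<mu>\<in>?F. wsp V T A \<mu>) \<subseteq> ?E"
      using h by (intro span_minimal[OF _ sE]) (auto simp: wsp_def)
    show "?E \<subseteq> span (\<Union>\<mu>\<in>?F. wsp V T A \<mu>)"
    proof
      fix v assume v: "v \<in> ?E"
      then have "v \<in> span (\<Union>\<mu>\<in>D. wsp V T A \<mu>)" using D by blast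
      from span_UN_eq_sum[OF subspace_wsp[OF V] this]
      obtain F u where F: "finite F" "F \<subseteq> D" "\<forall>i\<in>F. u i \<in> wsp V T A i" "v = (\<Sum>i\<in>F. u i)"
        by blast
      have uV: "u i \<in> V" if "i \<in> F" for i using F(3) that by (auto simp: wsp_def)
      \<comment> \<open>Subtracting c from \<open>A h\<close> turns the components of
        \<open>v\<close> into weight vectors with sum zero, so each of them vanishes and only
        components with \<open>\<mu> h = c\<close> survive.\<close>
      have "scale (\<mu> h - c) (u \<mu>) \<in> {0}" if "\<mu> \<in> F" for \<mu>
      proof (rule components_in_stable_subspace[where v = "\<lambda>\<mu>. scale (\<mu> h - c) (u \<mu>)" and F = F
        and w = id and S = "{0}" and A = A and V = V and T = T])
        show "\<exists>h\<in>T. id i h \<noteq> id j h" if "i \<in> F" "j \<in> F" "i \<noteq> j" for i j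
          using that sep[of i j] F(2) by auto
        have "0 = A h v - scale c v" using v by simp
        also have "A h v = (\<Sum>\<mu>\<in>F. A h (u \<mu>))"
          unfolding F(4) by (rule linear_between_sum[OF V(1) V(2)[OF h] uV])
        also have "\<dots> = (\<Sum>\<mu>\<in>F. scale (\<mu> h) (u \<mu>))"
          using F(3) h by (intro sum.cong) (auto simp: wsp_def)
        finally show "(\<Sum>\<mu>\<in>F. scale (\<mu> h - c) (u \<mu>)) \<in> {0}"
          by (simp add: F(4) scale_left_diff_distrib sum_subtractf scale_sum_right)
        show "A h w \<in> {0}" if "h \<in> T" "w \<in> {0}" for h w
          using that linear_between_zero[OF V(1) V(2)] by auto
        show "scale (i h - c) (u i) \<in> wsp V T A (id i)" if "i \<in> F" for i
          using F(3) that by (simp add: subspace_scale subspace_wsp V)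
      qed (use V F that in auto)
      then have z: "\<mu> h = c \<or> u \<mu> = 0" if "\<mu> \<in> F" for \<mu> using that by auto
      have "u \<mu> \<in> span (\<Union>\<mu>\<in>?F. wsp V T A \<mu>)" if "\<mu> \<in> F" for \<mu>
      proof (cases "u \<mu> = 0")
        case False
        have u: "u \<mu> \<in> wsp V T A \<mu>" using F(3) that by blast
        have "\<mu> h = c" using z[OF that] False by simp
        moreover have "wsp V T A \<mu> \<noteq> {0}" using u False by blast
        then have "\<mu> \<in> W" using W(3) F(2) that by auto
        ultimately show ?thesis using u by (intro span_base) auto
      qed (simp add: span_zero)
      then show "v \<in> span (\<Union>\<mu>\<in>?F. wsp V T A \<mu>)" unfolding F(4) by (intro span_sum)
    qed
  qed
  ultimately show ?thesis by simp
qed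

text \<open>An eigenvector modulo a stable subspace lifts to a genuine one: take for
  \<open>u\<close> the c-component of \<open>q\<close>. Each other component \<open>u d\<close> lies
  in \<open>S\<close> because its multiple by d - c does. Diagonalizability of \<open>A\<close>, the
  hypothesis on spans of eigenspaces, is essential here; it makes passage to eigenspaces
  exact.\<close>

lemma approximate_eigenvector:
  assumes V: "subspace V" "linear_between scale V scale A"
    and D: "V \<subseteq> span (\<Union>c. {v \<in> V. A v = scale c v})"
    and S: "subspace S" "\<And>v. v \<in> S \<Longrightarrow> A v \<in> S"
    and q: "q \<in> V" "A q - scale c q \<in> S"
  shows "\<exists>u\<in>V. A u = scale c u \<and> q - u \<in> S"
proof -
  let ?E = "\<lambda>c. {v \<in> V. A v = scale c v}"
  have E: "?E c = wsp V {()} (\<lambda>_. A) (\<lambda>_. c)" for c by (auto simp: wsp_def)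
  have sE: "subspace (?E c)" for c unfolding E by (rule subspace_wsp) (use V in auto)
  have "q \<in> span (\<Union>c. ?E c)" using q(1) D by blast
  from span_UN_eq_sum[OF sE this] obtain F u where
    F: "finite F" "\<forall>d\<in>F. u d \<in> ?E d" "q = (\<Sum>d\<in>F. u d)" by blast
  have uV: "u d \<in> V" if "d \<in> F" for d using F(2) that by blast
  have "scale (d - c) (u d) \<in> S" if "d \<in> F" for d
  \<comment> \<open>The single operator is viewed as a family indexed by the unit type, and an
    eigenvalue as a constant weight.\<close>
  proof (rule components_in_stable_subspace[where v = "\<lambda>d. scale (d - c) (u d)" and F = F
      and w = "\<lambda>d _. d" and S = S and A = "\<lambda>_. A" and V = V and T = "{()}"])
    show "scale (d - c) (u d) \<in> wsp V {()} (\<lambda>_. A) (\<lambda>_. d)" if "d \<in> F" for d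
      unfolding E[symmetric] using F(2) that by (intro subspace_scale[OF sE]) auto
    have "A q = (\<Sum>d\<in>F. A (u d))"
      unfolding F(3) by (rule linear_between_sum[OF V uV])
    also have "\<dots> = (\<Sum>d\<in>F. scale d (u d))" using F(2) by (intro sum.cong) auto
    finally show "(\<Sum>d\<in>F. scale (d - c) (u d)) \<in> S"
      using q(2) by (simp add: F(3) scale_left_diff_distrib sum_subtractf scale_sum_right)
  qed (use V S F that in auto)
  then have uS: "u d \<in> S" if "d \<in> F" "d \<noteq> c" for d
    using subspace_scale[OF S(1), of "scale (d - c) (u d)" "inverse (d - c)"] that by simp
  \<comment> \<open>If c is not among the eigenvalues of the components, all of \<open>q\<close>
    lies in \<open>S\<close> and zero is the required eigenvector.\<close>
  let ?u = "if c \<in> F then u c else 0"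
  have "?u \<in> V" "A ?u = scale c ?u"
    using F(2) subspace_0[OF V(1)] linear_between_zero[OF V] by auto
  moreover have "q - ?u = (\<Sum>d\<in>F - {c}. u d)"
    using F(1) by (simp add: F(3) sum_diff1)
  then have "q - ?u \<in> S" using uS by (auto intro!: subspace_sum[OF S(1)])
  ultimately show ?thesis by blast
qed

lemma finite_graded_weights:
  fixes V :: "bool \<Rightarrow> 'v set" and D :: "('t \<Rightarrow> complex) set"
  assumes V: "\<And>p. subspace (V p)" "\<And>p h. h \<in> T \<Longrightarrow> linear_between scale (V p) scale (A h)"
    and sep: "\<And>\<mu> \<nu>. \<mu> \<in> D \<Longrightarrow> \<nu> \<in> D \<Longrightarrow> \<mu> \<noteq> \<nu> \<Longrightarrow> \<exists>h\<in>T. \<mu> h \<noteq> \<nu> h"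
    and S: "finite S" "\<And>p. V p \<subseteq> span S"
    and D: "\<And>p. V p \<subseteq> span (\<Union>\<mu>\<in>D. wsp (V p) T A \<mu>)"
  shows "finite {\<mu> \<in> D. \<exists>p. wsp (V p) T A \<mu> \<noteq> {0}}"
proof -
  have "{\<mu> \<in> D. \<exists>p. wsp (V p) T A \<mu> \<noteq> {0}} = (\<Union>p. {\<mu> \<in> D. wsp (V p) T A \<mu> \<noteq> {0}})" by auto
  moreover have "finite {\<mu> \<in> D. wsp (V p) T A \<mu> \<noteq> {0}}" for p
    by (rule finite_weights[OF V(1) V(2) sep S(1) S(2) D])
  ultimately show ?thesis by simp
qed

text \<open>Weights are grouped by their value at \<open>h\<close>. Any finite \<open>C\<close>
  containing these values is allowed, surplus values having zero eigenspaces; this lets a module and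
  its homology be summed over one common set.\<close>

lemma weight_sum_eq_eigenvalue_sum:
  fixes V :: "bool \<Rightarrow> 'v set" and D :: "('t \<Rightarrow> complex) set"
  assumes V: "\<And>p. subspace (V p)" "\<And>p h. h \<in> T \<Longrightarrow> linear_between scale (V p) scale (A h)"
    and sep: "\<And>\<mu> \<nu>. \<mu> \<in> D \<Longrightarrow> \<nu> \<in> D \<Longrightarrow> \<mu> \<noteq> \<nu> \<Longrightarrow> \<exists>h\<in>T. \<mu> h \<noteq> \<nu> h"
    and S: "finite S" "\<And>p. V p \<subseteq> span S"
    and D: "\<And>p. V p \<subseteq> span (\<Union>\<mu>\<in>D. wsp (V p) T A \<mu>)"
    and h: "h \<in> T"
    and C: "finite C" "(\<lambda>\<mu>. \<mu> h) ` {\<mu> \<in> D. \<exists>p. wsp (V p) T A \<mu> \<noteq> {0}} \<subseteq> C"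
  shows "(\<Sum>\<mu> | \<mu> \<in> D \<and> (\<exists>p. wsp (V p) T A \<mu> \<noteq> {0}).
      (of_nat (dim (wsp (V False) T A \<mu>)) - of_nat (dim (wsp (V True) T A \<mu>))) * exp (\<mu> h)) =
    (\<Sum>c\<in>C. (of_nat (dim {v \<in> V False. A h v = scale c v})
      - of_nat (dim {v \<in> V True. A h v = scale c v})) * exp c)" (is "?l = ?r")
proof -
  let ?W = "{\<mu> \<in> D. \<exists>p. wsp (V p) T A \<mu> \<noteq> {0}}"
  have W: "finite ?W" by (rule finite_graded_weights[OF V(1) V(2) sep S D])
  have dimE: "dim {v \<in> V p. A h v = scale c v} = (\<Sum>\<mu> | \<mu> \<in> ?W \<and> \<mu> h = c. dim (wsp (V p) T A \<mu>))" for p c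
    by (rule dim_eigenspace_eq_sum_weights[OF V(1) V(2) sep S(1) S(2) D h W]) auto
  let ?g = "\<lambda>\<mu>. (of_nat (dim (wsp (V False) T A \<mu>)) - of_nat (dim (wsp (V True) T A \<mu>)) :: complex)"
  have "?l = (\<Sum>c\<in>C. \<Sum>\<mu> | \<mu> \<in> ?W \<and> \<mu> h = c. ?g \<mu> * exp (\<mu> h))"
    using sum.group[OF W C, of "\<lambda>\<mu>. ?g \<mu> * exp (\<mu> h)"] by simp
  also have "\<dots> = (\<Sum>c\<in>C. (\<Sum>\<mu> | \<mu> \<in> ?W \<and> \<mu> h = c. ?g \<mu>) * exp c)"
    unfolding sum_distrib_right by (intro sum.cong refl) auto
  also have "\<dots> = ?r"
    unfolding dimE by (simp add: sum_subtractf)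
  finally show ?thesis .
qed

end

section \<open>Homology of an odd differential\<close>

locale graded_space = cvector_space scale for scale :: "complex \<Rightarrow> 'v::ab_group_add \<Rightarrow> 'v" +
  fixes P :: "bool \<Rightarrow> 'v set"
  assumes super: "super_space scale P"
begin

abbreviation "V \<equiv> set_sum (P False) (P True)"

lemma subspace_P: "subspace (P p)"
  using super unfolding super_space_def by blast

lemma subspace_V: "subspace V"
  unfolding set_sum_def by (rule subspace_sums[OF subspace_P subspace_P])

lemma P_subset_V: "P p \<subseteq> V"
proof
  fix v assume "v \<in> P p"
  moreover have "v = v + 0" "v = 0 + v" by simp_all
  moreover have "0 \<in> P False" "0 \<in> P True" by (rule subspace_0[OF subspace_P])+
  ultimately show "v \<in> V" unfolding set_sum_def mem_Collect_eq by (cases p) metis+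
qed

lemma P_inter: "P False \<inter> P True = {0}"
  using super unfolding super_space_def by blast

lemma parts_unique:
  assumes "a \<in> P p" "b \<in> P (\<not> p)" "a' \<in> P p" "b' \<in> P (\<not> p)" "a + b = a' + b'"
  shows "a = a' \<and> b = b'"
proof -
  have "a - a' = b' - b" using assms(5) by (simp add: algebra_simps)
  moreover have "a - a' \<in> P p" "b' - b \<in> P (\<not> p)"
    using assms by (auto intro: subspace_diff[OF subspace_P])
  ultimately have "a - a' \<in> P False \<inter> P True" by (cases p) auto
  then show ?thesis using assms(5) by (simp add: P_inter)
qed

lemma V_cases:
  assumes "v \<in> V"
  obtains a b where "a \<in> P p" "b \<in> P (\<not> p)" "v = a + b"
proof -
  obtain a b where "a \<in> P False" "b \<in> P True" "v = a + b" using assms unfolding set_sum_def by blast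
  then show thesis using that[of a b] that[of b a] by (cases p) (auto simp: add.commute)
qed

lemma finite_span: "\<exists>S. finite S \<and> (\<forall>p. P p \<subseteq> span S)"
proof -
  obtain S where S: "finite S" "P False \<union> P True \<subseteq> span S"
    using super unfolding super_space_def by blast
  have "P p \<subseteq> span S" for p using S(2) by (cases p) auto
  then show ?thesis using S(1) by blast
qed

end

locale super_complex = graded_space scale P
  for scale :: "complex \<Rightarrow> 'v::ab_group_add \<Rightarrow> 'v" and P +
  fixes X :: "'v \<Rightarrow> 'v"
  assumes X_linear: "linear_between scale V scale X"
    and X_odd: "v \<in> P p \<Longrightarrow> X v \<in> P (\<not> p)"
    and X_square: "v \<in> V \<Longrightarrow> X (X v) = 0"
begin

definition "K = {v \<in> V. X v = 0}"
definition "I = X ` V"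

lemma mem_K: "v \<in> K \<longleftrightarrow> v \<in> V \<and> X v = 0"
  by (simp add: K_def)

lemma X_V: "v \<in> V \<Longrightarrow> X v \<in> V"
  using X_odd P_subset_V X_linear
  by (elim V_cases[where p = False])
    (auto simp: linear_between_def subset_iff intro!: subspace_add[OF subspace_V])

lemma X_add: "v \<in> V \<Longrightarrow> w \<in> V \<Longrightarrow> X (v + w) = X v + X w"
  using X_linear by (simp add: linear_between_def)

lemma subspace_K: "subspace K"
  unfolding K_def by (rule subspace_linear_kernel[OF subspace_V X_linear])

lemma subspace_I: "subspace I"
  unfolding I_def by (rule subspace_linear_image[OF subspace_V X_linear])

lemma I_subset_K: "I \<subseteq> K"
  using X_V X_square by (auto simp: I_def mem_K)

text \<open>The images of the two parity components lie in different parts and so cannot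
  cancel.\<close>

lemma K_cases:
  assumes "v \<in> K"
  obtains a b where "a \<in> K \<inter> P p" "b \<in> K \<inter> P (\<not> p)" "v = a + b"
proof -
  obtain a b where ab: "a \<in> P p" "b \<in> P (\<not> p)" "v = a + b" using assms V_cases[of v p] unfolding mem_K by metis
  have V: "a \<in> V" "b \<in> V" using ab(1,2) P_subset_V by blast+
  then have "X a + X b = 0 + 0" using assms ab(3) by (simp add: X_add mem_K)
  then have "X a = 0 \<and> X b = 0"
    using parts_unique[of "X a" "\<not> p" "X b" 0 0] ab X_odd[of a p] X_odd[of b "\<not> p"] subspace_0[OF subspace_P] by simp
  then show thesis using ab V by (intro that[of a b]) (auto simp: mem_K)
qed

lemma I_Int_P: "I \<inter> P p = X ` P (\<not> p)"
proof
  show "X ` P (\<not> p) \<subseteq> I \<inter> P p" using P_subset_V X_odd[of _ "\<not> p"] by (auto simp: I_def)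
  show "I \<inter> P p \<subseteq> X ` P (\<not> p)"
  proof
    fix v assume v: "v \<in> I \<inter> P p"
    then obtain m where m: "m \<in> V" "v = X m" unfolding I_def by blast
    obtain a b where ab: "a \<in> P p" "b \<in> P (\<not> p)" "m = a + b" by (rule V_cases[OF m(1)])
    have "a \<in> V" "b \<in> V" using ab(1,2) P_subset_V by blast+
    then have "X b + X a = v + 0" using m(2) ab(3) by (simp add: X_add add.commute)
    then have "X b = v \<and> X a = 0"
      using parts_unique[of "X b" p "X a" v 0] ab v X_odd[of a p] X_odd[of b "\<not> p"]
        subspace_0[OF subspace_P] by simp
    then show "v \<in> X ` P (\<not> p)" using ab by blast
  qed
qed

end

text \<open>The quotient \<open>ker X / im X\<close> is realized by a graded complement \<open>C\<close> of \<open>im X\<close> in \<open>ker X\<close>.\<close>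

locale split_super_complex = super_complex scale P X
  for scale :: "complex \<Rightarrow> 'v::ab_group_add \<Rightarrow> 'v" and P X +
  fixes C :: "bool \<Rightarrow> 'v set"
  assumes subspace_C: "subspace (C p)"
    and C_subset: "C p \<subseteq> K \<inter> P p"
    and C_Int: "C p \<inter> I = {0}"
    and C_complement: "v \<in> K \<inter> P p \<Longrightarrow> \<exists>u\<in>C p. v - u \<in> I"
begin

abbreviation "CC \<equiv> set_sum (C False) (C True)"

text \<open>The quotient map from the kernel to the homology, with each class represented by its
  unique element in the complement. It is meaningful on \<open>K\<close> only.\<close>

definition proj :: "'v \<Rightarrow> 'v" where
  "proj v = (THE u. u \<in> CC \<and> v - u \<in> I)"

lemma subspace_CC: "subspace CC"
  unfolding set_sum_def by (rule subspace_sums[OF subspace_C subspace_C])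

lemma C_subset_CC: "C p \<subseteq> CC"
proof
  fix v assume "v \<in> C p"
  moreover have "v = v + 0" "v = 0 + v" by simp_all
  moreover have "0 \<in> C False" "0 \<in> C True" by (rule subspace_0[OF subspace_C])+
  ultimately show "v \<in> CC" unfolding set_sum_def mem_Collect_eq by (cases p) metis+
qed

lemma CC_subset: "CC \<subseteq> K"
proof
  fix v assume "v \<in> CC"
  then obtain a b where "a \<in> C False" "b \<in> C True" "v = a + b" unfolding set_sum_def by blast
  moreover from this have "a \<in> K" "b \<in> K" using C_subset by blast+
  ultimately show "v \<in> K" by (simp add: subspace_add[OF subspace_K])
qed

text \<open>\<open>C_Int\<close> speaks of one parity at a time. Since \<open>X\<close> is odd, the
  two parity components of a boundary are boundaries themselves, which reduces the sum to that
  case.\<close>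

lemma CC_Int: "CC \<inter> I = {0}"
proof -
  have "v = 0" if v: "v \<in> CC" "v \<in> I" for v
  proof -
    obtain a b where ab: "a \<in> C False" "b \<in> C True" "v = a + b" using v(1) unfolding set_sum_def by blast
    obtain m where m: "m \<in> V" "v = X m" using v(2) unfolding I_def by blast
    obtain c d where cd: "c \<in> P False" "d \<in> P True" "m = c + d" using V_cases[OF m(1), of False] by auto
    have V: "c \<in> V" "d \<in> V" using cd(1,2) P_subset_V by blast+
    then have "a + b = X d + X c" using m(2) cd(3) ab(3) by (simp add: X_add add.commute)
    then have "a = X d \<and> b = X c"
      using parts_unique[of a False b "X d" "X c"] ab C_subset cd X_odd[of c False] X_odd[of d True] by auto
    then have "a \<in> I" "b \<in> I" using V by (auto simp: I_def)
    then have "a = 0" "b = 0" using ab C_Int by blast+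
    then show ?thesis using ab by simp
  qed
  then show ?thesis using subspace_0[OF subspace_CC] subspace_0[OF subspace_I] by blast
qed

lemma proj_eqI: "u \<in> CC \<Longrightarrow> v - u \<in> I \<Longrightarrow> proj v = u"
  unfolding proj_def
proof (rule the_equality)
  fix w assume u: "u \<in> CC" "v - u \<in> I" and w: "w \<in> CC \<and> v - w \<in> I"
  have "(v - u) - (v - w) \<in> I"
    using u w by (intro subspace_diff[OF subspace_I, of "v - u" "v - w"]) auto
  moreover have "w - u \<in> CC" using u w by (intro subspace_diff[OF subspace_CC]) auto
  ultimately have "w - u \<in> CC \<inter> I" by simp
  then show "w = u" by (simp add: CC_Int)
qed simp

lemma proj_part: "v \<in> K \<inter> P p \<Longrightarrow> proj v \<in> C p \<and> v - proj v \<in> I"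
  using C_complement[of v p] proj_eqI C_subset_CC by blast

lemma proj_K: "v \<in> K \<Longrightarrow> proj v \<in> CC \<and> v - proj v \<in> I"
proof -
  assume "v \<in> K"
  then obtain a b where ab: "a \<in> K \<inter> P False" "b \<in> K \<inter> P (\<not> False)" "v = a + b" by (rule K_cases)
  have a: "proj a \<in> C False \<and> a - proj a \<in> I" and b: "proj b \<in> C True \<and> b - proj b \<in> I"
    using proj_part[OF ab(1)] proj_part[OF ab(2)] by simp_all
  have "proj a \<in> CC" "proj b \<in> CC" using a b C_subset_CC by blast+
  then have "proj a + proj b \<in> CC" by (rule subspace_add[OF subspace_CC])
  moreover have "(a - proj a) + (b - proj b) \<in> I" using a b by (intro subspace_add[OF subspace_I]) auto
  then have "v - (proj a + proj b) \<in> I" using ab by (simp add: algebra_simps)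
  ultimately show ?thesis using proj_eqI by metis
qed

lemma proj_CC: "u \<in> CC \<Longrightarrow> proj u = u"
  by (rule proj_eqI) (use subspace_0[OF subspace_I] in auto)

lemma proj_linear: "linear_between scale K scale proj"
  unfolding linear_between_def
proof (intro conjI ballI allI)
  fix a b assume "a \<in> K" "b \<in> K"
  then have p: "proj a \<in> CC" "a - proj a \<in> I" "proj b \<in> CC" "b - proj b \<in> I" by (auto dest!: proj_K)
  have "(a - proj a) + (b - proj b) \<in> I" by (intro subspace_add[OF subspace_I] p)
  then show "proj (a + b) = proj a + proj b"
    by (intro proj_eqI subspace_add[OF subspace_CC] p) (simp add: algebra_simps)
next
  fix c a assume "a \<in> K"
  then have p: "proj a \<in> CC" "a - proj a \<in> I" by (auto dest!: proj_K)
  have "scale c (a - proj a) \<in> I" by (intro subspace_scale[OF subspace_I] p)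
  then show "proj (scale c a) = scale c (proj a)"
    by (intro proj_eqI subspace_scale[OF subspace_CC] p) (simp add: scale_right_diff_distrib)
qed

lemma proj_eq_0_iff: "v \<in> K \<Longrightarrow> proj v = 0 \<longleftrightarrow> v \<in> I"
  using proj_K[of v] proj_eqI[of 0 v] subspace_0[OF subspace_CC] by auto

lemma proj_eq_iff:
  assumes "v \<in> K" "w \<in> K"
  shows "proj v = proj w \<longleftrightarrow> v - w \<in> I"
  using proj_eq_0_iff[OF subspace_diff[OF subspace_K assms]]
    linear_between_diff[OF subspace_K proj_linear assms] by simp

lemma proj_image_part: "proj ` (K \<inter> P p) = C p"
  using proj_part proj_CC C_subset C_subset_CC by (force simp: image_iff)

lemma super_space_C: "super_space scale C"
proof -
  obtain S where S: "finite S" "\<forall>p. P p \<subseteq> span S" using finite_span by blast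
  have "C False \<inter> C True \<subseteq> P False \<inter> P True" using C_subset by blast
  then have "C False \<inter> C True = {0}" using P_inter subspace_0[OF subspace_C] by blast
  moreover have "C False \<union> C True \<subseteq> span S" using C_subset S(2) by blast
  ultimately show ?thesis
    unfolding super_space_def using S(1) subspace_C vector_space_axioms by blast
qed

text \<open>The operator induced by \<open>A\<close> on the homology sends q to
  \<open>proj (A q)\<close>. A class that is an eigenvector of it contains an eigenvector of
  \<open>A\<close>, by lifting modulo boundaries.\<close>

lemma proj_eigenvectors:
  assumes A: "linear_between scale V scale A" "\<And>v p. v \<in> P p \<Longrightarrow> A v \<in> P p"
      "\<And>v. v \<in> V \<Longrightarrow> X (A v) = A (X v)"
    and D: "P p \<subseteq> span (\<Union>c. {v \<in> P p. A v = scale c v})"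
  shows "proj ` {v \<in> K \<inter> P p. A v = scale c v} = {q \<in> C p. proj (A q) = scale c q}"
proof
  have AV: "A v \<in> V" if "v \<in> V" for v
  proof -
    obtain a b where "a \<in> P False" "b \<in> P (\<not> False)" "v = a + b" using V_cases[OF \<open>v \<in> V\<close>] .
    then show ?thesis using A(1,2) P_subset_V
      by (auto simp: linear_between_def subset_iff intro!: subspace_add[OF subspace_V])
  qed
  have A0: "A 0 = 0" by (rule linear_between_zero[OF subspace_V A(1)])
  have AK: "A v \<in> K" if "v \<in> K" for v using that AV A(3)[of v] A0 by (simp add: mem_K)
  have AI: "A v \<in> I" if v: "v \<in> I" for v
  proof -
    obtain m where "m \<in> V" "v = X m" using v unfolding I_def by blast
    then have "A v = X (A m)" "A m \<in> V" using A(3) AV by auto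
    then show ?thesis unfolding I_def by blast
  qed
  show "proj ` {v \<in> K \<inter> P p. A v = scale c v} \<subseteq> {q \<in> C p. proj (A q) = scale c q}"
  proof
    fix q assume "q \<in> proj ` {v \<in> K \<inter> P p. A v = scale c v}"
    then obtain v where v: "v \<in> K" "v \<in> P p" "A v = scale c v" "q = proj v" by blast
    have q: "q \<in> C p" "v - q \<in> I" using proj_part v by blast+
    have qK: "q \<in> K" using q(1) C_subset by blast
    have "A (v - q) \<in> I" using q AI by blast
    then have "A v - A q \<in> I"
      using linear_between_diff[OF subspace_V A(1)] v(1) qK by (simp add: mem_K)
    then have "proj (A v) = proj (A q)" using proj_eq_iff AK v(1) qK by blast
    moreover have "proj (A v) = scale c q"
      using proj_linear v by (simp add: linear_between_def)
    ultimately show "q \<in> {q \<in> C p. proj (A q) = scale c q}" using q(1) by simp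
  qed
  show "{q \<in> C p. proj (A q) = scale c q} \<subseteq> proj ` {v \<in> K \<inter> P p. A v = scale c v}"
  proof
    fix q assume "q \<in> {q \<in> C p. proj (A q) = scale c q}"
    then have q: "q \<in> C p" "proj (A q) = scale c q" by auto
    have qK: "q \<in> K" "q \<in> P p" using q(1) C_subset by blast+
    have "A q - scale c q \<in> I" using proj_K[OF AK[OF qK(1)]] q(2) by simp
    moreover have "A q - scale c q \<in> P p"
      by (intro subspace_diff subspace_scale subspace_P A(2) qK(2))
    ultimately have "\<exists>u\<in>P p. A u = scale c u \<and> q - u \<in> I \<inter> P p"
      using A(2) AI qK(2)
      by (intro approximate_eigenvector[OF subspace_P linear_between_mono[OF A(1) P_subset_V] D]
          subspace_inter[OF subspace_I subspace_P]) auto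
    then obtain u where u: "u \<in> P p" "A u = scale c u" "q - u \<in> I" by blast
    have "q - (q - u) \<in> K" using subspace_diff[OF subspace_K qK(1), of "q - u"] u(3) I_subset_K by blast
    then have "u \<in> K" by simp
    moreover have "proj q = proj u" using proj_eq_iff[OF qK(1) \<open>u \<in> K\<close>] u(3) by blast
    then have "proj u = q" using proj_CC[of q] q(1) C_subset_CC by auto
    ultimately show "q \<in> proj ` {v \<in> K \<inter> P p. A v = scale c v}" using u by blast
  qed
qed

text \<open>The Euler characteristic argument on one eigenspace. With E, Z and Q the eigenspace, its
  kernel and its homology, dim E p = dim Z p + dim X(E p) and dim Z p = dim X(E (\<not> p)) + dim Q
  p. In the difference of the two parities the ranks of \<open>X\<close> cancel.\<close>

lemma super_dim_eigenspace:
  assumes A: "linear_between scale V scale A" "\<And>v p. v \<in> P p \<Longrightarrow> A v \<in> P p"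
      "\<And>v. v \<in> V \<Longrightarrow> X (A v) = A (X v)"
    and D: "\<And>p. P p \<subseteq> span (\<Union>c. {v \<in> P p. A v = scale c v})"
  shows "int (dim {v \<in> P False. A v = scale c v}) - int (dim {v \<in> P True. A v = scale c v})
    = int (dim {q \<in> C False. proj (A q) = scale c q}) - int (dim {q \<in> C True. proj (A q) = scale c q})"
proof -
  let ?E = "\<lambda>p. {v \<in> P p. A v = scale c v}"
  let ?Z = "\<lambda>p. {v \<in> ?E p. X v = 0}"
  obtain S where S: "finite S" "\<forall>p. P p \<subseteq> span S" using finite_span by blast
  have linP: "linear_between scale (P p) scale A" for p by (rule linear_between_mono[OF A(1) P_subset_V])
  have sE: "subspace (?E p)" for p
    using subspace_wsp[of "P p" "{()}" "\<lambda>_. A" "\<lambda>_. c"] subspace_P linP by (simp add: wsp_def)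
  have EV: "?E p \<subseteq> V" for p using P_subset_V by blast
  have 1: "dim (?E p) = dim (?Z p) + dim (X ` ?E p)" for p
    by (rule rank_nullity[OF sE S(1) _ linear_between_mono[OF X_linear EV]]) (use S(2) in auto)
  have sZ: "subspace (?Z p)" for p
    by (rule subspace_linear_kernel[OF sE linear_between_mono[OF X_linear EV]])
  have ZK: "?Z p \<subseteq> K" for p using EV unfolding K_def by blast
  have 2: "dim (?Z p) = dim {v \<in> ?Z p. proj v = 0} + dim (proj ` ?Z p)" for p
    by (rule rank_nullity[OF sZ S(1) _ linear_between_mono[OF proj_linear ZK]]) (use S(2) in auto)
  have 3: "{v \<in> ?Z p. proj v = 0} = X ` ?E (\<not> p)" for p
  proof
    show "X ` ?E (\<not> p) \<subseteq> {v \<in> ?Z p. proj v = 0}"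
    proof
      fix v assume "v \<in> X ` ?E (\<not> p)"
      then obtain m where m: "m \<in> P (\<not> p)" "A m = scale c m" "v = X m" by blast
      have mV: "m \<in> V" using m(1) P_subset_V by blast
      have "v \<in> P p" using X_odd[OF m(1)] m(3) by simp
      moreover have "A v = scale c v"
        using A(3)[OF mV] m X_linear mV by (simp add: linear_between_def)
      moreover have "v \<in> I" using m(3) mV unfolding I_def by blast
      moreover from this have "v \<in> K" using I_subset_K by blast
      ultimately show "v \<in> {v \<in> ?Z p. proj v = 0}" using proj_eq_0_iff[of v] by (simp add: mem_K)
    qed
    show "{v \<in> ?Z p. proj v = 0} \<subseteq> X ` ?E (\<not> p)"
    proof
      fix v assume v: "v \<in> {v \<in> ?Z p. proj v = 0}"
      then have "v \<in> K" using ZK by blast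
      then have "v \<in> I \<inter> P p" using v proj_eq_0_iff by auto
      then obtain m where m: "m \<in> P (\<not> p)" "v = X m" unfolding I_Int_P by blast
      have mV: "m \<in> V" using m(1) P_subset_V by blast
      have AmV: "A m \<in> V" "scale c m \<in> V" using A(2)[OF m(1)] P_subset_V subspace_scale[OF subspace_V mV] by auto
      have "X (A m - scale c m) = X (A m) - X (scale c m)"
        by (rule linear_between_diff[OF subspace_V X_linear AmV])
      also have "\<dots> = 0" using A(3)[OF mV] m(2) v X_linear mV by (simp add: linear_between_def)
      finally have X0: "X (A m - scale c m) = 0" .
      \<comment> \<open>Modulo the kernel of \<open>X\<close> the preimage \<open>m\<close> is an
        eigenvector. Lifting it changes \<open>m\<close> only by an element of \<open>K\<close>, so
        \<open>X m\<close> stays the same.\<close>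
      have "\<exists>u\<in>P (\<not> p). A u = scale c u \<and> m - u \<in> K \<inter> P (\<not> p)"
      proof (rule approximate_eigenvector[OF subspace_P linP D _ _ m(1)])
        show "subspace (K \<inter> P (\<not> p))" by (rule subspace_inter[OF subspace_K subspace_P])
        show "A v \<in> K \<inter> P (\<not> p)" if "v \<in> K \<inter> P (\<not> p)" for v
          using that A(2)[of v "\<not> p"] P_subset_V A(3)[of v] linear_between_zero[OF subspace_V A(1)]
          by (auto simp: mem_K)
        have "A m - scale c m \<in> P (\<not> p)"
          using m(1) A(2) by (auto intro!: subspace_diff subspace_scale subspace_P)
        then show "A m - scale c m \<in> K \<inter> P (\<not> p)" using X0 P_subset_V by (auto simp: mem_K)
      qed
      then obtain u where u: "u \<in> P (\<not> p)" "A u = scale c u" "m - u \<in> K" by blast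
      have uV: "u \<in> V" using u(1) P_subset_V by blast
      have "X m - X u = 0" using linear_between_diff[OF subspace_V X_linear mV uV] u(3) by (simp add: mem_K)
      then show "v \<in> X ` ?E (\<not> p)" using u m(2) by auto
    qed
  qed
  have "?Z p = {v \<in> K \<inter> P p. A v = scale c v}" for p using P_subset_V unfolding K_def by blast
  then have 4: "proj ` ?Z p = {q \<in> C p. proj (A q) = scale c q}" for p
    using proj_eigenvectors[OF A D] by simp
  show ?thesis
    using 1[of False] 1[of True] 2[of False] 2[of True] unfolding 3 4 by simp
qed

end

lemma (in super_complex) split_exists:
  obtains C where "split_super_complex scale P X C"
proof -
  have "\<exists>C. subspace C \<and> C \<subseteq> K \<inter> P p \<and> C \<inter> (I \<inter> P p) = {0} \<and> (\<forall>v\<in>K \<inter> P p. \<exists>u\<in>C. v - u \<in> I \<inter> P p)" for p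
  proof -
    have "I \<inter> P p \<subseteq> K \<inter> P p" using I_subset_K by blast
    from complement_exists[OF subspace_inter[OF subspace_I subspace_P]
      subspace_inter[OF subspace_K subspace_P] this] show ?thesis by metis
  qed
  then obtain C where C: "\<And>p. subspace (C p) \<and> C p \<subseteq> K \<inter> P p \<and> C p \<inter> (I \<inter> P p) = {0}
      \<and> (\<forall>v\<in>K \<inter> P p. \<exists>u\<in>C p. v - u \<in> I \<inter> P p)" by metis
  have "split_super_complex scale P X C"
    by unfold_locales (use C in blast)+
  then show thesis by (rule that)
qed

section \<open>Root decompositions\<close>

locale lsa =
  fixes L :: "'g::ab_group_add lie_super"
  assumes lsa: "lie_superalgebra L"

sublocale lsa \<subseteq> alg: graded_space "scl L" "part L"
proof -
  have "super_space (scl L) (part L)" using lsa by (simp add: lie_superalgebra_def)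
  moreover from this have "vector_space (scl L)" by (simp add: super_space_def)
  ultimately show "graded_space (scl L) (part L)"
    by (intro graded_space.intro cvector_space.intro graded_space_axioms.intro)
qed

context lsa
begin

lemmas lsa_conjuncts = lsa[unfolded lie_superalgebra_def]
lemmas brk_bilinear = lsa_conjuncts[THEN conjunct2, THEN conjunct1]
lemmas brk_parts = lsa_conjuncts[THEN conjunct2, THEN conjunct2, THEN conjunct1, rule_format]
lemmas brk_part = brk_parts[THEN conjunct1]
lemmas brk_comm = brk_parts[THEN conjunct2]
lemmas jacobi = lsa_conjuncts[THEN conjunct2, THEN conjunct2, THEN conjunct2, rule_format]

lemma subspace_car: "alg.subspace (car L)"
  unfolding car_def by (rule alg.subspace_V)

lemma part_subset_car: "part L p \<subseteq> car L"
  unfolding car_def by (rule alg.P_subset_V)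

lemma part_car [simp]: "a \<in> part L p \<Longrightarrow> a \<in> car L"
  using part_subset_car by blast

lemma car_add [simp]: "a \<in> car L \<Longrightarrow> b \<in> car L \<Longrightarrow> a + b \<in> car L"
  by (rule alg.subspace_add[OF subspace_car])

lemma car_scale [simp]: "a \<in> car L \<Longrightarrow> scl L c a \<in> car L"
  by (rule alg.subspace_scale[OF subspace_car])

lemma car_cases:
  assumes "v \<in> car L"
  obtains a b where "a \<in> part L p" "b \<in> part L (\<not> p)" "v = a + b"
  using alg.V_cases assms unfolding car_def by metis

lemma brk_linear_right: "a \<in> car L \<Longrightarrow> linear_between (scl L) (car L) (scl L) (brk L a)"
  using brk_bilinear by (simp add: bilinear_between_def)

lemma brk_linear_left: "b \<in> car L \<Longrightarrow> linear_between (scl L) (car L) (scl L) (\<lambda>a. brk L a b)"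
  using brk_bilinear by (simp add: bilinear_between_def)

lemma brk_add_right: "a \<in> car L \<Longrightarrow> b \<in> car L \<Longrightarrow> c \<in> car L \<Longrightarrow> brk L a (b + c) = brk L a b + brk L a c"
  using brk_linear_right[of a] by (simp add: linear_between_def)

lemma brk_add_left: "a \<in> car L \<Longrightarrow> b \<in> car L \<Longrightarrow> c \<in> car L \<Longrightarrow> brk L (a + b) c = brk L a c + brk L b c"
  using brk_linear_left[of c] by (simp add: linear_between_def)

lemma brk_scale_right: "a \<in> car L \<Longrightarrow> b \<in> car L \<Longrightarrow> brk L a (scl L z b) = scl L z (brk L a b)"
  using brk_linear_right[of a] by (simp add: linear_between_def)

lemma brk_scale_left: "a \<in> car L \<Longrightarrow> b \<in> car L \<Longrightarrow> brk L (scl L z a) b = scl L z (brk L a b)"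
  using brk_linear_left[of b] by (simp add: linear_between_def)

lemma brk_zero_right: "a \<in> car L \<Longrightarrow> brk L a 0 = 0"
  by (rule alg.linear_between_zero[OF subspace_car brk_linear_right])

lemma brk_zero_left: "a \<in> car L \<Longrightarrow> brk L 0 a = 0"
  using alg.linear_between_zero[OF subspace_car brk_linear_left] by simp

lemma brk_sum_right:
  "a \<in> car L \<Longrightarrow> (\<And>i. i \<in> F \<Longrightarrow> b i \<in> car L) \<Longrightarrow> brk L a (\<Sum>i\<in>F. b i) = (\<Sum>i\<in>F. brk L a (b i))"
  by (rule alg.linear_between_sum[OF subspace_car brk_linear_right])

lemma brk_sum_left:
  "a \<in> car L \<Longrightarrow> (\<And>i. i \<in> F \<Longrightarrow> b i \<in> car L) \<Longrightarrow> brk L (\<Sum>i\<in>F. b i) a = (\<Sum>i\<in>F. brk L (b i) a)"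
  by (rule alg.linear_between_sum[where f = "\<lambda>x. brk L x a", OF subspace_car brk_linear_left])

lemma brk_car: "a \<in> car L \<Longrightarrow> b \<in> car L \<Longrightarrow> brk L a b \<in> car L"
proof -
  assume "a \<in> car L" "b \<in> car L"
  then obtain a0 a1 b0 b1 where
    a: "a0 \<in> part L False" "a1 \<in> part L True" "a = a0 + a1" and
    b: "b0 \<in> part L False" "b1 \<in> part L True" "b = b0 + b1"
    using car_cases[of a False] car_cases[of b False] by (metis (full_types))
  have "brk L x y \<in> car L" if "x \<in> part L p" "y \<in> part L q" for x y p q
    using brk_part[OF that] by simp
  then show ?thesis using a b
    by (auto simp: brk_add_left brk_add_right alg.subspace_add[OF subspace_car] intro!: alg.subspace_add[OF subspace_car])
qed

lemma even_comm: "h \<in> part L False \<Longrightarrow> a \<in> car L \<Longrightarrow> brk L a h = - brk L h a"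
proof -
  assume h: "h \<in> part L False" and "a \<in> car L"
  then obtain a0 a1 where a: "a0 \<in> part L False" "a1 \<in> part L True" "a = a0 + a1"
    using car_cases[of a False] by (metis (full_types))
  have "brk L a0 h = - brk L h a0" "brk L a1 h = - brk L h a1"
    using brk_comm[OF a(1) h] brk_comm[OF a(2) h] by (simp_all add: ksign_def)
  then show ?thesis using a h by (simp add: brk_add_left brk_add_right)
qed

lemma even_derivation:
  assumes h: "h \<in> part L False" and a: "a \<in> car L" and b: "b \<in> car L"
  shows "brk L h (brk L a b) = brk L (brk L h a) b + brk L a (brk L h b)"
proof -
  obtain a0 a1 where a': "a0 \<in> part L False" "a1 \<in> part L True" "a = a0 + a1"
    using car_cases[OF a, of False] by (metis (full_types))
  obtain b0 b1 where b': "b0 \<in> part L False" "b1 \<in> part L True" "b = b0 + b1"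
    using car_cases[OF b, of False] by (metis (full_types))
  have *: "brk L h (brk L x y) = brk L (brk L h x) y + brk L x (brk L h y)"
    if "x \<in> part L p" "y \<in> part L q" for x y p q
    using jacobi[OF h that] by (simp add: ksign_def)
  note [simp] = *[OF a'(1) b'(1)] *[OF a'(1) b'(2)] *[OF a'(2) b'(1)] *[OF a'(2) b'(2)]
  show ?thesis using h a' b'
    by (simp add: brk_add_left brk_add_right brk_car ac_simps)
qed

end

lemma dual_separated:
  assumes "\<mu> \<in> dual L H" "\<nu> \<in> dual L H" "\<mu> \<noteq> \<nu>"
  shows "\<exists>h\<in>H. \<mu> h \<noteq> \<nu> h"
proof (rule ccontr)
  assume "\<not> ?thesis"
  then have "\<mu> h = \<nu> h" for h using assms(1,2) by (cases "h \<in> H") (auto simp: dual_def)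
  then show False using assms(3) by auto
qed

text \<open>The stage before diagonalizability of \<open>H\<close> is known. Both families of
  algebras enter here and then use the weight calculus to prove that the root spaces span.\<close>

locale lsa_weights = lsa L for L :: "'g::ab_group_add lie_super" +
  fixes H :: "'g set"
  assumes subspace_H: "alg.subspace H"
    and H_even: "H \<subseteq> part L False"
    and H_abelian: "h \<in> H \<Longrightarrow> h' \<in> H \<Longrightarrow> brk L h h' = 0"
begin

lemma H_part [simp]: "h \<in> H \<Longrightarrow> h \<in> part L False"
  using H_even by blast

lemma H_car [simp]: "h \<in> H \<Longrightarrow> h \<in> car L"
  using part_car[OF H_part] .

lemma dual_add: "\<mu> \<in> dual L H \<Longrightarrow> \<nu> \<in> dual L H \<Longrightarrow> \<mu> + \<nu> \<in> dual L H"
  by (auto simp: dual_def linear_between_def algebra_simps)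

lemma dual_uminus: "\<mu> \<in> dual L H \<Longrightarrow> - \<mu> \<in> dual L H"
  by (auto simp: dual_def linear_between_def)

lemma dual_scale: "\<mu> \<in> dual L H \<Longrightarrow> (\<lambda>h. c * \<mu> h) \<in> dual L H"
  by (auto simp: dual_def linear_between_def algebra_simps)

lemma dual_zero: "0 \<in> dual L H"
  by (auto simp: dual_def linear_between_def)

lemma root_space_wsp: "root_space L H \<mu> = alg.wsp (car L) H (brk L) \<mu>"
  by (simp add: root_space_def alg.wsp_def)

lemma brk_H_linear: "h \<in> H \<Longrightarrow> linear_between (scl L) (car L) (scl L) (brk L h)"
  by (rule brk_linear_right) simp

lemma subspace_root_space: "alg.subspace (root_space L H \<mu>)"
  unfolding root_space_wsp by (rule alg.subspace_wsp[OF subspace_car brk_H_linear])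

lemma root_space_car: "a \<in> root_space L H \<mu> \<Longrightarrow> a \<in> car L"
  by (simp add: root_space_def)

lemma root_space_brk:
  assumes "a \<in> root_space L H \<mu>" "b \<in> root_space L H \<nu>"
  shows "brk L a b \<in> root_space L H (\<mu> + \<nu>)"
  using assms
  by (auto simp: root_space_def even_derivation brk_car brk_scale_left brk_scale_right
      alg.scale_left_distrib)

lemma H_subset_root_space: "H \<subseteq> root_space L H 0"
  using H_abelian by (auto simp: root_space_def)

lemma root_space_cases:
  assumes a: "a \<in> root_space L H \<mu>"
  obtains b c where "b \<in> root_space L H \<mu> \<inter> part L p" "c \<in> root_space L H \<mu> \<inter> part L (\<not> p)" "a = b + c"
proof -
  obtain b c where bc: "b \<in> part L p" "c \<in> part L (\<not> p)" "a = b + c"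
    using car_cases[OF root_space_car[OF a]] .
  have "brk L h b = scl L (\<mu> h) b \<and> brk L h c = scl L (\<mu> h) c" if h: "h \<in> H" for h
  proof (rule alg.parts_unique[of _ p])
    show "brk L h b \<in> part L p" using brk_part[OF H_part[OF h] bc(1)] by simp
    show "brk L h c \<in> part L (\<not> p)" using brk_part[OF H_part[OF h] bc(2)] by simp
    show "brk L h b + brk L h c = scl L (\<mu> h) b + scl L (\<mu> h) c"
      using a h bc by (simp add: root_space_def brk_add_right alg.scale_right_distrib)
  qed (use bc in \<open>auto intro: alg.subspace_scale[OF alg.subspace_P]\<close>)
  then show thesis using bc by (intro that[of b c]) (auto simp: root_space_def)
qed

text \<open>\<open>cartan_subalgebra\<close> asks only for nilpotency and self-normalization. That
  \<open>H\<close> acts diagonalizably, which means that this span is all of \<open>car L\<close>,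
  has to be proved for each family.\<close>

definition weight_span :: "'g set" where
  "weight_span = alg.span (\<Union>\<mu>\<in>dual L H. root_space L H \<mu>)"

lemma weight_span_subset: "weight_span \<subseteq> car L"
  unfolding weight_span_def by (rule alg.span_minimal[OF _ subspace_car]) (auto simp: root_space_car)

lemma weight_span_brk: "a \<in> weight_span \<Longrightarrow> b \<in> weight_span \<Longrightarrow> brk L a b \<in> weight_span"
proof -
  assume a: "a \<in> weight_span" and b: "b \<in> weight_span"
  from alg.span_UN_eq_sum[OF subspace_root_space a[unfolded weight_span_def]] obtain F u where
    F: "finite F" "F \<subseteq> dual L H" "\<forall>\<mu>\<in>F. u \<mu> \<in> root_space L H \<mu>" "a = (\<Sum>\<mu>\<in>F. u \<mu>)" by blast
  from alg.span_UN_eq_sum[OF subspace_root_space b[unfolded weight_span_def]] obtain G w where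
    G: "finite G" "G \<subseteq> dual L H" "\<forall>\<mu>\<in>G. w \<mu> \<in> root_space L H \<mu>" "b = (\<Sum>\<mu>\<in>G. w \<mu>)" by blast
  have car: "a \<in> car L" "b \<in> car L" using a b weight_span_subset by blast+
  have "brk L a b = (\<Sum>\<mu>\<in>F. \<Sum>\<nu>\<in>G. brk L (u \<mu>) (w \<nu>))"
  proof -
    have uw: "\<And>\<mu>. \<mu> \<in> F \<Longrightarrow> u \<mu> \<in> car L" "\<And>\<mu>. \<mu> \<in> G \<Longrightarrow> w \<mu> \<in> car L"
      using F(3) G(3) root_space_car by blast+
    have "brk L a b = (\<Sum>\<mu>\<in>F. brk L (u \<mu>) b)" unfolding F(4) by (rule brk_sum_left[OF car(2) uw(1)])
    also have "\<dots> = (\<Sum>\<mu>\<in>F. \<Sum>\<nu>\<in>G. brk L (u \<mu>) (w \<nu>))"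
      unfolding G(4) by (intro sum.cong refl brk_sum_right uw)
    finally show ?thesis .
  qed
  moreover have "brk L (u \<mu>) (w \<nu>) \<in> weight_span" if "\<mu> \<in> F" "\<nu> \<in> G" for \<mu> \<nu>
  proof -
    have "brk L (u \<mu>) (w \<nu>) \<in> root_space L H (\<mu> + \<nu>)" using F(3) G(3) that root_space_brk by blast
    moreover have "\<mu> + \<nu> \<in> dual L H" using F(2) G(2) that dual_add by blast
    ultimately show ?thesis unfolding weight_span_def by (intro alg.span_base) blast
  qed
  ultimately show ?thesis unfolding weight_span_def by (auto intro!: alg.span_sum)
qed

text \<open>For a contragredient algebra this yields the root decomposition at once, since the
  Chevalley generators are weight vectors.\<close>

lemma subalgebra_weight_span: "subalgebra L weight_span"
  unfolding subalgebra_def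
  using weight_span_subset weight_span_brk by (auto simp: weight_span_def)

end

locale cartan_lsa = lsa_weights L H for L :: "'g::ab_group_add lie_super" and H +
  fixes frm
  assumes cartan: "cartan_subalgebra L H"
    and form: "invariant_form L frm"
    and car_weights: "car L \<subseteq> weight_span"
begin

lemmas form_conjuncts = form[unfolded invariant_form_def]
lemmas frm_bilinear = form_conjuncts[THEN conjunct1]
lemmas frm_even_odd = form_conjuncts[THEN conjunct2, THEN conjunct1, rule_format]
lemmas frm_supersym = form_conjuncts[THEN conjunct2, THEN conjunct2, THEN conjunct1, rule_format]
lemmas frm_inv = form_conjuncts[THEN conjunct2, THEN conjunct2, THEN conjunct2, THEN conjunct1, rule_format]
lemmas frm_nondegenerate =
  form_conjuncts[THEN conjunct2, THEN conjunct2, THEN conjunct2, THEN conjunct2, rule_format]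

lemma frm_add_left: "a \<in> car L \<Longrightarrow> b \<in> car L \<Longrightarrow> c \<in> car L \<Longrightarrow> frm (a + b) c = frm a c + frm b c"
  using frm_bilinear by (simp add: bilinear_between_def linear_between_def)

lemma frm_add_right: "a \<in> car L \<Longrightarrow> b \<in> car L \<Longrightarrow> c \<in> car L \<Longrightarrow> frm a (b + c) = frm a b + frm a c"
  using frm_bilinear by (simp add: bilinear_between_def linear_between_def)

lemma frm_scale_left: "a \<in> car L \<Longrightarrow> b \<in> car L \<Longrightarrow> frm (scl L z a) b = z * frm a b"
  using frm_bilinear by (simp add: bilinear_between_def linear_between_def)

lemma frm_scale_right: "a \<in> car L \<Longrightarrow> b \<in> car L \<Longrightarrow> frm a (scl L z b) = z * frm a b"
  using frm_bilinear by (simp add: bilinear_between_def linear_between_def)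

lemma frm_parity: "a \<in> part L p \<Longrightarrow> b \<in> part L q \<Longrightarrow> p \<noteq> q \<Longrightarrow> frm a b = 0"
proof -
  assume a: "a \<in> part L p" and b: "b \<in> part L q" and "p \<noteq> q"
  then show ?thesis using frm_supersym[OF a b] frm_even_odd by (cases p; cases q) auto
qed

lemma frm_sym: "a \<in> part L False \<Longrightarrow> b \<in> part L False \<Longrightarrow> frm a b = frm b a"
  using frm_supersym[of a False b False] by (simp add: ksign_def)

lemma frm_zero_left: "a \<in> car L \<Longrightarrow> frm 0 a = 0"
  using frm_scale_left[of a a 0] by simp

lemma frm_zero_right: "a \<in> car L \<Longrightarrow> frm a 0 = 0"
  using frm_scale_right[of a a 0] by simp

lemma frm_minus_left: "a \<in> car L \<Longrightarrow> b \<in> car L \<Longrightarrow> frm (- a) b = - frm a b"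
  using frm_scale_left[of a b "-1"] by simp

lemma frm_nondeg: "a \<in> car L \<Longrightarrow> a \<noteq> 0 \<Longrightarrow> \<exists>b\<in>car L. frm a b \<noteq> 0"
  using frm_nondegenerate by blast

text \<open>Invariance moves the action of \<open>h\<close> from one argument to the other, so
  \<mu>(h) + \<nu>(h) annihilates the value \<open>frm a b\<close> for every
  \<open>h\<close>.\<close>

lemma frm_root_spaces:
  assumes "\<mu> \<in> dual L H" "\<nu> \<in> dual L H" "a \<in> root_space L H \<mu>" "b \<in> root_space L H \<nu>" "\<nu> \<noteq> - \<mu>"
  shows "frm a b = 0"
proof -
  obtain h where h: "h \<in> H" "\<nu> h \<noteq> (- \<mu>) h"
    using dual_separated[OF assms(2) dual_uminus[OF assms(1)] assms(5)] by blast
  have "frm (brk L a h) b = frm a (brk L h b)"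
    using h assms by (simp add: frm_inv root_space_car)
  moreover have "brk L a h = - scl L (\<mu> h) a"
    using even_comm[of h a] h assms by (simp add: root_space_def)
  moreover have "brk L h b = scl L (\<nu> h) b" using h assms by (simp add: root_space_def)
  ultimately have e: "- (\<mu> h * frm a b) = \<nu> h * frm a b"
    using assms(3,4) by (simp add: frm_scale_left frm_scale_right frm_minus_left root_space_car
        alg.subspace_scale[OF subspace_car])
  then have "(\<nu> h + \<mu> h) * frm a b = 0" unfolding distrib_right by (simp flip: e)
  moreover have "\<nu> h + \<mu> h \<noteq> 0" using h(2) by (simp add: eq_neg_iff_add_eq_0)
  ultimately show ?thesis by simp
qed

text \<open>Of any vector pairing nontrivially with \<open>a\<close>, only the component of weight
  \<open>- \<mu>\<close> and parity \<open>p\<close> contributes.\<close>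

lemma frm_nondeg_root_space:
  assumes \<mu>: "\<mu> \<in> dual L H" and a: "a \<in> root_space L H \<mu>" "a \<in> part L p" "a \<noteq> 0"
  shows "\<exists>b\<in>root_space L H (- \<mu>) \<inter> part L p. frm a b \<noteq> 0"
proof -
  have aL: "a \<in> car L" using a(1) by (rule root_space_car)
  obtain b where b: "b \<in> car L" "frm a b \<noteq> 0" using frm_nondeg[OF aL a(3)] by blast
  have "b \<in> alg.span (\<Union>\<nu>\<in>dual L H. root_space L H \<nu>)"
    using b(1) car_weights by (auto simp: weight_span_def)
  from alg.span_UN_eq_sum[OF subspace_root_space this]
  obtain F u where F: "finite F" "F \<subseteq> dual L H" "\<forall>\<nu>\<in>F. u \<nu> \<in> root_space L H \<nu>" "b = (\<Sum>\<nu>\<in>F. u \<nu>)"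
    by blast
  have uL: "u \<nu> \<in> car L" if "\<nu> \<in> F" for \<nu> using F(3) that root_space_car by blast
  have "frm a (\<Sum>\<nu>\<in>G. u \<nu>) = (\<Sum>\<nu>\<in>G. frm a (u \<nu>))" if "G \<subseteq> F" "finite G" for G
    using that(2,1)
  proof (induction G rule: finite_induct)
    case (insert \<nu> G)
    then have "u \<nu> \<in> car L" "(\<Sum>\<nu>\<in>G. u \<nu>) \<in> car L"
      using uL by (auto intro!: alg.subspace_sum[OF subspace_car])
    then show ?case using insert aL by (simp add: frm_add_right)
  qed (simp add: frm_zero_right aL)
  then have "(\<Sum>\<nu>\<in>F. frm a (u \<nu>)) \<noteq> 0" using b(2) F(1,4) by auto
  then obtain \<nu> where \<nu>: "\<nu> \<in> F" "frm a (u \<nu>) \<noteq> 0" using sum.not_neutral_contains_not_neutral by blast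
  then have "\<nu> = - \<mu>" using frm_root_spaces[OF \<mu> _ a(1)] F(2,3) by blast
  then have "u \<nu> \<in> root_space L H (- \<mu>)" using F(3) \<nu>(1) by blast
  then obtain c d where cd: "c \<in> root_space L H (- \<mu>) \<inter> part L p"
      "d \<in> root_space L H (- \<mu>) \<inter> part L (\<not> p)" "u \<nu> = c + d"
    by (rule root_space_cases)
  have "c \<in> car L" "d \<in> car L" using cd root_space_car by blast+
  then have "frm a (u \<nu>) = frm a c" using cd aL frm_parity[OF a(2), of d "\<not> p"]
    by (simp add: frm_add_right)
  then show ?thesis using cd \<nu>(2) by auto
qed

text \<open>Self-normalization enters here: an even vector commuting with \<open>H\<close>
  normalizes it.\<close>

lemma zero_root_space_even: "root_space L H 0 \<inter> part L False = H"
proof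
  show "H \<subseteq> root_space L H 0 \<inter> part L False" using H_subset_root_space H_even by blast
  have "brk L a h \<in> H" if "a \<in> root_space L H 0" "h \<in> H" for a h
    using even_comm[of h a] that alg.subspace_0[OF subspace_H] by (auto simp: root_space_def)
  moreover have "{a \<in> part L False. \<forall>h\<in>H. brk L a h \<in> H} = H"
    using cartan unfolding cartan_subalgebra_def by (elim conjE)
  ultimately show "root_space L H 0 \<inter> part L False \<subseteq> H" by blast
qed

lemma frm_nondeg_H: "h \<in> H \<Longrightarrow> (\<And>h'. h' \<in> H \<Longrightarrow> frm h h' = 0) \<Longrightarrow> h = 0"
proof (rule ccontr)
  assume h: "h \<in> H" "\<And>h'. h' \<in> H \<Longrightarrow> frm h h' = 0" "h \<noteq> 0"
  then have "h \<in> root_space L H 0" using H_subset_root_space by blast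
  from frm_nondeg_root_space[OF dual_zero this H_part[OF h(1)] h(3)]
  obtain b where "b \<in> root_space L H 0 \<inter> part L False" "frm h b \<noteq> 0" by auto
  then show False using h(2) zero_root_space_even by blast
qed

text \<open>The relation behind the definite description \<open>dual_vector\<close>. It can be
  computed with before existence and uniqueness of a representative are known.\<close>

definition represents :: "'g \<Rightarrow> ('g \<Rightarrow> complex) \<Rightarrow> bool" where
  "represents t \<gamma> \<longleftrightarrow> t \<in> H \<and> (\<forall>h\<in>H. frm t h = \<gamma> h)"

lemma represents_unique: "represents t \<gamma> \<Longrightarrow> represents t' \<gamma> \<Longrightarrow> t = t'"
proof -
  assume a: "represents t \<gamma>" "represents t' \<gamma>"
  then have "t \<in> H" "t' \<in> H" by (simp_all add: represents_def)
  then have d: "t - t' \<in> H" by (rule alg.subspace_diff[OF subspace_H])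
  have "frm (t - t') h = 0" if "h \<in> H" for h
  proof -
    have "frm t h = frm ((t - t') + t') h" by simp
    also have "\<dots> = frm (t - t') h + frm t' h"
      by (rule frm_add_left) (use d that \<open>t' \<in> H\<close> in simp_all)
    finally have "frm t h = frm (t - t') h + frm t' h" .
    moreover have "frm t h = \<gamma> h" "frm t' h = \<gamma> h" using a that by (simp_all add: represents_def)
    ultimately show ?thesis by simp
  qed
  then show ?thesis using frm_nondeg_H[OF d] by simp
qed

lemma dual_vector_eq: "represents t \<gamma> \<Longrightarrow> dual_vector H frm \<gamma> = t"
  unfolding dual_vector_def represents_def[symmetric]
  by (rule the_equality) (auto intro: represents_unique)

lemma represents_add: "represents t \<gamma> \<Longrightarrow> represents t' \<gamma>' \<Longrightarrow> represents (t + t') (\<gamma> + \<gamma>')"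
  using alg.subspace_add[OF subspace_H] by (auto simp: represents_def frm_add_left)

lemma represents_uminus: "represents t \<gamma> \<Longrightarrow> represents (- t) (- \<gamma>)"
  using alg.subspace_neg[OF subspace_H] by (auto simp: represents_def frm_minus_left)

text \<open>This is the formula [a,b] = (a,b) t, with t the dual vector of \<gamma>, tested against
  \<open>H\<close> so that t does not have to exist beforehand. It comes from ([a,b],h) =
  (a,[b,h]).\<close>

lemma brk_opposite_roots:
  assumes \<gamma>: "\<gamma> \<in> dual L H" and a: "a \<in> root_space L H \<gamma>" "a \<in> part L p"
    and b: "b \<in> root_space L H (- \<gamma>)" "b \<in> part L p"
  shows "brk L a b \<in> H" "h \<in> H \<Longrightarrow> frm (brk L a b) h = frm a b * \<gamma> h"
proof -
  have "brk L a b \<in> root_space L H 0" using root_space_brk[OF a(1) b(1)] by simp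
  moreover have "brk L a b \<in> part L False" using brk_part[OF a(2) b(2)] by simp
  ultimately show "brk L a b \<in> H" using zero_root_space_even by blast
  assume h: "h \<in> H"
  have "brk L b h = scl L (\<gamma> h) b"
    using even_comm[of h b] h b by (simp add: root_space_def)
  then show "frm (brk L a b) h = frm a b * \<gamma> h"
    using a b h by (simp add: frm_inv frm_scale_right)
qed

lemma represents_brk:
  assumes "\<gamma> \<in> dual L H" "a \<in> root_space L H \<gamma>" "a \<in> part L p"
    and "b \<in> root_space L H (- \<gamma>)" "b \<in> part L p" "frm a b \<noteq> 0"
  shows "represents (scl L (inverse (frm a b)) (brk L a b)) \<gamma>"
  using brk_opposite_roots[OF assms(1-5)] assms(6) alg.subspace_scale[OF subspace_H]
  by (auto simp: represents_def frm_scale_left)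

text \<open>A root vector has a partner in the opposite root space; their bracket, divided by the
  value of the form, is the dual vector.\<close>

lemma represents_odd_root:
  assumes "\<gamma> \<in> odd_roots L H"
  shows "represents (dual_vector H frm \<gamma>) \<gamma>"
proof -
  have \<gamma>: "\<gamma> \<in> dual L H" using assms by (simp add: odd_roots_def roots_def)
  have "0 \<in> root_space L H \<gamma> \<inter> part L True"
    using alg.subspace_0[OF subspace_root_space] alg.subspace_0[OF alg.subspace_P] by blast
  then obtain a where a: "a \<in> root_space L H \<gamma>" "a \<in> part L True" "a \<noteq> 0"
    using assms unfolding odd_roots_def by blast
  obtain b where b: "b \<in> root_space L H (- \<gamma>) \<inter> part L True" "frm a b \<noteq> 0"
    using frm_nondeg_root_space[OF \<gamma> a] by blast
  then have "represents (scl L (inverse (frm a b)) (brk L a b)) \<gamma>"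
    using represents_brk[OF \<gamma> a(1,2)] by blast
  then show ?thesis using dual_vector_eq by simp
qed

end

section \<open>Sets of orthogonal isotropic roots\<close>

text \<open>The assumption is phrased for an arbitrary functional and concludes
  \<open>e = 0\<close>. It can thus be applied to \<beta>_i + \<beta>_j and \<beta>_i - \<beta>_j
  without asking first whether these are roots.\<close>

locale ds_setting = cartan_lsa L H frm for L :: "'g::ab_group_add lie_super" and H frm +
  assumes no_even_isotropic: "\<gamma> \<in> dual L H \<Longrightarrow> \<gamma> \<noteq> 0 \<Longrightarrow> represents t \<gamma> \<Longrightarrow> \<gamma> t = 0 \<Longrightarrow>
    e \<in> root_space L H \<gamma> \<Longrightarrow> e \<in> part L False \<Longrightarrow> e = 0"

locale ds_data = ds_setting L H frm for L :: "'g::ab_group_add lie_super" and H frm +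
  fixes k :: nat and \<beta> :: "nat \<Rightarrow> 'g \<Rightarrow> complex" and B and xr :: "nat \<Rightarrow> 'g" and x :: 'g and gx :: "'g set"
  assumes B: "B = \<beta> ` {..<k}"
    and isotropic: "B \<subseteq> isotropic_roots L H frm"
    and orthogonal: "\<forall>i<k. \<forall>j<k. i \<noteq> j \<longrightarrow> dual_form H frm (\<beta> i) (\<beta> j) = 0"
    and independent: "lin_indep_family k \<beta>"
    and xr: "\<forall>i<k. xr i \<in> root_space L H (\<beta> i) \<and> xr i \<noteq> 0"
    and x: "x = (\<Sum>i<k. xr i)"
    and ds_sub: "ds_subalgebra L H frm B x gx"
begin

lemma \<beta>_odd_root: "i < k \<Longrightarrow> \<beta> i \<in> odd_roots L H"
  using isotropic by (auto simp: B isotropic_roots_def)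

lemma \<beta>_dual: "i < k \<Longrightarrow> \<beta> i \<in> dual L H"
  using \<beta>_odd_root by (simp add: odd_roots_def roots_def)

lemma \<beta>_add: "i < k \<Longrightarrow> a \<in> H \<Longrightarrow> b \<in> H \<Longrightarrow> \<beta> i (a + b) = \<beta> i a + \<beta> i b"
  using \<beta>_dual[of i] by (simp add: dual_def linear_between_def)

lemma \<beta>_nonzero: "i < k \<Longrightarrow> \<beta> i \<noteq> 0"
  using \<beta>_odd_root by (simp add: odd_roots_def roots_def)

abbreviation t where "t i \<equiv> dual_vector H frm (\<beta> i)"

lemma represents_t: "i < k \<Longrightarrow> represents (t i) (\<beta> i)"
  by (intro represents_odd_root \<beta>_odd_root)

lemma \<beta>_t:
  assumes "i < k" "j < k"
  shows "\<beta> i (t j) = 0"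
proof -
  have "dual_form H frm (\<beta> i) (\<beta> j) = 0"
    using orthogonal assms isotropic by (cases "i = j") (auto simp: B isotropic_roots_def)
  then show ?thesis
    using represents_t[OF assms(1)] represents_t[OF assms(2)] by (simp add: dual_form_def represents_def)
qed

lemma \<beta>_add_nonzero:
  assumes "i < k" "j < k"
  shows "\<beta> i + \<beta> j \<noteq> 0"
proof
  assume 0: "\<beta> i + \<beta> j = 0"
  \<comment> \<open>A sum of two indicators also covers \<open>i = j\<close>, where the coefficient
    is 2. That case is what later gives [x_i, x_i] = 0.\<close>
  let ?c = "\<lambda>l. (if l = i then 1 else 0) + (if l = j then 1 else 0) :: complex"
  have "(\<Sum>l<k. ?c l * \<beta> l h) = \<beta> i h + \<beta> j h" for h
    using assms by (simp add: distrib_right sum.distrib if_distrib[of "\<lambda>z. z * _"] cong: if_cong)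
  moreover have "\<beta> i h + \<beta> j h = 0" for h using fun_cong[OF 0, of h] by simp
  ultimately have "\<forall>h. (\<Sum>l<k. ?c l * \<beta> l h) = 0" by simp
  then have "?c i = 0"
    using independent[unfolded lin_indep_family_def, THEN spec[where x = ?c]] assms(1) by blast
  then show False by (simp split: if_splits)
qed

lemma \<beta>_inj:
  assumes "i < k" "j < k" "i \<noteq> j"
  shows "\<beta> i \<noteq> \<beta> j"
proof
  assume 0: "\<beta> i = \<beta> j"
  let ?c = "\<lambda>l. (if l = i then 1 else 0) - (if l = j then 1 else 0) :: complex"
  have "(\<Sum>l<k. ?c l * \<beta> l h) = \<beta> i h - \<beta> j h" for h
    using assms by (simp add: left_diff_distrib sum_subtractf if_distrib[of "\<lambda>z. z * _"] cong: if_cong)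
  moreover have "\<beta> i h - \<beta> j h = 0" for h using 0 by simp
  ultimately have "\<forall>h. (\<Sum>l<k. ?c l * \<beta> l h) = 0" by simp
  then have "?c i = 0"
    using independent[unfolded lin_indep_family_def, THEN spec[where x = ?c]] assms(1) by blast
  then show False using assms(3) by simp
qed

text \<open>Membership in \<open>odd_roots\<close> only provides some odd root vector. An even one
  of the same weight would be an even isotropic root vector.\<close>

lemma \<beta>_spaces_odd:
  assumes "i < k" "\<gamma> = \<beta> i \<or> \<gamma> = - \<beta> i" "a \<in> root_space L H \<gamma>"
  shows "a \<in> part L True"
proof -
  obtain b c where bc: "b \<in> root_space L H \<gamma> \<inter> part L False"
      "c \<in> root_space L H \<gamma> \<inter> part L (\<not> False)" "a = b + c"
    by (rule root_space_cases[OF assms(3)])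
  have r: "represents (t i) (\<beta> i)" "represents (- t i) (- \<beta> i)"
    using represents_t[OF assms(1)] represents_uminus by auto
  have "\<beta> i (- t i) = 0"
  proof -
    have "\<beta> i (- t i) = frm (t i) (- t i)" "frm (t i) (- t i) = - frm (t i) (t i)"
      using r frm_scale_right[of "t i" "t i" "-1"] by (simp_all add: represents_def)
    then show ?thesis using r(1) \<beta>_t[OF assms(1,1)] by (simp add: represents_def)
  qed
  then have "b = 0"
    using bc(1) assms(1,2) r \<beta>_dual[OF assms(1)] dual_uminus \<beta>_nonzero[OF assms(1)] \<beta>_t[OF assms(1,1)]
      no_even_isotropic[of "\<beta> i" "t i" b] no_even_isotropic[of "- \<beta> i" "- t i" b] by auto
  then show ?thesis using bc by simp
qed

text \<open>The bracket of two odd vectors is even, and its weight is nonzero by independence and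
  isotropic by orthogonality, so it vanishes.\<close>

lemma brk_\<beta>_spaces:
  assumes ij: "i < k" "j < k" and a: "a \<in> root_space L H (\<beta> i)" and b: "b \<in> root_space L H (\<beta> j)"
  shows "brk L a b = 0"
proof (rule no_even_isotropic)
  show "\<beta> i + \<beta> j \<in> dual L H" by (intro dual_add \<beta>_dual ij)
  show "\<beta> i + \<beta> j \<noteq> 0" by (rule \<beta>_add_nonzero[OF ij])
  show r: "represents (t i + t j) (\<beta> i + \<beta> j)" by (intro represents_add represents_t ij)
  have "\<beta> l (t i + t j) = 0" if "l < k" for l
    using represents_t[OF that] represents_t[OF ij(1)] represents_t[OF ij(2)] \<beta>_t[OF that ij(1)] \<beta>_t[OF that ij(2)]
      \<beta>_dual[OF that] by (simp add: dual_def linear_between_def represents_def)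
  then show "(\<beta> i + \<beta> j) (t i + t j) = 0" using ij by simp
  show "brk L a b \<in> root_space L H (\<beta> i + \<beta> j)" by (rule root_space_brk[OF a b])
  show "brk L a b \<in> part L False"
    using brk_part[OF \<beta>_spaces_odd[OF ij(1) _ a] \<beta>_spaces_odd[OF ij(2) _ b]] by simp
qed

text \<open>The same argument for \<beta>_i - \<beta>_j, which is nonzero because the indices
  differ; for equal indices the bracket is a coroot instead.\<close>

lemma brk_\<beta>_opposite_spaces:
  assumes ij: "i < k" "j < k" "i \<noteq> j" and a: "a \<in> root_space L H (\<beta> i)" and b: "b \<in> root_space L H (- \<beta> j)"
  shows "brk L a b = 0"
proof (rule no_even_isotropic)
  show "\<beta> i + - \<beta> j \<in> dual L H" by (intro dual_add dual_uminus \<beta>_dual ij)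
  show "\<beta> i + - \<beta> j \<noteq> 0" using \<beta>_inj[OF ij] by simp
  show r: "represents (t i + - t j) (\<beta> i + - \<beta> j)" by (intro represents_add represents_uminus represents_t ij)
  have "\<beta> l (t i + - t j) = 0" if "l < k" for l
  proof -
    have "frm (t l) (- t j) = - frm (t l) (t j)"
      using represents_t[OF that] represents_t[OF ij(2)] frm_scale_right[of "t l" "t j" "-1"]
      by (simp add: represents_def)
    moreover have H: "t i \<in> H" "t j \<in> H" "- t j \<in> H"
      using represents_t[OF ij(1)] represents_t[OF ij(2)] alg.subspace_neg[OF subspace_H]
      by (simp_all add: represents_def)
    ultimately have "\<beta> l (- t j) = - \<beta> l (t j)"
      using represents_t[OF that] by (simp add: represents_def)
    then show ?thesis using \<beta>_add[OF that H(1,3)] \<beta>_t[OF that] ij by simp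
  qed
  then show "(\<beta> i + - \<beta> j) (t i + - t j) = 0" using ij by simp
  show "brk L a b \<in> root_space L H (\<beta> i + - \<beta> j)" by (rule root_space_brk[OF a b])
  show "brk L a b \<in> part L False"
    using brk_part[OF \<beta>_spaces_odd[OF ij(1) _ a] \<beta>_spaces_odd[OF ij(2) _ b]] by simp
qed

section \<open>The odd element x and its centralizer in the Cartan subalgebra\<close>

lemma xr_root: "i < k \<Longrightarrow> xr i \<in> root_space L H (\<beta> i)"
  using xr by blast

lemma xr_odd: "i < k \<Longrightarrow> xr i \<in> part L True"
  using \<beta>_spaces_odd xr_root by blast

lemma xr_car: "i < k \<Longrightarrow> xr i \<in> car L"
  by (rule part_car[OF xr_odd])

lemma x_odd: "x \<in> part L True"
  unfolding x by (rule alg.subspace_sum[OF alg.subspace_P]) (simp add: xr_odd)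

lemma x_car: "x \<in> car L"
  by (rule part_car[OF x_odd])

lemma brk_x: "b \<in> car L \<Longrightarrow> brk L x b = (\<Sum>i<k. brk L (xr i) b)"
  unfolding x by (rule brk_sum_left) (auto simp: xr_car)

lemma brk_x_x: "brk L x x = 0"
proof -
  have "brk L (xr i) x = 0" if "i < k" for i
  proof -
    have "brk L (xr i) x = (\<Sum>j<k. brk L (xr i) (xr j))"
      unfolding x by (rule brk_sum_right) (auto simp: xr_car that)
    also have "\<dots> = 0" using that brk_\<beta>_spaces xr_root by (intro sum.neutral) auto
    finally show ?thesis .
  qed
  then show ?thesis by (simp add: brk_x[OF x_car])
qed

lemma brk_h_x: "h \<in> H \<Longrightarrow> brk L h x = (\<Sum>i<k. scl L (\<beta> i h) (xr i))"
proof -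
  assume h: "h \<in> H"
  have "brk L h x = (\<Sum>i<k. brk L h (xr i))"
    unfolding x by (rule brk_sum_right) (use h xr_car in auto)
  also have "\<dots> = (\<Sum>i<k. scl L (\<beta> i h) (xr i))"
    using h xr_root by (intro sum.cong) (auto simp: root_space_def)
  finally show ?thesis .
qed

text \<open>The bracket [h, x] is the sum of the \<beta>_i(h) x_i, and the x_i are nonzero of
  pairwise distinct weights, hence independent.\<close>

lemma common_kernel_iff: "common_kernel H B = {h \<in> H. brk L x h = 0}"
proof -
  have "brk L x h = 0 \<longleftrightarrow> (\<forall>i<k. \<beta> i h = 0)" if h: "h \<in> H" for h
  proof
    have eq: "brk L x h = - (\<Sum>i<k. scl L (\<beta> i h) (xr i))"
      using even_comm[OF H_part[OF h] x_car] brk_h_x[OF h] by simp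
    show "\<forall>i<k. \<beta> i h = 0 \<Longrightarrow> brk L x h = 0" using eq by simp
    assume "brk L x h = 0"
    then have sum0: "(\<Sum>i<k. scl L (\<beta> i h) (xr i)) = 0" using eq by simp
    show "\<forall>i<k. \<beta> i h = 0"
    proof (intro allI impI)
      fix i assume i: "i < k"
      have "scl L (\<beta> i h) (xr i) \<in> {0}"
      proof (rule alg.components_in_stable_subspace[where v = "\<lambda>i. scl L (\<beta> i h) (xr i)" and F = "{..<k}"
        and w = \<beta> and S = "{0}" and A = "brk L" and V = "car L" and T = H])
        show "scl L (\<beta> i h) (xr i) \<in> alg.wsp (car L) H (brk L) (\<beta> i)" if "i \<in> {..<k}" for i
          using that xr_root unfolding root_space_wsp[symmetric]
          by (intro alg.subspace_scale[OF subspace_root_space]) auto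
        show "\<exists>h\<in>H. \<beta> i h \<noteq> \<beta> j h" if "i \<in> {..<k}" "j \<in> {..<k}" "i \<noteq> j" for i j
          using that dual_separated[OF \<beta>_dual \<beta>_dual \<beta>_inj] by auto
      qed (use subspace_car brk_H_linear sum0 i in \<open>auto simp: brk_zero_right\<close>)
      then show "\<beta> i h = 0" using xr i by simp
    qed
  qed
  then show ?thesis by (auto simp: common_kernel_def B)
qed

section \<open>The span of the coroots as boundaries\<close>

abbreviation "U \<equiv> coroot_span L H B"

text \<open>For \<open>y\<close> of weight \<open>- \<beta> i\<close> all terms of [x, y] but
  [x_i, y] vanish. Both [x_i, y] and [a, b] represent multiples of \<open>\<beta> i\<close>, so a
  rescaled \<open>y\<close> is a preimage of [a, b]. It is odd, which fixes the sign when [x, y]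
  acts on modules.\<close>

lemma coroot_brk:
  assumes i: "i < k" and a: "a \<in> root_space L H (\<beta> i)" and b: "b \<in> root_space L H (- \<beta> i)"
  shows "brk L a b \<in> H" "brk L a b \<in> brk L x ` part L True"
proof -
  note odd = \<beta>_spaces_odd[OF i _ a] \<beta>_spaces_odd[OF i _ b]
  show aH: "brk L a b \<in> H" using brk_opposite_roots(1)[OF \<beta>_dual[OF i] a _ b] odd by blast
  obtain y where y: "y \<in> root_space L H (- \<beta> i)" "y \<in> part L True" "frm (xr i) y \<noteq> 0"
    using frm_nondeg_root_space[OF \<beta>_dual[OF i] xr_root[OF i] xr_odd[OF i]] xr i by blast
  have yL: "y \<in> car L" by (rule part_car[OF y(2)])
  \<comment> \<open>[x_i, y] represents (x_i, y) times \<open>\<beta> i\<close> and has to be turned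
    into an element representing (a, b) times \<open>\<beta> i\<close>.\<close>
  let ?c = "frm a b / frm (xr i) y"
  have "brk L x y = brk L (xr i) y"
  proof -
    have "brk L x y = (\<Sum>j<k. if j = i then brk L (xr i) y else 0)"
      unfolding brk_x[OF yL] using brk_\<beta>_opposite_spaces[OF _ i _ xr_root y(1)]
      by (intro sum.cong) auto
    then show ?thesis using i by simp
  qed
  then have cy: "brk L x (scl L ?c y) = scl L ?c (brk L (xr i) y)"
    using x_car yL by (simp add: brk_scale_right)
  have xy: "brk L (xr i) y \<in> H" by (rule brk_opposite_roots(1)[OF \<beta>_dual[OF i] xr_root[OF i] xr_odd[OF i] y(1,2)])
  have "represents (brk L a b) (\<lambda>h. frm a b * \<beta> i h)"
    using aH brk_opposite_roots(2)[OF \<beta>_dual[OF i] a _ b] odd by (auto simp: represents_def)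
  moreover have "represents (scl L ?c (brk L (xr i) y)) (\<lambda>h. frm a b * \<beta> i h)"
    using alg.subspace_scale[OF subspace_H xy] y(3) xy
      brk_opposite_roots(2)[OF \<beta>_dual[OF i] xr_root[OF i] xr_odd[OF i] y(1,2)]
    by (auto simp: represents_def frm_scale_left)
  ultimately have "brk L a b = brk L x (scl L ?c y)" using represents_unique cy by metis
  then show "brk L a b \<in> brk L x ` part L True"
    using alg.subspace_scale[OF alg.subspace_P y(2)] by blast
qed

lemma coroot_span_minimal:
  assumes "alg.subspace S" "\<And>i a b. i < k \<Longrightarrow> a \<in> root_space L H (\<beta> i) \<Longrightarrow> b \<in> root_space L H (- \<beta> i) \<Longrightarrow> brk L a b \<in> S"
  shows "U \<subseteq> S"
  unfolding coroot_span_def B using assms by (intro alg.span_minimal) auto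

lemma coroot_span_H: "U \<subseteq> H"
  by (rule coroot_span_minimal[OF subspace_H coroot_brk(1)])

lemma coroot_span_brk_x: "U \<subseteq> brk L x ` part L True"
  by (rule coroot_span_minimal[OF _ coroot_brk(2)])
    (rule alg.subspace_linear_image[OF alg.subspace_P alg.linear_between_mono[OF brk_linear_right[OF x_car] part_subset_car]])

lemma subspace_coroot_span: "alg.subspace U"
  unfolding coroot_span_def by simp

lemma coroot_in_span:
  "i < k \<Longrightarrow> a \<in> root_space L H (\<beta> i) \<Longrightarrow> b \<in> root_space L H (- \<beta> i) \<Longrightarrow> brk L a b \<in> U"
  unfolding coroot_span_def B by (intro alg.span_base) blast

section \<open>The subalgebra g_x and the splitting of h^x\<close>

lemmas ds_conjuncts = ds_sub[unfolded ds_subalgebra_def]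
lemmas subalgebra_gx = ds_conjuncts[THEN conjunct1]
lemmas gx_Int = ds_conjuncts[THEN conjunct2, THEN conjunct1]
lemmas gx_sum = ds_conjuncts[THEN conjunct2, THEN conjunct2, THEN conjunct1]
lemmas gx_span = ds_conjuncts[THEN conjunct2, THEN conjunct2, THEN conjunct2, THEN conjunct1]

lemma subspace_gx: "alg.subspace gx"
  using subalgebra_gx by (simp add: subalgebra_def)

lemma gx_car: "gx \<subseteq> car L"
  using subalgebra_gx by (simp add: subalgebra_def)

lemma gx_centralizes: "a \<in> gx \<Longrightarrow> brk L x a = 0"
proof -
  assume "a \<in> gx"
  moreover have "0 \<in> brk L x ` car L"
    using brk_zero_right[OF x_car] alg.subspace_0[OF subspace_car] by force
  ultimately have "a + 0 \<in> set_sum gx (brk L x ` car L)" unfolding set_sum_def by blast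
  then show ?thesis unfolding gx_sum by (simp add: centralizer_def)
qed

lemma H_Int_gx_subset: "H \<inter> gx \<subseteq> common_kernel H B"
  using gx_centralizes by (auto simp: common_kernel_iff)

text \<open>\<open>gx\<close> is spanned by even elements and full root spaces, each of which is
  graded. This is needed because the commutation rule with x is available for homogeneous
  elements.\<close>

lemma gx_cases:
  assumes "a \<in> gx"
  obtains b c where "b \<in> gx \<inter> part L False" "c \<in> gx \<inter> part L True" "a = b + c"
proof -
  let ?S = "set_sum (gx \<inter> part L False) (gx \<inter> part L True)"
  have sS: "alg.subspace ?S"
    unfolding set_sum_def by (intro alg.subspace_sums alg.subspace_inter subspace_gx alg.subspace_P)
  have z: "0 \<in> gx \<inter> part L p" for p
    using alg.subspace_0[OF subspace_gx] alg.subspace_0[OF alg.subspace_P] by blast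
  have "H \<inter> gx \<subseteq> ?S"
  proof
    fix h assume "h \<in> H \<inter> gx"
    then have "h \<in> gx \<inter> part L False" "h = h + 0" using H_part by auto
    then show "h \<in> ?S" unfolding set_sum_def using z[of True] by blast
  qed
  moreover have "root_space L H \<alpha> \<subseteq> ?S" if \<alpha>: "\<alpha> \<in> ds_roots L H frm B" for \<alpha>
  proof
    fix v assume v: "v \<in> root_space L H \<alpha>"
    have "root_space L H \<alpha> \<subseteq> gx" by (subst gx_span) (use \<alpha> in \<open>auto intro: alg.span_base\<close>)
    moreover obtain b c where "b \<in> root_space L H \<alpha> \<inter> part L False"
      "c \<in> root_space L H \<alpha> \<inter> part L (\<not> False)" "v = b + c"
      by (rule root_space_cases[OF v])
    ultimately have "b \<in> gx \<inter> part L False" "c \<in> gx \<inter> part L True" "v = b + c" by auto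
    then show "v \<in> ?S" unfolding set_sum_def by blast
  qed
  ultimately have "alg.span ((H \<inter> gx) \<union> (\<Union>\<alpha>\<in>ds_roots L H frm B. root_space L H \<alpha>)) \<subseteq> ?S"
    by (intro alg.span_minimal[OF _ sS]) blast
  then have "a \<in> ?S" using assms gx_span by blast
  then show thesis unfolding set_sum_def using that by blast
qed

text \<open>The existence half of h^x = h_x \<oplus> span of the coroots. As \<open>h\<close>
  centralizes x, it equals a + [x, b] with \<open>a\<close> in \<open>gx\<close>; now compare parts
  of weight zero. That of \<open>a\<close> lies in \<open>H \<inter> gx\<close>, and [x_i, b] has
  weight zero only through the component of \<open>b\<close> of weight \<open>- \<beta> i\<close>,
  where it is a coroot.\<close>

lemma common_kernel_decomposition:
  assumes h: "h \<in> common_kernel H B"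
  shows "\<exists>u\<in>H \<inter> gx. h - u \<in> U"
proof -
  \<comment> \<open>\<open>N\<close> absorbs everything of nonzero weight, so membership in
    \<open>Z\<close> means that the remaining part is a combination of coroots.\<close>
  define N where "N = alg.span (\<Union>\<mu>\<in>dual L H - {0}. root_space L H \<mu>)"
  define Z where "Z = set_sum U N"
  have sN: "alg.subspace N" unfolding N_def by simp
  have sZ: "alg.subspace Z"
    unfolding Z_def set_sum_def by (intro alg.subspace_sums subspace_coroot_span sN)
  have NZ: "n \<in> Z" if "n \<in> N" for n
  proof -
    have "n = 0 + n" by simp
    then show ?thesis unfolding Z_def set_sum_def using that alg.subspace_0[OF subspace_coroot_span] by blast
  qed
  have UZ: "n \<in> Z" if "n \<in> U" for n
  proof -
    have "n = n + 0" by simp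
    then show ?thesis unfolding Z_def set_sum_def using that alg.subspace_0[OF sN] by blast
  qed
  have root_N: "v \<in> N" if "v \<in> root_space L H \<mu>" "\<mu> \<in> dual L H" "\<mu> \<noteq> 0" for v \<mu>
    unfolding N_def using that by (intro alg.span_base) blast
  have hH: "h \<in> H" "brk L x h = 0" using h by (auto simp: common_kernel_iff)
  then have "h \<in> set_sum gx (brk L x ` car L)" unfolding gx_sum by (simp add: centralizer_def)
  then obtain a b where ab: "a \<in> gx" "b \<in> car L" "h = a + brk L x b" unfolding set_sum_def by blast
  have "a \<in> alg.span ((H \<inter> gx) \<union> (\<Union>\<alpha>\<in>ds_roots L H frm B. root_space L H \<alpha>))"
    using ab(1) gx_span by blast
  then obtain u r where ur: "u \<in> alg.span (H \<inter> gx)" "r \<in> alg.span (\<Union>\<alpha>\<in>ds_roots L H frm B. root_space L H \<alpha>)"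
      "a = u + r" unfolding alg.span_Un by blast
  have u: "u \<in> H \<inter> gx"
    using ur(1) alg.span_minimal[OF order_refl alg.subspace_inter[OF subspace_H subspace_gx]] by blast
  have "alg.span (\<Union>\<alpha>\<in>ds_roots L H frm B. root_space L H \<alpha>) \<subseteq> N"
    by (rule alg.span_minimal[OF _ sN]) (auto simp: ds_roots_def roots_def intro: root_N)
  then have r: "r \<in> Z" using ur(2) NZ by blast
  have "brk L (xr i) b \<in> Z" if i: "i < k" for i
  proof -
    have "b \<in> alg.span (\<Union>\<nu>\<in>dual L H. root_space L H \<nu>)"
      using ab(2) car_weights by (auto simp: weight_span_def)
    from alg.span_UN_eq_sum[OF subspace_root_space this]
    obtain F w where F: "finite F" "F \<subseteq> dual L H" "\<forall>\<nu>\<in>F. w \<nu> \<in> root_space L H \<nu>" "b = (\<Sum>\<nu>\<in>F. w \<nu>)"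
      by blast
    have wL: "w \<nu> \<in> car L" if "\<nu> \<in> F" for \<nu> using F(3) that root_space_car by blast
    have "brk L (xr i) (w \<nu>) \<in> Z" if \<nu>: "\<nu> \<in> F" for \<nu>
    proof (cases "\<nu> = - \<beta> i")
      case True
      then show ?thesis using coroot_in_span[OF i xr_root[OF i], of "w \<nu>"] F(3) \<nu> UZ by auto
    next
      case False
      then have "\<beta> i + \<nu> \<noteq> 0" by (metis add_eq_0_iff)
      moreover have "brk L (xr i) (w \<nu>) \<in> root_space L H (\<beta> i + \<nu>)"
        using root_space_brk[OF xr_root[OF i]] F(3) \<nu> by blast
      moreover have "\<beta> i + \<nu> \<in> dual L H" using dual_add[OF \<beta>_dual[OF i]] F(2) \<nu> by blast
      ultimately show ?thesis using NZ root_N by blast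
    qed
    then show ?thesis
      unfolding F(4) by (subst brk_sum_right[OF xr_car[OF i] wL]) (auto intro!: alg.subspace_sum[OF sZ])
  qed
  then have "brk L x b \<in> Z"
    unfolding brk_x[OF ab(2)] by (auto intro!: alg.subspace_sum[OF sZ])
  then have "r + brk L x b \<in> Z" using r alg.subspace_add[OF sZ] by blast
  then obtain c n where cn: "c \<in> U" "n \<in> N" "r + brk L x b = c + n" unfolding Z_def set_sum_def by blast
  have n: "n = h - u - c" using ab(3) ur(3) cn(3) by (simp add: algebra_simps)
  have "n \<in> H" unfolding n using hH(1) u cn(1) coroot_span_H by (intro alg.subspace_diff[OF subspace_H]) auto
  then have n0: "n \<in> alg.wsp (car L) H (brk L) 0" using H_subset_root_space unfolding root_space_wsp by blast
  \<comment> \<open>As an element of \<open>H\<close>, \<open>n\<close> has weight zero, whereas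
    \<open>N\<close> is spanned by the other weights.\<close>
  have "n = 0"
  proof (rule ccontr)
    assume "n \<noteq> 0"
    have "0 \<in> dual L H - {0}"
      by (rule alg.wsp_nonzero_weight_in[OF subspace_car brk_H_linear dual_separated n0 \<open>n \<noteq> 0\<close> dual_zero])
        (use cn(2) in \<open>auto simp: N_def root_space_wsp\<close>)
    then show False by simp
  qed
  then have "h - u = c" using n by simp
  then show ?thesis using u cn(1) by blast
qed

text \<open>The uniqueness half: two candidates differ by an element of \<open>gx\<close> that is
  also of the form [x, y].\<close>

lemma proj_along_eqI:
  assumes "u \<in> H \<inter> gx" "h - u \<in> U"
  shows "proj_along (H \<inter> gx) U h = u"
  unfolding proj_along_def
proof (rule the_equality)
  fix u' assume u': "u' \<in> H \<inter> gx \<and> h - u' \<in> U"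
  have "(h - u) - (h - u') \<in> U"
    using alg.subspace_diff[OF subspace_coroot_span assms(2), of "h - u'"] u' by blast
  then have "u' - u \<in> U" by simp
  then have "u' - u \<in> brk L x ` car L" using coroot_span_brk_x part_subset_car by blast
  moreover have "u' - u \<in> gx" using alg.subspace_diff[OF subspace_gx, of u' u] u' assms(1) by blast
  ultimately have "u' - u \<in> gx \<inter> brk L x ` car L" by blast
  then show "u' = u" unfolding gx_Int by simp
qed (use assms in blast)

end

section \<open>The Duflo--Serganova functor on supercharacters\<close>

text \<open>Functionals are extended by zero, so restriction to the smaller Cartan subalgebra must
  overwrite the values off \<open>gx\<close>.\<close>

lemma dual_restrict:
  "\<mu> \<in> dual L H \<Longrightarrow> (\<lambda>h. if h \<in> gx then \<mu> h else 0) \<in> dual (sub_lsa L gx) (H \<inter> gx)"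
  if "Modules.module.subspace (scl L) gx" "vector_space (scl L)"
proof -
  interpret vector_space "scl L" by (rule that(2))
  show "\<mu> \<in> dual L H \<Longrightarrow> ?thesis"
    using subspace_add[OF that(1)] subspace_scale[OF that(1)]
    by (auto simp: dual_def linear_between_def sub_lsa_def)
qed

locale ds_module = ds_data L H frm k \<beta> B xr x gx
  for L :: "'g::ab_group_add lie_super" and H frm k \<beta> B xr x gx +
  fixes M :: "('g, 'v::ab_group_add) super_mod"
  assumes M: "weight_module L H M"
begin

lemmas M_conjuncts = M[unfolded weight_module_def lsa_module_def]
lemmas M_super_space = M_conjuncts[THEN conjunct1, THEN conjunct1]
lemmas act_bilinear = M_conjuncts[THEN conjunct1, THEN conjunct2, THEN conjunct1]
lemmas act_part = M_conjuncts[THEN conjunct1, THEN conjunct2, THEN conjunct2, THEN conjunct1, rule_format]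
lemmas act_brk = M_conjuncts[THEN conjunct1, THEN conjunct2, THEN conjunct2, THEN conjunct2, rule_format]
lemmas M_weights = M_conjuncts[THEN conjunct2, rule_format]

lemma act_linear: "a \<in> car L \<Longrightarrow> linear_between (mscl M) (mcar M) (mscl M) (act M a)"
  using act_bilinear by (simp add: bilinear_between_def)

lemma act_add_left: "a \<in> car L \<Longrightarrow> b \<in> car L \<Longrightarrow> v \<in> mcar M \<Longrightarrow> act M (a + b) v = act M a v + act M b v"
  using act_bilinear by (simp add: bilinear_between_def linear_between_def)

lemma act_scale_left: "a \<in> car L \<Longrightarrow> v \<in> mcar M \<Longrightarrow> act M (scl L c a) v = mscl M c (act M a v)"
  using act_bilinear by (simp add: bilinear_between_def linear_between_def)

lemma act_add_right: "a \<in> car L \<Longrightarrow> v \<in> mcar M \<Longrightarrow> w \<in> mcar M \<Longrightarrow> act M a (v + w) = act M a v + act M a w"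
  using act_bilinear by (simp add: bilinear_between_def linear_between_def)

end

sublocale ds_module \<subseteq> mod: graded_space "mscl M" "mpart M"
proof -
  have "vector_space (mscl M)" using M_super_space by (simp add: super_space_def)
  then show "graded_space (mscl M) (mpart M)" using M_super_space
    by (intro graded_space.intro cvector_space.intro graded_space_axioms.intro)
qed

context ds_module
begin

lemma act_zero_left: "v \<in> mcar M \<Longrightarrow> act M 0 v = 0"
  using act_scale_left[of x v 0] x_car by simp

lemma mpart_mcar: "v \<in> mpart M p \<Longrightarrow> v \<in> mcar M"
  using mod.P_subset_V by (auto simp: mcar_def)

lemma subspace_mcar: "mod.subspace (mcar M)"
  unfolding mcar_def by (rule mod.subspace_V)

lemma act_zero_right: "a \<in> car L \<Longrightarrow> act M a 0 = 0"
  by (rule mod.linear_between_zero[OF subspace_mcar act_linear])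

lemma act_mcar:
  assumes "a \<in> part L p" "v \<in> mcar M"
  shows "act M a v \<in> mcar M"
proof -
  obtain v0 v1 where v: "v0 \<in> mpart M False" "v1 \<in> mpart M (\<not> False)" "v = v0 + v1"
    using assms(2) mod.V_cases[of v False] unfolding mcar_def by metis
  have "act M a v = act M a v0 + act M a v1"
    unfolding v(3) by (intro act_add_right part_car[OF assms(1)] mpart_mcar[OF v(1)] mpart_mcar[OF v(2)])
  moreover have "act M a v0 \<in> mcar M" "act M a v1 \<in> mcar M"
    using mpart_mcar[OF act_part[OF assms(1) v(1)]] mpart_mcar[OF act_part[OF assms(1) v(2)]] .
  ultimately show ?thesis using mod.subspace_add[OF subspace_mcar] by simp
qed

text \<open>As x is odd, [x, x] = 0 acts as twice the square of x.\<close>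

lemma act_x_x: "v \<in> mcar M \<Longrightarrow> act M x (act M x v) = 0"
proof -
  assume v: "v \<in> mcar M"
  have "act M x (act M x v) + act M x (act M x v) = 0"
    using act_brk[OF x_odd x_odd v] brk_x_x act_zero_left[OF v] by (simp add: ksign_def)
  then have "mscl M (1 + 1) (act M x (act M x v)) = 0" unfolding mod.scale_left_distrib by simp
  then show ?thesis unfolding mod.scale_eq_0_iff by simp
qed

end

sublocale ds_module \<subseteq> cx: super_complex "mscl M" "mpart M" "act M x"
proof
  show "linear_between (mscl M) mod.V (mscl M) (act M x)"
    using act_linear[OF x_car] by (simp add: mcar_def)
  show "v \<in> mpart M p \<Longrightarrow> act M x v \<in> mpart M (\<not> p)" for v p using act_part[OF x_odd, of v p] by simp
  show "v \<in> mod.V \<Longrightarrow> act M x (act M x v) = 0" for v using act_x_x by (simp add: mcar_def)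
qed

context ds_module
begin

lemma act_H_linear: "h \<in> H \<Longrightarrow> linear_between (mscl M) (mpart M p) (mscl M) (act M h)"
  by (rule mod.linear_between_mono[OF act_linear]) (auto simp: mpart_mcar)

lemma act_H_part: "h \<in> H \<Longrightarrow> v \<in> mpart M p \<Longrightarrow> act M h v \<in> mpart M p"
  using act_part[OF H_part, of h v p] by simp

lemma weight_space_wsp: "weight_space H' M \<mu> p = mod.wsp (mpart M p) H' (act M) \<mu>"
  by (simp add: weight_space_def mod.wsp_def)

lemma mpart_eigenspaces:
  assumes "h \<in> H"
  shows "mpart M p \<subseteq> mod.span (\<Union>c. {v \<in> mpart M p. act M h v = mscl M c v})"
proof -
  have "(\<Union>\<mu>\<in>dual L H. weight_space H M \<mu> p) \<subseteq> (\<Union>c. {v \<in> mpart M p. act M h v = mscl M c v})"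
    using assms by (auto simp: weight_space_def)
  then show ?thesis unfolding M_weights by (rule mod.span_mono)
qed

lemma act_x_commute:
  assumes "a \<in> gx \<inter> part L p" "v \<in> mcar M"
  shows "act M x (act M a v) = mscl M (ksign True p) (act M a (act M x v))"
  using act_brk[OF x_odd, of a p v] assms gx_centralizes[of a] act_zero_left[OF assms(2)] by simp

lemma act_common_kernel_commute:
  assumes "h \<in> common_kernel H B" "v \<in> mcar M"
  shows "act M x (act M h v) = act M h (act M x v)"
  using act_brk[OF x_odd H_part, of h v] assms act_zero_left[OF assms(2)]
  by (simp add: ksign_def common_kernel_iff)

lemma act_gx_K:
  assumes "a \<in> gx" "v \<in> cx.K"
  shows "act M a v \<in> cx.K"
proof -
  obtain b c where bc: "b \<in> gx \<inter> part L False" "c \<in> gx \<inter> part L True" "a = b + c"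
    by (rule gx_cases[OF assms(1)])
  have v: "v \<in> mcar M" "act M x v = 0" using assms(2) by (auto simp: cx.mem_K mcar_def)
  have *: "act M d v \<in> cx.K" if d: "d \<in> gx \<inter> part L p" for d p
  proof -
    have "d \<in> part L p" using d by simp
    then have "act M d v \<in> mcar M" "d \<in> car L" using act_mcar v(1) part_car by blast+
    then show ?thesis using act_x_commute[OF d v(1)] v(2) by (simp add: cx.mem_K mcar_def act_zero_right)
  qed
  have "act M a v = act M b v + act M c v" unfolding bc(3)
    by (rule act_add_left) (use bc gx_car v in auto)
  then show ?thesis using *[OF bc(1)] *[OF bc(2)] mod.subspace_add[OF cx.subspace_K] by simp
qed

lemma act_gx_I:
  assumes "a \<in> gx" "v \<in> cx.I"
  shows "act M a v \<in> cx.I"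
proof -
  obtain b c where bc: "b \<in> gx \<inter> part L False" "c \<in> gx \<inter> part L True" "a = b + c"
    by (rule gx_cases[OF assms(1)])
  obtain m where m: "m \<in> mcar M" "v = act M x m" using assms(2) by (auto simp: cx.I_def mcar_def)
  have v: "v \<in> mcar M" unfolding m(2) by (rule act_mcar[OF x_odd m(1)])
  have *: "act M d v \<in> cx.I" if d: "d \<in> gx \<inter> part L p" for d p
  proof -
    have "act M d m \<in> mcar M" using act_mcar[of d p m] d m(1) by simp
    then have "act M x (act M d m) \<in> cx.I" unfolding cx.I_def mcar_def by blast
    then have "mscl M (ksign True p) (act M d v) \<in> cx.I" using act_x_commute[OF d m(1)] m(2) by simp
    \<comment> \<open>The sign is its own inverse, so multiplying by it once more removes
      it.\<close>
    then have "mscl M (ksign True p) (mscl M (ksign True p) (act M d v)) \<in> cx.I"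
      by (rule mod.subspace_scale[OF cx.subspace_I])
    then show ?thesis by (simp add: ksign_def split: if_splits)
  qed
  have "act M a v = act M b v + act M c v" unfolding bc(3)
    by (rule act_add_left) (use bc gx_car v in auto)
  then show ?thesis using *[OF bc(1)] *[OF bc(2)] mod.subspace_add[OF cx.subspace_I] by simp
qed

text \<open>Writing w = [x, y] makes y a contracting homotopy: on the kernel of x, w acts as x after
  y.\<close>

lemma act_coroot_span:
  assumes "w \<in> U" "q \<in> cx.K"
  shows "act M w q \<in> cx.I"
proof -
  have q: "q \<in> mcar M" "act M x q = 0" using assms(2) by (auto simp: cx.mem_K mcar_def)
  obtain y where y: "y \<in> part L True" "w = brk L x y" using assms(1) coroot_span_brk_x by blast
  have "y \<in> car L" by (rule part_car[OF y(1)])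
  then have "act M w q = act M x (act M y q)"
    using act_brk[OF x_odd y(1) q(1)] q(2) y(2) by (simp add: act_zero_right)
  moreover have "act M y q \<in> mcar M" by (rule act_mcar[OF y(1) q(1)])
  ultimately show ?thesis unfolding cx.I_def mcar_def by blast
qed

end

locale ds_module_split = ds_module L H frm k \<beta> B xr x gx M + cx: split_super_complex "mscl M" "mpart M" "act M x" C
  for L :: "'g::ab_group_add lie_super" and H frm k \<beta> B xr x gx
    and M :: "('g, 'v::ab_group_add) super_mod" and C
begin

text \<open>The action on classes, transported to representatives. Keeping the type of
  \<open>M\<close> makes \<open>Q\<close> eligible as the quotient module in
  \<open>ds_hom\<close>.\<close>

definition Q :: "('g, 'v) super_mod" where
  "Q = \<lparr>mscl = mscl M, mpart = C, act = (\<lambda>a v. cx.proj (act M a v))\<rparr>"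

lemma Q_simps [simp]: "mscl Q = mscl M" "mpart Q = C" "act Q a v = cx.proj (act M a v)"
  by (simp_all add: Q_def)

lemma mcar_Q: "mcar Q = cx.CC"
  by (simp add: mcar_def)

text \<open>The action on a class is independent of its representative, since \<open>gx\<close>
  preserves boundaries.\<close>

lemma proj_act_proj:
  assumes "a \<in> gx" "v \<in> cx.K"
  shows "cx.proj (act M a (cx.proj v)) = cx.proj (act M a v)"
proof -
  have pK: "cx.proj v \<in> cx.K" using cx.proj_K[OF assms(2)] cx.CC_subset by blast
  have "a \<in> car L" using assms(1) gx_car by blast
  then have "act M a (v - cx.proj v) = act M a v - act M a (cx.proj v)"
    using mod.linear_between_diff[OF subspace_mcar act_linear] assms(2) pK
    by (auto simp: cx.mem_K mcar_def)
  moreover have "act M a (v - cx.proj v) \<in> cx.I"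
    using act_gx_I[OF assms(1)] cx.proj_K[OF assms(2)] by blast
  ultimately show ?thesis
    using cx.proj_eq_iff[OF act_gx_K[OF assms] act_gx_K[OF assms(1) pK]] by simp
qed

lemma car_sub_lsa: "car (sub_lsa L gx) \<subseteq> gx"
  unfolding car_def set_sum_def sub_lsa_def using mod.subspace_0 alg.subspace_add[OF subspace_gx] by auto

lemma proj_add: "v \<in> cx.K \<Longrightarrow> w \<in> cx.K \<Longrightarrow> cx.proj (v + w) = cx.proj v + cx.proj w"
  using cx.proj_linear by (simp add: linear_between_def)

lemma proj_scale: "v \<in> cx.K \<Longrightarrow> cx.proj (mscl M c v) = mscl M c (cx.proj v)"
  using cx.proj_linear by (simp add: linear_between_def)

lemma K_mcar: "v \<in> cx.K \<Longrightarrow> v \<in> mcar M"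
  by (simp add: cx.mem_K mcar_def)

lemma proj_diff: "v \<in> cx.K \<Longrightarrow> w \<in> cx.K \<Longrightarrow> cx.proj (v - w) = cx.proj v - cx.proj w"
  by (rule mod.linear_between_diff[OF cx.subspace_K cx.proj_linear])

lemma lsa_module_Q: "lsa_module (sub_lsa L gx) Q"
proof -
  have CK: "v \<in> cx.K" if "v \<in> mcar Q" for v using that cx.CC_subset by (auto simp: mcar_Q)
  have "bilinear_between (scl L) (car (sub_lsa L gx)) (mscl M) (mcar Q) (mscl M) (act Q)"
    unfolding bilinear_between_def linear_between_def
  proof (intro conjI ballI allI)
    fix a v assume "a \<in> car (sub_lsa L gx)" "v \<in> mcar Q"
    then have a: "a \<in> gx" "a \<in> car L" and v: "v \<in> cx.K" "v \<in> mcar M"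
      using car_sub_lsa gx_car CK K_mcar by blast+
    note av = act_gx_K[OF a(1) v(1)]
    {
      fix w assume "w \<in> mcar Q"
      then have w: "w \<in> cx.K" "w \<in> mcar M" using CK K_mcar by blast+
      show "act Q a (v + w) = act Q a v + act Q a w"
        using a v w av act_gx_K[OF a(1) w(1)] by (simp add: act_add_right proj_add)
    next
      fix c
      show "act Q a (mscl M c v) = mscl M c (act Q a v)"
        using act_linear[OF a(2)] v av by (simp add: linear_between_def proj_scale)
    next
      fix b assume "b \<in> car (sub_lsa L gx)"
      then have b: "b \<in> gx" "b \<in> car L" using car_sub_lsa gx_car by blast+
      show "act Q (a + b) v = act Q a v + act Q b v"
        using a b v av act_gx_K[OF b(1) v(1)] by (simp add: act_add_left proj_add)
    next
      fix c
      show "act Q (scl L c a) v = mscl M c (act Q a v)"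
        using a v av by (simp add: act_scale_left proj_scale)
    }
  qed
  moreover have "act Q a v \<in> C (p \<noteq> q)" if "a \<in> part L p \<inter> gx" "v \<in> C q" for a v p q
  proof -
    have v: "v \<in> cx.K" "v \<in> mpart M q" using that(2) cx.C_subset by blast+
    have "act M a v \<in> cx.K \<inter> mpart M (p \<noteq> q)" using act_gx_K[of a v] act_part[of a p v q] that(1) v by blast
    then show ?thesis using cx.proj_part by simp
  qed
  moreover have "act Q (brk L a b) v = act Q a (act Q b v) - mscl M (ksign p q) (act Q b (act Q a v))"
    if a: "a \<in> part L p \<inter> gx" and b: "b \<in> part L q \<inter> gx" and v: "v \<in> mcar Q" for a b v p q
  proof -
    have gx: "a \<in> gx" "b \<in> gx" "v \<in> cx.K" using a b v CK by auto
    have K: "act M a v \<in> cx.K" "act M b v \<in> cx.K" "act M a (act M b v) \<in> cx.K" "act M b (act M a v) \<in> cx.K"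
      by (intro act_gx_K gx)+
    have "act M (brk L a b) v = act M a (act M b v) - mscl M (ksign p q) (act M b (act M a v))"
      using act_brk[of a p b q v] a b K_mcar[OF gx(3)] by simp
    moreover have "mscl M (ksign p q) (act M b (act M a v)) \<in> cx.K"
      by (rule mod.subspace_scale[OF cx.subspace_K K(4)])
    ultimately show ?thesis
      using K gx by (simp add: proj_diff proj_scale proj_act_proj)
  qed
  ultimately show ?thesis
    unfolding lsa_module_def using cx.super_space_C by (simp add: sub_lsa_def)
qed

lemma ds_quotient_Q: "ds_quotient L gx x M Q cx.proj"
proof -
  have K: "{v \<in> mcar M. act M x v = 0} = cx.K" by (simp add: cx.K_def mcar_def)
  have "{v \<in> cx.K. cx.proj v = 0} = act M x ` mcar M"
    using cx.proj_eq_0_iff cx.I_subset_K unfolding cx.I_def mcar_def by blast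
  then show ?thesis
    unfolding ds_quotient_def K Let_def
    using lsa_module_Q cx.proj_linear cx.proj_image_part proj_act_proj by simp
qed

text \<open>\<open>ds_quotient\<close> does not state that the homology is a weight module, yet its
  supercharacter must account for all of it. The kernel is stable under
  \<open>H \<inter> gx\<close>, hence spanned by weight vectors, and \<open>cx.proj\<close>
  preserves weights.\<close>

lemma C_weights:
  "C p \<subseteq> mod.span (\<Union>\<nu>\<in>dual (sub_lsa L gx) (H \<inter> gx). mod.wsp (C p) (H \<inter> gx) (act Q) \<nu>)"
proof
  fix q assume q: "q \<in> C p"
  let ?D = "dual (sub_lsa L gx) (H \<inter> gx)"
  let ?K = "cx.K \<inter> mpart M p"
  have sK: "mod.subspace ?K" by (rule mod.subspace_inter[OF cx.subspace_K mod.subspace_P])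
  have 1: "mpart M p \<subseteq> mod.span (\<Union>\<nu>\<in>?D. mod.wsp (mpart M p) (H \<inter> gx) (act M) \<nu>)"
  proof -
    have "mod.wsp (mpart M p) H (act M) \<mu> \<subseteq> (\<Union>\<nu>\<in>?D. mod.wsp (mpart M p) (H \<inter> gx) (act M) \<nu>)"
      if "\<mu> \<in> dual L H" for \<mu>
    proof -
      have "(\<lambda>h. if h \<in> gx then \<mu> h else 0) \<in> ?D"
        using dual_restrict[OF subspace_gx alg.vector_space_axioms that] .
      moreover have "mod.wsp (mpart M p) H (act M) \<mu>
          \<subseteq> mod.wsp (mpart M p) (H \<inter> gx) (act M) (\<lambda>h. if h \<in> gx then \<mu> h else 0)"
        by (auto simp: mod.wsp_def)
      ultimately show ?thesis by blast
    qed
    then have "(\<Union>\<mu>\<in>dual L H. weight_space H M \<mu> p)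
        \<subseteq> (\<Union>\<nu>\<in>?D. mod.wsp (mpart M p) (H \<inter> gx) (act M) \<nu>)"
      unfolding weight_space_wsp by blast
    from mod.span_mono[OF this] show ?thesis unfolding M_weights[symmetric] .
  qed
  have lin: "linear_between (mscl M) (mpart M p) (mscl M) (act M h)" if "h \<in> H \<inter> gx" for h
    using act_H_linear that by blast
  have stable: "act M h v \<in> ?K" if "h \<in> H \<inter> gx" "v \<in> ?K" for h v
    using that act_gx_K act_H_part by blast
  have "?K = mod.span (\<Union>\<nu>\<in>?D. mod.wsp ?K (H \<inter> gx) (act M) \<nu>)"
    by (rule mod.stable_subspace_spanned[OF mod.subspace_P lin dual_separated 1 sK _ stable]) auto
  moreover have "q \<in> ?K" using q cx.C_subset by blast
  ultimately have "q \<in> mod.span (\<Union>\<nu>\<in>?D. mod.wsp ?K (H \<inter> gx) (act M) \<nu>)" by blast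
  moreover have "mod.subspace (mod.wsp ?K (H \<inter> gx) (act M) \<nu>)" for \<nu>
    by (rule mod.subspace_wsp[OF sK mod.linear_between_mono[OF lin]]) auto
  ultimately obtain F u where F: "finite F" "F \<subseteq> ?D"
      "\<forall>\<nu>\<in>F. u \<nu> \<in> mod.wsp ?K (H \<inter> gx) (act M) \<nu>" "q = (\<Sum>\<nu>\<in>F. u \<nu>)"
    using mod.span_UN_eq_sum[of ?D "\<lambda>\<nu>. mod.wsp ?K (H \<inter> gx) (act M) \<nu>" q] by blast
  have uK: "u \<nu> \<in> cx.K" "u \<nu> \<in> mpart M p" if "\<nu> \<in> F" for \<nu> using F(3) that by (auto simp: mod.wsp_def)
  have "q = cx.proj q" using cx.proj_CC cx.C_subset_CC q by (metis subsetD)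
  also have "\<dots> = (\<Sum>\<nu>\<in>F. cx.proj (u \<nu>))"
    unfolding F(4) by (rule mod.linear_between_sum[OF cx.subspace_K cx.proj_linear uK(1)])
  finally have "q = (\<Sum>\<nu>\<in>F. cx.proj (u \<nu>))" .
  moreover have "cx.proj (u \<nu>) \<in> mod.wsp (C p) (H \<inter> gx) (act Q) \<nu>" if \<nu>: "\<nu> \<in> F" for \<nu>
  proof -
    have "cx.proj (u \<nu>) \<in> C p" using cx.proj_part uK[OF \<nu>] by blast
    moreover have "cx.proj (act M h (cx.proj (u \<nu>))) = mscl M (\<nu> h) (cx.proj (u \<nu>))" if h: "h \<in> H \<inter> gx" for h
    proof -
      have "cx.proj (act M h (cx.proj (u \<nu>))) = cx.proj (act M h (u \<nu>))"
        using proj_act_proj[OF _ uK(1)[OF \<nu>]] h by blast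
      also have "act M h (u \<nu>) = mscl M (\<nu> h) (u \<nu>)" using F(3) \<nu> h by (simp add: mod.wsp_def)
      finally show ?thesis using proj_scale[OF uK(1)[OF \<nu>]] by simp
    qed
    ultimately show ?thesis by (simp add: mod.wsp_def)
  qed
  then have "(\<Sum>\<nu>\<in>F. cx.proj (u \<nu>)) \<in> mod.span (\<Union>\<nu>\<in>?D. mod.wsp (C p) (H \<inter> gx) (act Q) \<nu>)"
    by (intro mod.span_sum mod.span_base) (use F(2) in blast)
  ultimately show "q \<in> mod.span (\<Union>\<nu>\<in>?D. mod.wsp (C p) (H \<inter> gx) (act Q) \<nu>)" by simp
qed

text \<open>On the homology \<open>h\<close> and \<open>u\<close> induce the same operator, because
  \<open>h - u\<close> maps cycles to boundaries. The Euler characteristic argument for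
  \<open>h\<close> then gives equality eigenvalue by eigenvalue.\<close>

lemma sch_eq_sch_Q:
  assumes h: "h \<in> common_kernel H B" and u: "u \<in> H \<inter> gx" and hu: "h - u \<in> U"
  shows "sch L H M h = sch (sub_lsa L gx) (H \<inter> gx) Q u"
proof -
  let ?D = "dual (sub_lsa L gx) (H \<inter> gx)"
  have hH: "h \<in> H" using h by (simp add: common_kernel_def)
  obtain S where S: "finite S" "\<forall>p. mpart M p \<subseteq> mod.span S" using mod.finite_span by blast
  have SC: "C p \<subseteq> mod.span S" for p using cx.C_subset S(2) by blast
  have wM: "mpart M p \<subseteq> mod.span (\<Union>\<mu>\<in>dual L H. mod.wsp (mpart M p) H (act M) \<mu>)" for p
    using M_weights[of p] unfolding weight_space_wsp by simp
  have linQ: "linear_between (mscl M) (C p) (mscl M) (act Q h')" if "h' \<in> H \<inter> gx" for p h'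
  proof -
    have "h' \<in> part L False \<inter> gx" "0 \<in> part L True \<inter> gx"
      using that alg.subspace_0[OF subspace_gx] alg.subspace_0[OF alg.subspace_P] by simp_all
    then have "h' + 0 \<in> car (sub_lsa L gx)"
      unfolding car_def set_sum_def sub_lsa_def by force
    then have "linear_between (mscl M) (mcar Q) (mscl M) (act Q h')"
      using lsa_module_Q by (simp add: lsa_module_def bilinear_between_def)
    then show ?thesis by (rule mod.linear_between_mono) (simp add: mcar_Q cx.C_subset_CC)
  qed
  let ?WM = "{\<mu> \<in> dual L H. \<exists>p. mod.wsp (mpart M p) H (act M) \<mu> \<noteq> {0}}"
  let ?WQ = "{\<nu> \<in> ?D. \<exists>p. mod.wsp (C p) (H \<inter> gx) (act Q) \<nu> \<noteq> {0}}"
  \<comment> \<open>The values of weights of \<open>M\<close> at \<open>h\<close> and of weights of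
    \<open>Q\<close> at \<open>u\<close> are pooled, so that both supercharacters become sums over
    one set and can be compared termwise.\<close>
  let ?Cs = "(\<lambda>\<mu>. \<mu> h) ` ?WM \<union> (\<lambda>\<nu>. \<nu> u) ` ?WQ"
  have "finite ?WM"
    by (rule mod.finite_graded_weights[OF mod.subspace_P act_H_linear dual_separated S(1) S(2)[rule_format] wM])
  moreover have "finite ?WQ"
    by (rule mod.finite_graded_weights[OF cx.subspace_C linQ dual_separated S(1) SC C_weights])
  ultimately have fin: "finite ?Cs" by simp
  have "sch L H M h = (\<Sum>\<mu>\<in>?WM. (of_nat (mod.dim (mod.wsp (mpart M False) H (act M) \<mu>))
      - of_nat (mod.dim (mod.wsp (mpart M True) H (act M) \<mu>))) * exp (\<mu> h))"
    using hH by (simp add: sch_def weight_space_wsp)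
  also have "\<dots> = (\<Sum>c\<in>?Cs. (of_nat (mod.dim {v \<in> mpart M False. act M h v = mscl M c v})
      - of_nat (mod.dim {v \<in> mpart M True. act M h v = mscl M c v})) * exp c)"
    by (rule mod.weight_sum_eq_eigenvalue_sum[OF mod.subspace_P act_H_linear dual_separated S(1)
        S(2)[rule_format] wM hH fin]) auto
  also have "\<dots> = (\<Sum>c\<in>?Cs. (of_nat (mod.dim {q \<in> C False. act Q u q = mscl M c q})
      - of_nat (mod.dim {q \<in> C True. act Q u q = mscl M c q})) * exp c)"
  proof (rule sum.cong[OF refl])
    fix c
    have "cx.proj (act M h q) = act Q u q" if "q \<in> C p" for q p
    proof -
      have q: "q \<in> cx.K" using that cx.C_subset by blast
      have hq: "act M h q \<in> cx.K"
        using act_common_kernel_commute[OF h K_mcar[OF q]] q act_mcar[OF H_part[OF hH] K_mcar[OF q]] hH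
        by (simp add: cx.mem_K mcar_def act_zero_right)
      have "h - u \<in> H" "u \<in> H" using hu coroot_span_H u by blast+
      then have "act M ((h - u) + u) q = act M (h - u) q + act M u q"
        by (intro act_add_left K_mcar[OF q]) auto
      then have "act M h q - act M u q \<in> cx.I" using act_coroot_span[OF hu q] by simp
      then show ?thesis using cx.proj_eq_iff[OF hq act_gx_K[OF _ q]] u by simp
    qed
    then have eq: "{q \<in> C p. cx.proj (act M h q) = mscl M c q} = {q \<in> C p. act Q u q = mscl M c q}" for p
      by auto
    have "int (mod.dim {v \<in> mpart M False. act M h v = mscl M c v})
        - int (mod.dim {v \<in> mpart M True. act M h v = mscl M c v})
      = int (mod.dim {q \<in> C False. cx.proj (act M h q) = mscl M c q})
        - int (mod.dim {q \<in> C True. cx.proj (act M h q) = mscl M c q})"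
    proof (rule cx.super_dim_eigenspace)
      show "linear_between (mscl M) mod.V (mscl M) (act M h)"
        using act_linear[of h] hH by (simp add: mcar_def)
      show "act M h v \<in> mpart M p" if "v \<in> mpart M p" for v p using act_H_part[OF hH that] .
      show "act M x (act M h v) = act M h (act M x v)" if "v \<in> mod.V" for v
        using act_common_kernel_commute[OF h] that by (simp add: mcar_def)
      show "mpart M p \<subseteq> mod.span (\<Union>c. {v \<in> mpart M p. act M h v = mscl M c v})" for p
        by (rule mpart_eigenspaces[OF hH])
    qed
    from arg_cong[OF this, of "of_int :: int \<Rightarrow> complex"]
    show "(of_nat (mod.dim {v \<in> mpart M False. act M h v = mscl M c v})
        - of_nat (mod.dim {v \<in> mpart M True. act M h v = mscl M c v})) * exp c
      = (of_nat (mod.dim {q \<in> C False. act Q u q = mscl M c q})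
        - of_nat (mod.dim {q \<in> C True. act Q u q = mscl M c q})) * exp c"
      unfolding eq by (simp only: of_int_diff of_int_of_nat_eq)
  qed
  also have "\<dots> = (\<Sum>\<nu>\<in>?WQ. (of_nat (mod.dim (mod.wsp (C False) (H \<inter> gx) (act Q) \<nu>))
      - of_nat (mod.dim (mod.wsp (C True) (H \<inter> gx) (act Q) \<nu>))) * exp (\<nu> u))"
    by (rule mod.weight_sum_eq_eigenvalue_sum[OF cx.subspace_C linQ dual_separated S(1)
        SC C_weights u fin, symmetric]) auto
  also have "\<dots> = sch (sub_lsa L gx) (H \<inter> gx) Q u"
    using u by (simp add: sch_def weight_space_def mod.wsp_def)
  finally show ?thesis .
qed

end

section \<open>Homomorphisms of supercharacter rings\<close>

lemma sch_in_supchar_ring: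
  fixes M :: "'g::ab_group_add fd_mod"
  assumes "weight_module L H M"
  shows "(\<lambda>h\<in>H. of_int c * sch L H M h) \<in> carrier (supchar_ring L H)"
proof -
  have "(\<lambda>h\<in>H. of_int c * sch L H M h) = (\<lambda>h\<in>H. \<Sum>i<1. of_int ((\<lambda>_::nat. c) i) * sch L H ((\<lambda>_::nat. M) i) h)"
    by simp
  then show ?thesis unfolding supchar_ring_def using assms by fastforce
qed

lemma sum_sch_in_supchar_ring:
  fixes M :: "nat \<Rightarrow> 'g::ab_group_add fd_mod"
  assumes "\<forall>i<N. weight_module L H (M i)"
  shows "(\<lambda>h\<in>H. \<Sum>i<N. of_int (c i) * sch L H (M i) h) \<in> carrier (supchar_ring L H)"
  unfolding supchar_ring_def using assms by auto

context
  fixes L :: "'g::ab_group_add lie_super" and H :: "'g set" and L' H' ds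
  assumes hom: "ds \<in> ring_hom (supchar_ring L H) (supchar_ring L' (H' :: 'g set))"
begin

lemma ring_hom_supchar_add:
  assumes "F \<in> carrier (supchar_ring L H)" "G \<in> carrier (supchar_ring L H)" "u \<in> H'"
  shows "ds (\<lambda>h\<in>H. F h + G h) u = ds F u + ds G u"
proof -
  have "ds (F \<oplus>\<^bsub>supchar_ring L H\<^esub> G) = ds F \<oplus>\<^bsub>supchar_ring L' H'\<^esub> ds G"
    using hom assms by (simp add: ring_hom_def)
  then show ?thesis using assms(3) by (simp add: supchar_ring_def)
qed

text \<open>Preservation of zero is not part of \<open>ring_hom\<close>; it follows from additivity
  applied to 0 + 0 = 0.\<close>

lemma ring_hom_supchar_zero:
  assumes "u \<in> H'"
  shows "ds (\<lambda>h\<in>H. 0) u = 0"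
proof -
  have "(\<lambda>h\<in>H. 0) \<in> carrier (supchar_ring L H)"
    using sum_sch_in_supchar_ring[of 0] by simp
  from ring_hom_supchar_add[OF this this assms]
  have *: "ds (\<lambda>h\<in>H. (\<lambda>h\<in>H. 0) h + (\<lambda>h\<in>H. 0) h) u = ds (\<lambda>h\<in>H. 0) u + ds (\<lambda>h\<in>H. 0) u" .
  show ?thesis
  proof -
    have "(\<lambda>h\<in>H. (\<lambda>h\<in>H. 0) h + (\<lambda>h\<in>H. 0) h) = (\<lambda>h\<in>H. 0 :: complex)" by auto
    with * show ?thesis by simp
  qed
qed

text \<open>Negative multiples are reached by cancelling one copy of the supercharacter in the
  additive step.\<close>

lemma ring_hom_supchar_int:
  fixes M :: "'g fd_mod"
  assumes M: "weight_module L H M" and u: "u \<in> H'"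
  shows "ds (\<lambda>h\<in>H. of_int c * sch L H M h) u = of_int c * ds (sch L H M) u"
proof -
  let ?G = "\<lambda>c. (\<lambda>h\<in>H. of_int c * sch L H M h)"
  have G1: "?G 1 = sch L H M" by (auto simp: sch_def)
  have step: "ds (?G (c + 1)) u = ds (?G c) u + ds (sch L H M) u" for c
  proof -
    have "?G (c + 1) = (\<lambda>h\<in>H. ?G c h + ?G 1 h)" by (auto simp: distrib_right)
    then show ?thesis
      using ring_hom_supchar_add[OF sch_in_supchar_ring[OF M, of c] sch_in_supchar_ring[OF M, of 1] u] G1
      by simp
  qed
  show ?thesis
  proof (induction c rule: int_induct[where k = 0])
    case base
    then show ?case using ring_hom_supchar_zero[OF u] by (simp only: of_int_0 mult_zero_left lessThan_0 sum.empty)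
  next
    case (step1 i)
    have "of_int i * ds (sch L H M) u + ds (sch L H M) u = of_int (i + 1) * ds (sch L H M) u"
      by (simp add: distrib_right)
    then show ?case unfolding step step1.IH .
  next
    case (step2 i)
    have "ds (?G (i - 1)) u = ds (?G i) u - ds (sch L H M) u"
      using step[of "i - 1"] unfolding diff_add_cancel by (metis add_diff_cancel_right')
    also have "\<dots> = of_int (i - 1) * ds (sch L H M) u"
      unfolding step2.IH by (simp add: left_diff_distrib)
    finally show ?case .
  qed
qed

lemma ring_hom_supchar_sum:
  fixes M :: "nat \<Rightarrow> 'g fd_mod"
  assumes "\<forall>i<N. weight_module L H (M i)" and u: "u \<in> H'"
  shows "ds (\<lambda>h\<in>H. \<Sum>i<N. of_int (c i) * sch L H (M i) h) u = (\<Sum>i<N. of_int (c i) * ds (sch L H (M i)) u)"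
  using assms(1)
proof (induction N)
  case 0
  then show ?case using ring_hom_supchar_zero[OF u] by (simp only: of_int_0 mult_zero_left lessThan_0 sum.empty)
next
  case (Suc N)
  let ?F = "\<lambda>h\<in>H. \<Sum>i<N. of_int (c i) * sch L H (M i) h"
  let ?G = "\<lambda>h\<in>H. of_int (c N) * sch L H (M N) h"
  have M: "\<forall>i<N. weight_module L H (M i)" "weight_module L H (M N)" using Suc.prems by auto
  have "(\<lambda>h\<in>H. \<Sum>i<Suc N. of_int (c i) * sch L H (M i) h) = (\<lambda>h\<in>H. ?F h + ?G h)" by auto
  then have "ds (\<lambda>h\<in>H. \<Sum>i<Suc N. of_int (c i) * sch L H (M i) h) u = ds (\<lambda>h\<in>H. ?F h + ?G h) u"
    by (rule arg_cong)
  also have "\<dots> = ds ?F u + ds ?G u"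
    by (rule ring_hom_supchar_add[OF sum_sch_in_supchar_ring[OF M(1)] sch_in_supchar_ring[OF M(2)] u])
  also have "\<dots> = (\<Sum>i<Suc N. of_int (c i) * ds (sch L H (M i)) u)"
    unfolding Suc.IH[OF M(1)] ring_hom_supchar_int[OF M(2) u] by simp
  finally show ?case .
qed

end

context ds_data
begin

text \<open>The pointwise core of all claims. Taking \<open>u = h\<close> gives the restriction to
  h_x; taking for \<open>u\<close> the projection of \<open>h\<close> gives the pullback to
  h^x.\<close>

lemma ds_hom_value:
  assumes ds: "ds_hom L H gx x ds" and f: "f \<in> carrier (supchar_ring L H)"
    and h: "h \<in> common_kernel H B" and u: "u \<in> H \<inter> gx" and hu: "h - u \<in> U"
  shows "ds f u = f h"
proof -
  obtain N and c :: "nat \<Rightarrow> int" and M :: "nat \<Rightarrow> 'g fd_mod" where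
    M: "\<forall>i<N. weight_module L H (M i)" and f: "f = (\<lambda>h\<in>H. \<Sum>i<N. of_int (c i) * sch L H (M i) h)"
    using f unfolding supchar_ring_def by auto
  have "ds (sch L H (M i)) u = sch L H (M i) h" if "i < N" for i
  proof -
    have Mi: "weight_module L H (M i)" using M that by blast
    interpret ds_module L H frm k \<beta> B xr x gx "M i"
      by unfold_locales (rule Mi)
    obtain C where "split_super_complex (mscl (M i)) (mpart (M i)) (act (M i) x) C"
      by (rule cx.split_exists)
    then interpret cx: split_super_complex "mscl (M i)" "mpart (M i)" "act (M i) x" C .
    interpret s: ds_module_split L H frm k \<beta> B xr x gx "M i" C ..
    have "ds (sch L H (M i)) = sch (sub_lsa L gx) (H \<inter> gx) s.Q"
      using ds Mi s.ds_quotient_Q unfolding ds_hom_def by blast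
    then show ?thesis using s.sch_eq_sch_Q[OF h u hu] by simp
  qed
  moreover have "h \<in> H" using h by (simp add: common_kernel_def)
  moreover have hom: "ds \<in> ring_hom (supchar_ring L H) (supchar_ring (sub_lsa L gx) (H \<inter> gx))"
    using ds by (simp add: ds_hom_def)
  ultimately show ?thesis
    unfolding f ring_hom_supchar_sum[OF hom M u] by simp
qed

lemma ds_eq_restrict:
  assumes ds: "ds_hom L H gx x ds" and f: "f \<in> carrier (supchar_ring L H)"
  shows "ds f = restrict f (H \<inter> gx)"
proof
  fix u
  show "ds f u = restrict f (H \<inter> gx) u"
  proof (cases "u \<in> H \<inter> gx")
    case True
    have "u \<in> common_kernel H B" using True H_Int_gx_subset by blast
    then show ?thesis
      using ds_hom_value[OF ds f _ True, of u] True alg.subspace_0[OF subspace_coroot_span] by simp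
  next
    case False
    \<comment> \<open>Elements of the target ring are restrictions to \<open>H \<inter> gx\<close>,
      so off that set both sides have the same default value.\<close>
    have "ds f \<in> carrier (supchar_ring (sub_lsa L gx) (H \<inter> gx))"
      using ds f by (auto simp: ds_hom_def ring_hom_def)
    then show ?thesis using False by (auto simp: supchar_ring_def)
  qed
qed

lemma pullback_ds_eq_restrict:
  assumes ds: "ds_hom L H gx x ds" and f: "f \<in> carrier (supchar_ring L H)"
  shows "pullback L H B gx (ds f) = restrict f (common_kernel H B)"
proof -
  have "ds f (proj_along (H \<inter> gx) U h) = f h" if h: "h \<in> common_kernel H B" for h
  proof -
    obtain u where u: "u \<in> H \<inter> gx" "h - u \<in> U" using common_kernel_decomposition[OF h] by blast
    then show ?thesis using ds_hom_value[OF ds f h u] proj_along_eqI[OF u] by simp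
  qed
  then show ?thesis unfolding pullback_def by (intro restrict_ext) simp
qed

end

section \<open>Heisenberg subalgebras\<close>

text \<open>Even root vectors of weights \<open>\<gamma>\<close> and \<open>-\<gamma>\<close> with \<open>(\<gamma>,\<gamma>) = 0\<close> span a Heisenberg algebra with
  centre \<open>[e,f]\<close>. No even root is isotropic as soon as all these brackets vanish.\<close>

locale heisenberg_free = cartan_lsa L H frm for L :: "'g::ab_group_add lie_super" and H frm +
  assumes heisenberg: "\<gamma> \<in> dual L H \<Longrightarrow> \<gamma> \<noteq> 0 \<Longrightarrow> e \<in> root_space L H \<gamma> \<Longrightarrow> e \<in> part L False \<Longrightarrow>
    f \<in> root_space L H (- \<gamma>) \<Longrightarrow> f \<in> part L False \<Longrightarrow> brk L e f \<in> H \<Longrightarrow> brk L (brk L e f) e = 0 \<Longrightarrow>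
    brk L (brk L e f) f = 0 \<Longrightarrow> brk L e f = 0"

sublocale heisenberg_free \<subseteq> ds_setting L H frm
proof
  fix \<gamma> t e
  assume \<gamma>: "\<gamma> \<in> dual L H" "\<gamma> \<noteq> 0" and t: "represents t \<gamma>" "\<gamma> t = 0"
    and e: "e \<in> root_space L H \<gamma>" "e \<in> part L False"
  show "e = 0"
  proof (rule ccontr)
    assume "e \<noteq> 0"
    obtain f where f: "f \<in> root_space L H (- \<gamma>)" "f \<in> part L False" "frm e f \<noteq> 0"
      using frm_nondeg_root_space[OF \<gamma>(1) e \<open>e \<noteq> 0\<close>] by blast
    define s where "s = brk L e f"
    have sH: "s \<in> H" unfolding s_def by (rule brk_opposite_roots(1)[OF \<gamma>(1) e f(1,2)])
    have sfrm: "frm s h = frm e f * \<gamma> h" if "h \<in> H" for h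
      unfolding s_def by (rule brk_opposite_roots(2)[OF \<gamma>(1) e f(1,2) that])
    have tH: "t \<in> H" using t by (simp add: represents_def)
    \<comment> \<open>Up to the factor \<open>frm e f\<close>, s is the dual vector t, so
      \<gamma>(s) is a multiple of \<gamma>(t) = 0 and s commutes with \<open>e\<close> and
      \<open>f\<close>. Its vanishing will contradict \<gamma> being nonzero.\<close>
    have "\<gamma> s = frm t s" using t(1) sH by (simp add: represents_def)
    also have "\<dots> = frm s t" by (rule frm_sym[OF H_part[OF tH] H_part[OF sH]])
    also have "\<dots> = 0" using sfrm[OF tH] t(2) by simp
    finally have "\<gamma> s = 0" .
    then have "brk L s e = 0" "brk L s f = 0" using e f sH by (simp_all add: root_space_def)
    then have s0: "s = 0" using heisenberg[OF \<gamma>(1,2) e f(1,2)] sH unfolding s_def by blast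
    have "\<gamma> h = 0" if "h \<in> H" for h
      using sfrm[OF that] s0 f(3) frm_zero_left[OF H_car[OF that]] by simp
    then have "\<gamma> = 0" using \<gamma>(1) unfolding dual_def by (auto simp: fun_eq_iff)
    then show False using \<gamma>(2) by simp
  qed
qed

section \<open>Matrix superalgebras\<close>

text \<open>The parts \<open>P\<close> stay arbitrary, so gl, sl and osp are treated together: what
  matters is the supercommutator and a Cartan subalgebra consisting of the diagonal matrices of the
  algebra.\<close>

locale matrix_lsa = lsa L for L :: "'g::ab_group_add lie_super" +
  fixes H :: "'g set" and frm d P \<phi>
  assumes cartan: "cartan_subalgebra L H"
    and form: "invariant_form L frm"
    and iso: "matrix_iso L d P \<phi>"
    and H_diag: "H = {h \<in> car L. diagonal_mat (\<phi> h)}"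
begin

definition ent :: "'g \<Rightarrow> nat \<Rightarrow> nat \<Rightarrow> complex" where
  "ent a i j = \<phi> a $$ (i, j)"

lemma phi_carrier: "a \<in> car L \<Longrightarrow> \<phi> a \<in> carrier_mat d d"
  using iso unfolding matrix_iso_def by blast

lemma ent_add: "a \<in> car L \<Longrightarrow> b \<in> car L \<Longrightarrow> i < d \<Longrightarrow> j < d \<Longrightarrow> ent (a + b) i j = ent a i j + ent b i j"
proof -
  assume a: "a \<in> car L" "b \<in> car L" "i < d" "j < d"
  then have "\<phi> (a + b) = \<phi> a + \<phi> b" using iso unfolding matrix_iso_def by blast
  then show ?thesis using a phi_carrier[OF a(1)] phi_carrier[OF a(2)] by (simp add: ent_def)
qed

lemma ent_scale: "a \<in> car L \<Longrightarrow> i < d \<Longrightarrow> j < d \<Longrightarrow> ent (scl L c a) i j = c * ent a i j"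
proof -
  assume a: "a \<in> car L" "i < d" "j < d"
  then have "\<phi> (scl L c a) = c \<cdot>\<^sub>m \<phi> a" using iso unfolding matrix_iso_def by blast
  then show ?thesis using a phi_carrier[OF a(1)] by (simp add: ent_def)
qed

lemma ent_zero: "i < d \<Longrightarrow> j < d \<Longrightarrow> ent 0 i j = 0"
  using ent_scale[of 0 i j 0] alg.subspace_0[OF subspace_car] by simp

lemma ent_diff: "a \<in> car L \<Longrightarrow> b \<in> car L \<Longrightarrow> i < d \<Longrightarrow> j < d \<Longrightarrow> ent (a - b) i j = ent a i j - ent b i j"
  using ent_add[of "a - b" b i j] alg.subspace_diff[OF subspace_car, of a b] by simp

lemma ent_eqI:
  assumes "a \<in> car L" "b \<in> car L" "\<And>i j. i < d \<Longrightarrow> j < d \<Longrightarrow> ent a i j = ent b i j"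
  shows "a = b"
proof -
  have "\<phi> a = \<phi> b"
    using phi_carrier[OF assms(1)] phi_carrier[OF assms(2)] assms(3)
    by (intro eq_matI) (auto simp: ent_def)
  moreover have "inj_on \<phi> (car L)" using iso unfolding matrix_iso_def by blast
  ultimately show ?thesis using assms(1,2) by (meson inj_onD)
qed

lemma ent_brk_part:
  assumes "a \<in> part L p" "b \<in> part L q" "i < d" "j < d"
  shows "ent (brk L a b) i j =
    (\<Sum>l<d. ent a i l * ent b l j) - ksign p q * (\<Sum>l<d. ent b i l * ent a l j)"
proof -
  have c: "a \<in> car L" "b \<in> car L" using part_car assms by blast+
  have "\<phi> (brk L a b) = \<phi> a * \<phi> b - ksign p q \<cdot>\<^sub>m (\<phi> b * \<phi> a)"
    using iso assms unfolding matrix_iso_def by blast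
  moreover have "(\<phi> a * \<phi> b) $$ (i, j) = (\<Sum>l<d. ent a i l * ent b l j)"
    "(\<phi> b * \<phi> a) $$ (i, j) = (\<Sum>l<d. ent b i l * ent a l j)"
    using phi_carrier[OF c(1)] phi_carrier[OF c(2)] assms(3,4)
    by (auto simp: ent_def scalar_prod_def lessThan_atLeast0 intro!: sum.cong)
  ultimately show ?thesis
    using phi_carrier[OF c(1)] phi_carrier[OF c(2)] assms(3,4) by (simp add: ent_def)
qed

lemma ent_H: "h \<in> H \<Longrightarrow> i < d \<Longrightarrow> j < d \<Longrightarrow> i \<noteq> j \<Longrightarrow> ent h i j = 0"
proof -
  assume h: "h \<in> H" and ij: "i < d" "j < d" "i \<noteq> j"
  have "diagonal_mat (\<phi> h)" "\<phi> h \<in> carrier_mat d d" using h phi_carrier by (auto simp: H_diag)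
  then show ?thesis using ij by (auto simp: diagonal_mat_def ent_def)
qed

lemma cartan_H: "alg.subspace H" "H \<subseteq> part L False"
  using cartan unfolding cartan_subalgebra_def subalgebra_def by blast+

lemma ent_brk_H:
  assumes h: "h \<in> H" and a: "a \<in> car L" and ij: "i < d" "j < d"
  shows "ent (brk L h a) i j = (ent h i i - ent h j j) * ent a i j"
proof -
  have hp: "h \<in> part L False" using h cartan_H by blast
  have *: "ent (brk L h b) i j = (ent h i i - ent h j j) * ent b i j" if b: "b \<in> part L p" for b p
  proof -
    have "(\<Sum>l<d. ent h i l * ent b l j) = (\<Sum>l<d. if l = i then ent h i i * ent b i j else 0)"
      using ent_H[OF h ij(1)] by (intro sum.cong) auto
    moreover have "(\<Sum>l<d. ent b i l * ent h l j) = (\<Sum>l<d. if l = j then ent b i j * ent h j j else 0)"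
      using ent_H[OF h _ ij(2)] by (intro sum.cong) auto
    ultimately show ?thesis using ent_brk_part[OF hp b ij] ij by (simp add: ksign_def algebra_simps)
  qed
  obtain b c where bc: "b \<in> part L False" "c \<in> part L (\<not> False)" "a = b + c"
    using car_cases[OF a] .
  have car: "h \<in> car L" "b \<in> car L" "c \<in> car L" using part_car hp bc(1,2) by blast+
  have "brk L h a = brk L h b + brk L h c" unfolding bc(3) by (rule brk_add_right[OF car])
  then show ?thesis
    using *[OF bc(1)] *[OF bc(2)] ij car brk_car bc(3) by (simp add: ent_add algebra_simps)
qed

lemma H_commute: "h \<in> H \<Longrightarrow> h' \<in> H \<Longrightarrow> brk L h h' = 0"
proof -
  assume h: "h \<in> H" and h': "h' \<in> H"
  have car: "h \<in> car L" "h' \<in> car L" using h h' by (auto simp: H_diag)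
  show ?thesis
  proof (rule ent_eqI)
    fix i j assume ij: "i < d" "j < d"
    show "ent (brk L h h') i j = ent 0 i j"
      using ent_brk_H[OF h car(2) ij] ent_H[OF h' ij] ent_zero[OF ij] by (cases "i = j") auto
  qed (use car brk_car alg.subspace_0[OF subspace_car] in auto)
qed

end

sublocale matrix_lsa \<subseteq> lsa_weights L H
  by unfold_locales (use cartan_H H_commute in auto)

context matrix_lsa
begin

definition wt :: "nat \<Rightarrow> nat \<Rightarrow> 'g \<Rightarrow> complex" where
  "wt i j h = (if h \<in> H then ent h i i - ent h j j else 0)"

lemma wt_dual: "i < d \<Longrightarrow> j < d \<Longrightarrow> wt i j \<in> dual L H"
  using alg.subspace_add[OF subspace_H] alg.subspace_scale[OF subspace_H]
  by (auto simp: dual_def linear_between_def wt_def ent_add ent_scale algebra_simps)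

text \<open>A matrix unit need not belong to the algebra, for instance in osp. Only the weights of
  the nonzero entries are recorded, and the components are extracted by operators that stay
  inside.\<close>

definition supp :: "'g \<Rightarrow> ('g \<Rightarrow> complex) set" where
  "supp a = {wt i j | i j. i < d \<and> j < d \<and> ent a i j \<noteq> 0}"

lemma finite_supp: "finite (supp a)"
proof -
  have "supp a \<subseteq> (\<lambda>(i, j). wt i j) ` ({..<d} \<times> {..<d})" by (auto simp: supp_def)
  then show ?thesis by (rule finite_subset) simp
qed

text \<open>Induction on the number of weights occurring in \<open>a\<close>. If \<open>h\<close>
  separates two of them, subtracting either value from the action of \<open>h\<close> removes that
  weight, and the difference of the two results is a nonzero multiple of \<open>a\<close>.\<close>

lemma car_weight_span: "a \<in> car L \<Longrightarrow> a \<in> weight_span"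
proof (induction "card (supp a)" arbitrary: a rule: less_induct)
  case less
  show ?case
  proof (cases "\<exists>\<mu>. supp a \<subseteq> {\<mu>}")
    case True
    then obtain \<mu> where \<mu>: "supp a \<subseteq> {\<mu>}" by blast
    show ?thesis
    proof (cases "a = 0")
      case True
      then show ?thesis by (simp add: weight_span_def alg.span_zero)
    next
      case False
      then obtain i j where ij: "i < d" "j < d" "ent a i j \<noteq> 0"
        using ent_eqI[OF less.prems alg.subspace_0[OF subspace_car]] ent_zero by auto
      then have "wt i j \<in> supp a" by (auto simp: supp_def)
      then have "\<mu> \<in> dual L H" using \<mu> wt_dual[OF ij(1,2)] by auto
      have "brk L h a = scl L (\<mu> h) a" if h: "h \<in> H" for h
      proof (rule ent_eqI)
        fix i j assume ij: "i < d" "j < d"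
        have "ent a i j \<noteq> 0 \<Longrightarrow> \<mu> = wt i j" using \<mu> ij by (auto simp: supp_def)
        then show "ent (brk L h a) i j = ent (scl L (\<mu> h) a) i j"
          using ent_brk_H[OF h less.prems ij] ent_scale[OF less.prems ij] h
          by (cases "ent a i j = 0") (auto simp: wt_def)
      qed (use brk_car H_car[OF h] less.prems in auto)
      then have "a \<in> root_space L H \<mu>" using less.prems by (simp add: root_space_def)
      then show ?thesis unfolding weight_span_def using \<open>\<mu> \<in> dual L H\<close> by (intro alg.span_base) blast
    qed
  next
    case False
    then obtain \<mu> \<nu> where \<mu>\<nu>: "\<mu> \<in> supp a" "\<nu> \<in> supp a" "\<mu> \<noteq> \<nu>" by blast
    then have "\<mu> \<in> dual L H" "\<nu> \<in> dual L H" using wt_dual by (auto simp: supp_def)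
    then obtain h where h: "h \<in> H" "\<mu> h \<noteq> \<nu> h" using dual_separated \<mu>\<nu>(3) by blast
    have ha: "brk L h a \<in> car L" using brk_car H_car[OF h(1)] less.prems by blast
    \<comment> \<open>For \<kappa> a weight of \<open>a\<close>, this erases the entries of weight
      \<kappa> and creates no new ones. The scalar c is chosen below so that two such vectors add up
      to \<open>a\<close>.\<close>
    let ?p = "\<lambda>\<kappa> c. scl L (inverse c) (brk L h a - scl L (\<kappa> h) a)"
    have p: "?p \<kappa> c \<in> weight_span" if \<kappa>: "\<kappa> \<in> supp a" for \<kappa> :: "'g \<Rightarrow> complex" and c
    proof (rule less.hyps)
      have sa: "scl L (\<kappa> h) a \<in> car L" using less.prems by simp
      have d: "brk L h a - scl L (\<kappa> h) a \<in> car L" by (rule alg.subspace_diff[OF subspace_car ha sa])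
      then show "?p \<kappa> c \<in> car L" by simp
      have e: "ent (?p \<kappa> c) i j = inverse c * (wt i j h - \<kappa> h) * ent a i j" if ij: "i < d" "j < d" for i j
        using ent_scale[OF d ij] ent_diff[OF ha sa ij] ent_scale[OF less.prems ij]
          ent_brk_H[OF h(1) less.prems ij] h(1) by (simp add: wt_def algebra_simps)
      have "supp (?p \<kappa> c) \<subseteq> supp a - {\<kappa>}"
      proof
        fix \<rho> assume "\<rho> \<in> supp (?p \<kappa> c)"
        then obtain i j where ij: "\<rho> = wt i j" "i < d" "j < d" "ent (?p \<kappa> c) i j \<noteq> 0"
          unfolding supp_def by blast
        then have "wt i j h \<noteq> \<kappa> h" "ent a i j \<noteq> 0" unfolding e[OF ij(2,3)] by auto
        moreover from this have "\<rho> \<in> supp a" unfolding supp_def using ij by blast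
        ultimately show "\<rho> \<in> supp a - {\<kappa>}" using ij(1) by auto
      qed
      then have "supp (?p \<kappa> c) \<subset> supp a" using \<kappa> by blast
      then show "card (supp (?p \<kappa> c)) < card (supp a)" by (rule psubset_card_mono[OF finite_supp])
    qed
    have "?p \<nu> (\<mu> h - \<nu> h) + ?p \<mu> (\<nu> h - \<mu> h) = scl L (inverse (\<mu> h - \<nu> h))
        ((brk L h a - scl L (\<nu> h) a) - (brk L h a - scl L (\<mu> h) a))"
    proof -
      have "inverse (\<nu> h - \<mu> h) = - inverse (\<mu> h - \<nu> h)"
        by (metis inverse_minus_eq minus_diff_eq)
      then show ?thesis by (simp add: alg.scale_right_diff_distrib)
    qed
    also have "(brk L h a - scl L (\<nu> h) a) - (brk L h a - scl L (\<mu> h) a) = scl L (\<mu> h - \<nu> h) a"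
      by (simp add: alg.scale_left_diff_distrib)
    also have "scl L (inverse (\<mu> h - \<nu> h)) \<dots> = a" using h(2) by simp
    finally have "a = ?p \<nu> (\<mu> h - \<nu> h) + ?p \<mu> (\<nu> h - \<mu> h)" ..
    also have "\<dots> \<in> weight_span"
      using p[OF \<mu>\<nu>(2)] p[OF \<mu>\<nu>(1)] unfolding weight_span_def by (rule alg.span_add)
    finally show ?thesis .
  qed
qed

text \<open>The trace of \<open>[e,f]\<close> on an eigenspace of \<open>[e,f]\<close> vanishes, since \<open>e\<close> and \<open>f\<close> preserve it.\<close>

lemma heisenberg_matrix:
  assumes e: "e \<in> part L False" and f: "f \<in> part L False" and s: "brk L e f \<in> H"
    and se: "brk L (brk L e f) e = 0"
  shows "brk L e f = 0"
proof -
  define s where "s = brk L e f"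
  note sH = s[folded s_def]
  have eL: "e \<in> car L" by (rule part_car[OF e])
  \<comment> \<open>Commuting with the diagonal matrix s, \<open>e\<close> has nonzero entries only
    between equal diagonal entries of s.\<close>
  have comm: "ent s i i = ent s j j" if "i < d" "j < d" "ent e i j \<noteq> 0" for i j
    using ent_brk_H[OF sH eL that(1,2)] se that ent_zero by (simp add: s_def)
  have "ent s i i = 0" if i: "i < d" for i
  proof -
    define J where "J = {j \<in> {..<d}. ent s j j = ent s i i}"
    have fJ: "finite J" by (simp add: J_def)
    \<comment> \<open>Every summand contains an entry of \<open>e\<close>, so for \<open>j\<close>
      in the block \<open>J\<close> the summation index may be confined to \<open>J\<close> as
      well.\<close>
    have 1: "(\<Sum>l<d. ent e j l * ent f l j) = (\<Sum>l\<in>J. ent e j l * ent f l j)" if "j \<in> J" for j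
      using that comm[of j] by (intro sum.mono_neutral_right) (force simp: J_def)+
    have 2: "(\<Sum>l<d. ent f j l * ent e l j) = (\<Sum>l\<in>J. ent f j l * ent e l j)" if "j \<in> J" for j
      using that comm[of _ j] by (intro sum.mono_neutral_right) (force simp: J_def)+
    have "(\<Sum>j\<in>J. ent s j j) = (\<Sum>j\<in>J. (\<Sum>l\<in>J. ent e j l * ent f l j) - (\<Sum>l\<in>J. ent f j l * ent e l j))"
    proof (rule sum.cong[OF refl])
      fix j assume j: "j \<in> J"
      then have "j < d" by (simp add: J_def)
      then show "ent s j j = (\<Sum>l\<in>J. ent e j l * ent f l j) - (\<Sum>l\<in>J. ent f j l * ent e l j)"
        unfolding s_def using ent_brk_part[OF e f] 1[OF j] 2[OF j] by (simp add: ksign_def)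
    qed
    also have "\<dots> = (\<Sum>j\<in>J. \<Sum>l\<in>J. ent e j l * ent f l j) - (\<Sum>j\<in>J. \<Sum>l\<in>J. ent f j l * ent e l j)"
      by (rule sum_subtractf)
    also have "(\<Sum>j\<in>J. \<Sum>l\<in>J. ent e j l * ent f l j) = (\<Sum>l\<in>J. \<Sum>j\<in>J. ent e j l * ent f l j)"
      by (rule sum.swap)
    finally have "(\<Sum>j\<in>J. ent s j j) = 0" by (simp add: mult.commute)
    moreover have "(\<Sum>j\<in>J. ent s j j) = (\<Sum>j\<in>J. ent s i i)" by (rule sum.cong) (auto simp: J_def)
    \<comment> \<open>The trace over the block is its size times the common eigenvalue, and the
      block contains \<open>i\<close>.\<close>
    moreover have "card J \<noteq> 0" using i fJ by (auto simp: J_def)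
    ultimately show ?thesis by simp
  qed
  then have "s = 0"
    using ent_H[OF sH] ent_zero by (intro ent_eqI H_car[OF sH] alg.subspace_0[OF subspace_car]) metis
  then show ?thesis by (simp add: s_def)
qed

end

sublocale matrix_lsa \<subseteq> heisenberg_free L H frm
  by unfold_locales (use cartan form car_weight_span heisenberg_matrix in auto)

context cartan_lsa
begin

lemma dual_apply_zero: "\<mu> \<in> dual L H \<Longrightarrow> \<mu> 0 = 0"
proof -
  assume "\<mu> \<in> dual L H"
  then have "\<mu> (scl L 0 0) = 0 * \<mu> 0"
    using alg.subspace_0[OF subspace_H] unfolding dual_def linear_between_def by blast
  then show ?thesis by simp
qed

text \<open>The string consists of pairwise distinct functionals, as \<gamma> is nonzero, while a
  finite-dimensional algebra has finitely many weights.\<close>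

lemma weights_not_unbounded:
  assumes \<mu>: "\<mu> \<in> dual L H" and \<gamma>: "\<gamma> \<in> dual L H" "\<gamma> \<noteq> 0"
  shows "\<exists>n::nat. root_space L H (\<mu> + (\<lambda>h. of_nat n * \<gamma> h)) = {0}"
proof (rule ccontr)
  assume a: "\<not> ?thesis"
  let ?w = "\<lambda>n::nat. \<mu> + (\<lambda>h. of_nat n * \<gamma> h)"
  obtain S where S: "finite S" "\<forall>p. part L p \<subseteq> alg.span S" using alg.finite_span by blast
  have "car L \<subseteq> alg.span S"
    unfolding car_def set_sum_def using S(2) by (auto intro!: alg.span_add)
  then have "finite {\<nu> \<in> dual L H. alg.wsp (car L) H (brk L) \<nu> \<noteq> {0}}"
    by (intro alg.finite_weights[OF subspace_car brk_H_linear dual_separated S(1)])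
      (use car_weights in \<open>auto simp: weight_span_def root_space_wsp\<close>)
  moreover have "range ?w \<subseteq> {\<nu> \<in> dual L H. alg.wsp (car L) H (brk L) \<nu> \<noteq> {0}}"
    using a dual_add[OF \<mu> dual_scale[OF \<gamma>(1)]] unfolding root_space_wsp by blast
  ultimately have "finite (range ?w)" by (rule finite_subset[rotated])
  moreover have "inj ?w"
  proof (rule injI)
    fix m n assume e: "?w m = ?w n"
    obtain h where "\<gamma> h \<noteq> 0" using \<gamma>(2) by (auto simp: fun_eq_iff)
    then show "m = n" using fun_cong[OF e, of h] by simp
  qed
  ultimately show False using finite_imageD infinite_UNIV_nat by blast
qed

text \<open>The oscillator argument: a nonzero eigenvalue of the central element \<open>s = [e,f]\<close> would produce
  an infinite string of weights \<open>\<mu>, \<mu> - \<gamma>, \<mu> - 2\<gamma>, \<dots>\<close> below a vector killed by \<open>e\<close>.\<close>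

lemma heisenberg_central:
  assumes \<gamma>: "\<gamma> \<in> dual L H" "\<gamma> \<noteq> 0"
    and e: "e \<in> root_space L H \<gamma>" "e \<in> part L False"
    and f: "f \<in> root_space L H (- \<gamma>)" "f \<in> part L False"
    and s: "s = brk L e f" "s \<in> H" and se: "brk L s e = 0"
    and v: "v \<in> root_space L H \<mu>" "\<mu> \<in> dual L H" "v \<noteq> 0"
  shows "\<mu> s = 0"
proof (rule ccontr)
  assume d: "\<mu> s \<noteq> 0"
  have eL: "e \<in> car L" and fL: "f \<in> car L" using part_car e(2) f(2) by blast+
  have "e \<noteq> 0"
  proof
    assume "e = 0"
    then have "s = 0" using s(1) brk_zero_left[OF fL] by simp
    then show False using d dual_apply_zero[OF v(2)] by simp
  qed
  moreover have "brk L s e = scl L (\<gamma> s) e" using e(1) s(2) by (simp add: root_space_def)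
  \<comment> \<open>Hence s acts by the same scalar along every string in direction
    \<gamma>.\<close>
  ultimately have \<gamma>s: "\<gamma> s = 0" using se by simp
  define en where "en n = ((brk L e) ^^ n) v" for n
  have en_Suc: "en (Suc n) = brk L e (en n)" for n by (simp add: en_def)
  have en: "en n \<in> root_space L H (\<mu> + (\<lambda>h. of_nat n * \<gamma> h))" for n
  proof (induction n)
    case 0
    have "\<mu> + (\<lambda>h. of_nat 0 * \<gamma> h) = \<mu>" by (auto simp: fun_eq_iff)
    then show ?case using v(1) by (simp only: en_def funpow_0)
  next
    case (Suc n)
    have eq: "\<gamma> + (\<mu> + (\<lambda>h. of_nat n * \<gamma> h)) = \<mu> + (\<lambda>h. of_nat (Suc n) * \<gamma> h)"
      by (auto simp: fun_eq_iff algebra_simps)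
    show ?case using root_space_brk[OF e(1) Suc.IH] unfolding eq en_Suc .
  qed
  obtain n where "root_space L H (\<mu> + (\<lambda>h. of_nat n * \<gamma> h)) = {0}"
    using weights_not_unbounded[OF v(2) \<gamma>] by blast
  then have ex: "en n = 0" using en[of n] by blast
  \<comment> \<open>The last nonzero vector before the powers of \<open>e\<close> reach zero is
    killed by \<open>e\<close>; it serves as the vacuum from which \<open>f\<close>
    descends.\<close>
  define m where "m = (LEAST n. en n = 0)"
  have m: "en m = 0" unfolding m_def using ex by (rule LeastI)
  obtain l where l: "m = Suc l" using m v(3) by (cases m) (auto simp: en_def)
  have w0: "en l \<noteq> 0" using not_less_Least[of l "\<lambda>n. en n = 0"] l unfolding m_def by simp
  have ew: "brk L e (en l) = 0" using m l by (simp add: en_def)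
  define \<mu>' where "\<mu>' = \<mu> + (\<lambda>h. of_nat l * \<gamma> h)"
  have \<mu>': "\<mu>' \<in> dual L H" unfolding \<mu>'_def by (intro dual_add dual_scale v \<gamma>)
  have \<mu>'s: "\<mu>' s = \<mu> s" by (simp add: \<mu>'_def \<gamma>s)
  define w where "w n = ((brk L f) ^^ n) (en l)" for n
  have w_Suc: "w (Suc n) = brk L f (w n)" for n by (simp add: w_def)
  have w: "w n \<in> root_space L H (\<mu>' + (\<lambda>h. of_nat n * (- \<gamma>) h))" for n
  proof (induction n)
    case 0
    have "\<mu>' + (\<lambda>h. of_nat 0 * (- \<gamma>) h) = \<mu>'" by (auto simp: fun_eq_iff)
    then show ?case using en[of l, folded \<mu>'_def] by (simp only: w_def funpow_0)
  next
    case (Suc n)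
    have eq: "- \<gamma> + (\<mu>' + (\<lambda>h. of_nat n * (- \<gamma>) h)) = \<mu>' + (\<lambda>h. of_nat (Suc n) * (- \<gamma>) h)"
      by (auto simp: fun_eq_iff algebra_simps)
    show ?case using root_space_brk[OF f(1) Suc.IH] unfolding eq w_Suc .
  qed
  have wL: "w n \<in> car L" for n using w root_space_car by blast
  have sw: "brk L s (w n) = scl L (\<mu> s) (w n)" for n
    using w[of n] s(2) \<mu>'s \<gamma>s by (simp add: root_space_def)
  \<comment> \<open>Each exchange of \<open>e\<close> with \<open>f\<close> contributes s, which
    acts by \<open>\<mu> s\<close>; passing n + 1 factors \<open>f\<close> adds up to n + 1 such
    terms. As the total factor is nonzero, the descending string never ends.\<close>
  have ladder: "brk L e (w (Suc n)) = scl L (of_nat (Suc n) * \<mu> s) (w n)" for n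
  proof (induction n)
    case 0
    have "brk L e (w (Suc 0)) = brk L s (w 0) + brk L f (brk L e (w 0))"
      unfolding w_Suc s(1) by (rule even_derivation[OF e(2) fL wL])
    moreover have "brk L e (w 0) = 0" using ew by (simp add: w_def)
    ultimately show ?case using sw[of 0] brk_zero_right[OF fL] by simp
  next
    case (Suc n)
    have "brk L e (w (Suc (Suc n))) = brk L s (w (Suc n)) + brk L f (brk L e (w (Suc n)))"
      unfolding w_Suc[of "Suc n"] s(1) by (rule even_derivation[OF e(2) fL wL])
    also have "\<dots> = scl L (\<mu> s) (w (Suc n)) + scl L (of_nat (Suc n) * \<mu> s) (w (Suc n))"
      unfolding Suc.IH sw brk_scale_right[OF fL wL] w_Suc[of n, symmetric] ..
    also have "\<dots> = scl L (\<mu> s + of_nat (Suc n) * \<mu> s) (w (Suc n))"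
      by (rule alg.scale_left_distrib[symmetric])
    also have "\<mu> s + of_nat (Suc n) * \<mu> s = of_nat (Suc (Suc n)) * \<mu> s"
      by (simp add: algebra_simps)
    finally show ?case .
  qed
  have wn: "w n \<noteq> 0" for n
  proof (induction n)
    case 0
    then show ?case using w0 by (simp add: w_def)
  next
    case (Suc n)
    show ?case
    proof
      assume "w (Suc n) = 0"
      then have "scl L (of_nat (Suc n) * \<mu> s) (w n) = 0"
        using ladder[of n] brk_zero_right[OF eL] by simp
      then show False using Suc.IH d by (simp del: of_nat_Suc)
    qed
  qed
  have "- \<gamma> \<noteq> 0" using \<gamma>(2) by simp
  then obtain n where "root_space L H (\<mu>' + (\<lambda>h. of_nat n * (- \<gamma>) h)) = {0}"
    using weights_not_unbounded[OF \<mu>' dual_uminus[OF \<gamma>(1)]] by blast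
  then show False using w[of n] wn[of n] by blast
qed

end

section \<open>Contragredient superalgebras\<close>

text \<open>Invertibility of \<open>A\<close> is stated as a trivial left kernel because \<alpha>_j
  takes the value \<Sum> c_i A_ij on the element \<Sum> c_i h_i of \<open>H\<close>.\<close>

locale contragredient_lsa = lsa L for L :: "'g::ab_group_add lie_super" +
  fixes H :: "'g set" and frm r A e f hh and \<alpha> :: "nat \<Rightarrow> 'g \<Rightarrow> complex"
  assumes cartan: "cartan_subalgebra L H"
    and form: "invariant_form L frm"
    and contra: "contragredient L H r A e f hh"
    and \<alpha>_dual: "j < r \<Longrightarrow> \<alpha> j \<in> dual L H"
    and \<alpha>_hh: "i < r \<Longrightarrow> j < r \<Longrightarrow> \<alpha> j (hh i) = A $$ (i, j)"
    and nonsingular: "(\<And>j. j < r \<Longrightarrow> (\<Sum>i<r. c i * A $$ (i, j)) = 0) \<Longrightarrow> i < r \<Longrightarrow> c i = 0"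
begin

lemmas contra_conjuncts = contra[unfolded contragredient_def]
lemmas gen_parts = contra_conjuncts[THEN conjunct1, rule_format]
lemmas inj_hh = contra_conjuncts[THEN conjunct2, THEN conjunct1]
lemmas indep_hh = contra_conjuncts[THEN conjunct2, THEN conjunct2, THEN conjunct1]
lemmas H_span = contra_conjuncts[THEN conjunct2, THEN conjunct2, THEN conjunct2, THEN conjunct1]
lemmas relations =
  contra_conjuncts[THEN conjunct2, THEN conjunct2, THEN conjunct2, THEN conjunct2, THEN conjunct1, rule_format]
lemmas generation =
  contra_conjuncts[THEN conjunct2, THEN conjunct2, THEN conjunct2, THEN conjunct2, THEN conjunct2,
    THEN conjunct1, rule_format]

lemma gen_car: "i < r \<Longrightarrow> e i \<in> car L" "i < r \<Longrightarrow> f i \<in> car L" "i < r \<Longrightarrow> hh i \<in> car L"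
  using gen_parts part_car by blast+

lemma H_coords: "h \<in> H \<Longrightarrow> \<exists>c. h = (\<Sum>i<r. scl L (c i) (hh i))"
proof -
  assume "h \<in> H"
  then obtain u where "h = (\<Sum>v\<in>hh ` {..<r}. scl L (u v) v)"
    unfolding H_span alg.span_finite[OF finite_imageI[OF finite_lessThan]] by blast
  also have "\<dots> = (\<Sum>i<r. scl L (u (hh i)) (hh i))" by (simp add: sum.reindex[OF inj_hh])
  finally show ?thesis by (rule exI[of _ "\<lambda>i. u (hh i)"])
qed

lemma hh_H: "i < r \<Longrightarrow> hh i \<in> H"
  unfolding H_span by (rule alg.span_base) simp

lemma cartan_H: "alg.subspace H" "H \<subseteq> part L False"
  using cartan unfolding cartan_subalgebra_def subalgebra_def by blast+

lemma H_car': "h \<in> H \<Longrightarrow> h \<in> car L"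
  using cartan_H part_car by blast

lemma H_acts:
  assumes h: "h \<in> H" and a: "a \<in> car L" and \<mu>: "linear_between (scl L) H (*) \<mu>"
    and gen: "\<And>i. i < r \<Longrightarrow> brk L (hh i) a = scl L (\<mu> (hh i)) a"
  shows "brk L h a = scl L (\<mu> h) a"
proof -
  have "h \<in> alg.span (hh ` {..<r})" using h H_span by simp
  then have "h \<in> H \<and> brk L h a = scl L (\<mu> h) a"
  proof (induction rule: alg.span_induct_alt)
    case base
    have "\<mu> (scl L 0 0) = 0 * \<mu> 0"
      using \<mu> alg.subspace_0[OF cartan_H(1)] unfolding linear_between_def by blast
    then show ?case using brk_zero_left[OF a] alg.subspace_0[OF cartan_H(1)] by simp
  next
    case (step c y z)
    then obtain i where i: "i < r" "y = hh i" by blast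
    have y: "y \<in> H" "scl L c y \<in> H" using hh_H i alg.subspace_scale[OF cartan_H(1)] by auto
    have "\<mu> (scl L c y + z) = c * \<mu> y + \<mu> z"
      using \<mu> y step unfolding linear_between_def by simp
    then show ?case
      using y step gen[OF i(1)] i(2) a H_car' alg.subspace_add[OF cartan_H(1)]
      by (simp add: brk_add_left brk_scale_left alg.scale_left_distrib)
  qed
  then show ?thesis ..
qed

lemma H_commute: "h \<in> H \<Longrightarrow> h' \<in> H \<Longrightarrow> brk L h h' = 0"
proof -
  assume h: "h \<in> H" and h': "h' \<in> H"
  have z: "linear_between (scl L) H (*) (\<lambda>_. 0)" by (simp add: linear_between_def)
  have 1: "brk L k (hh j) = 0" if "k \<in> H" "j < r" for k j
    using H_acts[OF that(1) gen_car(3)[OF that(2)] z] relations that(2) by simp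
  have "brk L (hh i) h' = 0" if "i < r" for i
    using 1[OF h' that] even_comm[OF _ H_car'[OF h'], of "hh i"] gen_parts[OF that]
    by (simp add: minus_equation_iff)
  then show ?thesis using H_acts[OF h H_car'[OF h'] z] by simp
qed

end

sublocale contragredient_lsa \<subseteq> lsa_weights L H
  by unfold_locales (use cartan_H H_commute in auto)

context contragredient_lsa
begin

lemma \<alpha>_linear: "j < r \<Longrightarrow> linear_between (scl L) H (*) (\<alpha> j)"
  using \<alpha>_dual by (simp add: dual_def)

lemma e_root: "j < r \<Longrightarrow> e j \<in> root_space L H (\<alpha> j)"
  using H_acts[OF _ gen_car(1) \<alpha>_linear] relations \<alpha>_hh gen_car by (simp add: root_space_def)

lemma f_root: "j < r \<Longrightarrow> f j \<in> root_space L H (- \<alpha> j)"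
proof -
  assume j: "j < r"
  have "linear_between (scl L) H (*) (- \<alpha> j)"
    using dual_uminus[OF \<alpha>_dual[OF j]] by (simp add: dual_def)
  then show ?thesis
    using H_acts[OF _ gen_car(2)[OF j]] relations \<alpha>_hh gen_car(2)[OF j] j by (simp add: root_space_def)
qed

lemma car_weight_span: "car L \<subseteq> weight_span"
proof -
  have b: "v \<in> weight_span" if "v \<in> root_space L H \<mu>" "\<mu> \<in> dual L H" for v \<mu>
    unfolding weight_span_def using that by (intro alg.span_base) blast
  have "hh j \<in> weight_span" if "j < r" for j
    by (rule b[OF subsetD[OF H_subset_root_space hh_H[OF that]] dual_zero])
  then have "e ` {..<r} \<union> f ` {..<r} \<union> hh ` {..<r} \<subseteq> weight_span"
    using b[OF e_root \<alpha>_dual] b[OF f_root dual_uminus[OF \<alpha>_dual]] by auto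
  then have "weight_span = car L" by (intro generation conjI subalgebra_weight_span)
  then show ?thesis by simp
qed

end

sublocale contragredient_lsa \<subseteq> cartan_lsa L H frm
  by unfold_locales (use cartan form car_weight_span in auto)

context contragredient_lsa
begin

lemma e_nonzero: "j < r \<Longrightarrow> e j \<noteq> 0"
proof
  assume j: "j < r" and "e j = 0"
  then have "hh j = 0" using relations[OF j j] brk_zero_left gen_car(2) by simp
  then have "0 \<in> hh ` {..<r}" using j by force
  from alg.dependent_zero[OF this] show False using indep_hh by (rule notE[rotated])
qed

text \<open>In the coordinates of \<open>s\<close> this is a homogeneous linear system with matrix
  \<open>A\<close>.\<close>

lemma \<alpha>_separate:
  assumes s: "s \<in> H" and 0: "\<And>j. j < r \<Longrightarrow> \<alpha> j s = 0"
  shows "s = 0"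
proof -
  obtain c where c: "s = (\<Sum>i<r. scl L (c i) (hh i))" using H_coords[OF s] by blast
  have "(\<Sum>i<r. c i * A $$ (i, j)) = \<alpha> j s" if j: "j < r" for j
  proof -
    have m: "m \<le> r \<Longrightarrow> (\<Sum>i<m. scl L (c i) (hh i)) \<in> H \<and>
        \<alpha> j (\<Sum>i<m. scl L (c i) (hh i)) = (\<Sum>i<m. c i * A $$ (i, j))" for m
    proof (induction m)
      case 0
      have "\<alpha> j (scl L 0 0) = 0 * \<alpha> j 0"
        using \<alpha>_linear[OF j] alg.subspace_0[OF subspace_H] unfolding linear_between_def by blast
      then show ?case using alg.subspace_0[OF subspace_H] by simp
    next
      case (Suc m)
      then have "hh m \<in> H" "scl L (c m) (hh m) \<in> H"
        using hh_H alg.subspace_scale[OF subspace_H] by auto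
      then show ?case
        using Suc \<alpha>_linear[OF j] \<alpha>_hh[OF _ j, of m] alg.subspace_add[OF subspace_H]
        by (simp add: linear_between_def)
    qed
    show ?thesis using m[of r] c by simp
  qed
  then have "c i = 0" if "i < r" for i using nonsingular 0 that by metis
  then show ?thesis unfolding c by (intro sum.neutral) auto
qed

end

text \<open>The simple root vectors \<open>e j\<close> are nonzero weight vectors, so the oscillator
  argument gives \<alpha>_j(s) = 0 for the centre s = [x, y] and every j, and the simple roots
  separate \<open>H\<close>.\<close>

sublocale contragredient_lsa \<subseteq> heisenberg_free L H frm
proof
  fix \<gamma> x y
  assume \<gamma>: "\<gamma> \<in> dual L H" "\<gamma> \<noteq> 0" and x: "x \<in> root_space L H \<gamma>" "x \<in> part L False"
    and y: "y \<in> root_space L H (- \<gamma>)" "y \<in> part L False"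
    and s: "brk L x y \<in> H" and sx: "brk L (brk L x y) x = 0"
  show "brk L x y = 0"
  proof (rule \<alpha>_separate[OF s])
    fix j assume j: "j < r"
    show "\<alpha> j (brk L x y) = 0"
      by (rule heisenberg_central[OF \<gamma> x y refl s sx e_root[OF j] \<alpha>_dual[OF j] e_nonzero[OF j]])
  qed
qed

lemma matrix_lsa_ds_setting:
  assumes "lie_superalgebra L" "cartan_subalgebra L H" "invariant_form L frm"
    and "matrix_iso L d P \<phi>" "matrix_coords L H m ne nd \<phi> eps del"
  shows "ds_setting L H frm"
proof -
  interpret matrix_lsa L H frm d P \<phi>
    using assms by unfold_locales (auto simp: matrix_coords_def)
  show ?thesis by unfold_locales
qed

lemma contragredient_ds_setting:
  assumes "lie_superalgebra L" "cartan_subalgebra L H" "invariant_form L frm"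
    and "contragredient L H r A e f hh" "\<And>j. j < r \<Longrightarrow> \<alpha> j \<in> dual L H"
    and "\<forall>i<r. \<forall>j<r. \<alpha> j (hh i) = A $$ (i, j)"
    and "\<And>c i. (\<And>j. j < r \<Longrightarrow> (\<Sum>i<r. c i * A $$ (i, j)) = 0) \<Longrightarrow> i < r \<Longrightarrow> c i = 0"
  shows "ds_setting L H frm"
proof -
  interpret contragredient_lsa L H frm r A e f hh \<alpha>
    using assms by unfold_locales auto
  show ?thesis by unfold_locales
qed

text \<open>The one case distinction on the type of the algebra; everything else is uniform. For the
  exceptional types it amounts to the invertibility of the Cartan matrix.\<close>

lemma realizes_ds_setting:
  assumes X: "admissible X" and L: "lie_superalgebra L" "cartan_subalgebra L H" "invariant_form L frm"
    and real: "realizes X L H eps del"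
  shows "ds_setting L H frm"
proof (cases X)
  case (GL m n)
  then show ?thesis using real matrix_lsa_ds_setting[OF L] by auto
next
  case (SL m n)
  then show ?thesis using real matrix_lsa_ds_setting[OF L] by auto
next
  case (OSP m n)
  then show ?thesis using real matrix_lsa_ds_setting[OF L] by auto
next
  case (D21 a)
  then obtain e f hh where c: "contragredient L H 3 (D21_cartan a) e f hh"
      "\<forall>i<3. \<forall>j<3. D21_simple eps j (hh i) = D21_cartan a $$ (i, j)"
    and eps: "\<forall>i\<in>{1..3}. eps i \<in> dual L H"
    using real by auto
  show ?thesis
  proof (rule contragredient_ds_setting[OF L c(1) _ c(2)])
    show "D21_simple eps j \<in> dual L H" if "j < 3" for j
      using that eps[rule_format, of 1] eps[rule_format, of 2] eps[rule_format, of 3]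
      by (auto simp: D21_simple_def dual_def linear_between_def numeral_3_eq_3 less_Suc_eq algebra_simps)
    fix c :: "nat \<Rightarrow> complex" and i :: nat
    assume c: "\<And>j. j < 3 \<Longrightarrow> (\<Sum>i<3. c i * D21_cartan a $$ (i, j)) = 0" and i: "i < 3"
    \<comment> \<open>The determinant of the Cartan matrix is 2 (1 + a); the combination below
      eliminates c_1 and c_2 and leaves the factor 1 + a.\<close>
    have a: "1 + a \<noteq> 0" using X D21 by (simp add: add_eq_0_iff)
    have 0: "- c 1 - c 2 = 0" and 1: "c 0 + 2 * c 1 = 0" and 2: "a * c 0 + 2 * c 2 = 0"
      using c[of 0] c[of 1] c[of 2]
      by (simp_all add: D21_cartan_def mat_of_rows_list_def numeral_3_eq_3 numeral_2_eq_2 lessThan_Suc algebra_simps)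
    have "(1 + a) * c 0 = (c 0 + 2 * c 1) + (a * c 0 + 2 * c 2) + 2 * (- c 1 - c 2)" by (simp add: algebra_simps)
    also have "\<dots> = 0" unfolding 0 1 2 by simp
    finally have "c 0 = 0" using a by simp
    then show "c i = 0" using 1 2 i by (auto simp: numeral_3_eq_3 less_Suc_eq numeral_2_eq_2)
  qed
next
  case F4
  then obtain e f hh where c: "contragredient L H 4 F4_cartan e f hh"
      "\<forall>i<4. \<forall>j<4. F4_simple eps del j (hh i) = F4_cartan $$ (i, j)"
    and eps: "\<forall>i\<in>{1..3}. eps i \<in> dual L H" "del 1 \<in> dual L H"
    using real by auto
  show ?thesis
  proof (rule contragredient_ds_setting[OF L c(1) _ c(2)])
    show "F4_simple eps del j \<in> dual L H" if "j < 4" for j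
      using that eps(2) eps(1)[rule_format, of 1] eps(1)[rule_format, of 2] eps(1)[rule_format, of 3]
      by (auto simp: F4_simple_def dual_def linear_between_def eval_nat_numeral less_Suc_eq field_simps)
    fix c :: "nat \<Rightarrow> complex" and i :: nat
    assume c: "\<And>j. j < 4 \<Longrightarrow> (\<Sum>i<4. c i * F4_cartan $$ (i, j)) = 0" and i: "i < 4"
    have 0: "c 1 = 0" and 1: "c 0 + 2 * c 1 - c 2 = 0" and 2: "- 2 * c 1 + 2 * c 2 - c 3 = 0"
      and 3: "- c 2 + 2 * c 3 = 0"
      using c[of 0] c[of 1] c[of 2] c[of 3]
      by (simp_all add: F4_cartan_def mat_of_rows_list_def eval_nat_numeral lessThan_Suc algebra_simps)
    \<comment> \<open>The factor 3 is the determinant of the lower right A_2 block, which remains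
      once c_1 = 0.\<close>
    have "3 * c 3 = (- 2 * c 1 + 2 * c 2 - c 3) + 2 * (- c 2 + 2 * c 3) + 2 * c 1" by (simp add: algebra_simps)
    also have "\<dots> = 0" by (subst 2, subst 3, subst 0) simp
    finally have c3: "c 3 = 0" by simp
    then have c2: "c 2 = 0" using 3 by simp
    then have "c 0 = 0" using 0 1 by simp
    then show "c i = 0" using 0 c2 c3 i by (auto simp: eval_nat_numeral less_Suc_eq)
  qed
next
  case G3
  then obtain e f hh where c: "contragredient L H 3 G3_cartan e f hh"
      "\<forall>i<3. \<forall>j<3. G3_simple eps del j (hh i) = G3_cartan $$ (i, j)"
    and eps: "\<forall>i\<in>{1..3}. eps i \<in> dual L H" "del 1 \<in> dual L H"
    using real by auto
  show ?thesis
  proof (rule contragredient_ds_setting[OF L c(1) _ c(2)])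
    show "G3_simple eps del j \<in> dual L H" if "j < 3" for j
      using that eps(2) eps(1)[rule_format, of 1] eps(1)[rule_format, of 2] eps(1)[rule_format, of 3]
      by (auto simp: G3_simple_def dual_def linear_between_def eval_nat_numeral less_Suc_eq algebra_simps)
    fix c :: "nat \<Rightarrow> complex" and i :: nat
    assume c: "\<And>j. j < 3 \<Longrightarrow> (\<Sum>i<3. c i * G3_cartan $$ (i, j)) = 0" and i: "i < 3"
    have 0: "c 1 = 0" and 1: "c 0 + 2 * c 1 - c 2 = 0" and 2: "- 3 * c 1 + 2 * c 2 = 0"
      using c[of 0] c[of 1] c[of 2]
      by (simp_all add: G3_cartan_def mat_of_rows_list_def eval_nat_numeral lessThan_Suc algebra_simps)
    have c2: "c 2 = 0" using 0 2 by simp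
    then have "c 0 = 0" using 0 1 by simp
    then show "c i = 0" using 0 c2 i by (auto simp: eval_nat_numeral less_Suc_eq)
  qed
qed

theorem theorem10:
  fixes X :: lsa_type
    and L :: "'g::ab_group_add lie_super"
    and H gx :: "'g set"
    and frm :: "'g \<Rightarrow> 'g \<Rightarrow> complex"
    and eps del :: "nat \<Rightarrow> 'g \<Rightarrow> complex"
    and k :: nat
    and \<beta> :: "nat \<Rightarrow> 'g \<Rightarrow> complex"
    and B :: "('g \<Rightarrow> complex) set"
    and x :: 'g
    and xr :: "nat \<Rightarrow> 'g"
    and ds :: "('g \<Rightarrow> complex) \<Rightarrow> ('g \<Rightarrow> complex)"
    and f :: "'g \<Rightarrow> complex"
  assumes "admissible X"
    and "lie_superalgebra L"
    and "cartan_subalgebra L H"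
    and "invariant_form L frm"
    and "realizes X L H eps del"
    and "B = \<beta> ` {..<k}"
    and "B \<subseteq> isotropic_roots L H frm"
    and "\<forall>i<k. \<forall>j<k. i \<noteq> j \<longrightarrow> dual_form H frm (\<beta> i) (\<beta> j) = 0"
    and "lin_indep_family k \<beta>"
    and "\<forall>i<k. xr i \<in> root_space L H (\<beta> i) \<and> xr i \<noteq> 0"
    and "x = (\<Sum>i<k. xr i)"
    and "ds_subalgebra L H frm B x gx"
    and "ds_hom L H gx x ds"
    and "f \<in> carrier (supchar_ring L H)"
  shows
    "ds f = restrict f (H \<inter> gx)
   \<and> (1 \<le> num_eps X \<and> 1 \<le> num_del X \<and> B = {\<lambda>h. eps 1 h - del 1 h} \<longrightarrow>
        pullback L H B gx (ds f) = restrict f {h \<in> H. eps 1 h = del 1 h})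
   \<and> (X = F4 \<and> B = {\<lambda>h. (eps 1 h + eps 2 h + eps 3 h - del 1 h) / 2} \<longrightarrow>
        pullback L H B gx (ds f) =
          restrict f {h \<in> H. del 1 h / 2 = eps 1 h / 2 + eps 2 h / 2 + eps 3 h / 2})
   \<and> ((\<exists>\<alpha>. X = D21 \<alpha>) \<and> B = {\<lambda>h. eps 1 h - eps 2 h - eps 3 h} \<longrightarrow>
        pullback L H B gx (ds f) = restrict f {h \<in> H. eps 1 h = eps 2 h + eps 3 h})
   \<and> (\<forall>(a :: nat \<Rightarrow> complex) (b :: nat \<Rightarrow> complex) r s.
        (\<forall>i<k. a i \<in> {1, - 1} \<and> b i \<in> {1, - 1} \<and>
               r i \<in> {1..num_eps X} \<and> s i \<in> {1..num_del X} \<and>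
               \<beta> i = (\<lambda>h. a i * eps (r i) h - b i * del (s i) h)) \<longrightarrow>
        pullback L H B gx (ds f) =
          restrict f {h \<in> H. \<forall>i<k. a i * eps (r i) h = b i * del (s i) h})
   \<and> pullback L H B gx (ds f) = restrict f {h \<in> H. \<forall>i<k. \<beta> i h = 0}"
proof -
  interpret ds_setting L H frm by (rule realizes_ds_setting[OF assms(1-5)])
  interpret ds_data L H frm k \<beta> B xr x gx
    by unfold_locales (fact assms)+
  note ds = ds_eq_restrict[OF assms(13,14)]
  note pullback = pullback_ds_eq_restrict[OF assms(13,14)]
  \<comment> \<open>All pullback claims have the restriction of \<open>f\<close> to the common
    kernel on the right. It remains to identify this kernel with each of the listed loci.\<close>
  have ker: "common_kernel H B = {h \<in> H. \<forall>i<k. \<beta> i h = 0}"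
    by (auto simp: common_kernel_def assms(6))
  have "common_kernel H B = {h \<in> H. eps 1 h = del 1 h}" if "B = {\<lambda>h. eps 1 h - del 1 h}"
    unfolding common_kernel_def that by auto
  moreover have "common_kernel H B = {h \<in> H. del 1 h / 2 = eps 1 h / 2 + eps 2 h / 2 + eps 3 h / 2}"
    if "B = {\<lambda>h. (eps 1 h + eps 2 h + eps 3 h - del 1 h) / 2}"
    unfolding common_kernel_def that by (auto simp: field_simps)
  moreover have "common_kernel H B = {h \<in> H. eps 1 h = eps 2 h + eps 3 h}"
    if "B = {\<lambda>h. eps 1 h - eps 2 h - eps 3 h}"
    unfolding common_kernel_def that by (auto simp: algebra_simps)
  moreover have "common_kernel H B = {h \<in> H. \<forall>i<k. a i * eps (r i) h = b i * del (s i) h}"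
    if "\<forall>i<k. \<beta> i = (\<lambda>h. a i * eps (r i) h - b i * del (s i) h)" for a b r s
    unfolding ker using that by auto
  ultimately show ?thesis
    unfolding pullback by (intro conjI allI impI ds) (auto simp: ker)
qed

end
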